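(* Consider the RPSP in the following form: given a finite ground set $N$, reward sets $A_1,\dots,A_h\subseteq N$ with rewards $a_i\ge 0$ and penalty sets $B_1,\dots,B_l\subseteq N$ with penalties $b_j\ge 0$, find $X\subseteq N$ maximizing $$\sum_{i:\,A_i\cap X\neq\emptyset} a_i-\sum_{j:\,B_j\subseteq X} b_j .$$ Suppose the collection $\mathcal{S}=\{A_1,\dots,A_h\}\cup\{B_1,\dots,B_l\}$ is laminar, and the reward sets are pairwise distinct and the penalty sets are pairwise distinct. Let $G$ be the directed graph with one node $u_S$ for each $S\in\mathcal{S}$ and an arc $(u_{S_1},u_{S_2})$ whenever $S_2\subseteq S_1$, and let $n$ and $m$ denote the number of nodes and arcs of $G$. Then this laminar RPSP can be solved in time $O(m(n+m)+T_{MF}(n,m))$.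
   Context: A collection $\mathcal{S}$ of sets is laminar if for any $S_1,S_2\in\mathcal{S}$ either $S_1\cap S_2=\emptyset$ or one of them is contained in the other. A reward set may coincide with a penalty set. $T_{MF}(n,m)$ denotes the running time of a maximum-profit flow (circulation) computation in a network with $O(n)$ nodes and $O(m)$ arcs. *)

theory Defs
  imports Complex_Main "Graph_Theory.Digraph"
begin

section \<open>A real RAM\<close>

text \<open>
  Running times refer to the usual unit-cost real RAM, presented as a small while language. A
  program works on finitely many named arrays with two indices, holding either natural numbers
  (used for indices and combinatorial data) or real numbers; a scalar is the cell with indices 0, 0.
  Naturals can only be added, subtracted (truncated at 0) and compared. Reals support the four field
  operations, comparison and rational constants; there is no conversion from reals to naturals
  (no floor), so real arithmetic cannot be abused for indexing.
\<close>

datatype nexp =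
    NConst nat
  | NCell string nexp nexp
  | NPlus nexp nexp
  | NMinus nexp nexp

datatype rexp =
    RConst rat
  | RCell string nexp nexp
  | RPlus rexp rexp
  | RMinus rexp rexp
  | RTimes rexp rexp
  | RDivide rexp rexp

datatype bexp =
    NLess nexp nexp
  | RLess rexp rexp
  | BNot bexp
  | BAnd bexp bexp

datatype com =
    Skip
  | NAssign string nexp nexp nexp
  | RAssign string nexp nexp rexp
  | Seq com com
  | If bexp com com
  | While bexp com

record state =
  nmem :: "string \<Rightarrow> nat \<Rightarrow> nat \<Rightarrow> nat"
  rmem :: "string \<Rightarrow> nat \<Rightarrow> nat \<Rightarrow> real"

primrec nval :: "nexp \<Rightarrow> state \<Rightarrow> nat" where
  "nval (NConst k) s = k"
| "nval (NCell x i j) s = nmem s x (nval i s) (nval j s)"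
| "nval (NPlus e1 e2) s = nval e1 s + nval e2 s"
| "nval (NMinus e1 e2) s = nval e1 s - nval e2 s"

primrec rval :: "rexp \<Rightarrow> state \<Rightarrow> real" where
  "rval (RConst q) s = of_rat q"
| "rval (RCell x i j) s = rmem s x (nval i s) (nval j s)"
| "rval (RPlus e1 e2) s = rval e1 s + rval e2 s"
| "rval (RMinus e1 e2) s = rval e1 s - rval e2 s"
| "rval (RTimes e1 e2) s = rval e1 s * rval e2 s"
| "rval (RDivide e1 e2) s = rval e1 s / rval e2 s"

primrec bval :: "bexp \<Rightarrow> state \<Rightarrow> bool" where
  "bval (NLess e1 e2) s \<longleftrightarrow> nval e1 s < nval e2 s"
| "bval (RLess e1 e2) s \<longleftrightarrow> rval e1 s < rval e2 s"
| "bval (BNot b) s \<longleftrightarrow> \<not> bval b s"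
| "bval (BAnd b1 b2) s \<longleftrightarrow> bval b1 s \<and> bval b2 s"

definition upd :: "(string \<Rightarrow> nat \<Rightarrow> nat \<Rightarrow> 'v) \<Rightarrow> string \<Rightarrow> nat \<Rightarrow> nat \<Rightarrow> 'v \<Rightarrow>
    (string \<Rightarrow> nat \<Rightarrow> nat \<Rightarrow> 'v)" where
  "upd M x i j v = M(x := (M x)(i := (M x i)(j := v)))"

text \<open>
  \<open>exec P s t s'\<close>: started in state \<open>s\<close>, the program \<open>P\<close> halts in state \<open>s'\<close> after \<open>t\<close> steps. An
  assignment or a test counts as one step; the expressions occurring in a program have constant
  size, so charging their individual operations would change running times only by a constant factor
  depending on the program.
\<close>

inductive exec :: "com \<Rightarrow> state \<Rightarrow> nat \<Rightarrow> state \<Rightarrow> bool" where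
  Skip: "exec Skip s 1 s"
| NAssign: "exec (NAssign x i j e) s 1
    (s\<lparr>nmem := upd (nmem s) x (nval i s) (nval j s) (nval e s)\<rparr>)"
| RAssign: "exec (RAssign x i j e) s 1
    (s\<lparr>rmem := upd (rmem s) x (nval i s) (nval j s) (rval e s)\<rparr>)"
| Seq: "exec c1 s t1 s' \<Longrightarrow> exec c2 s' t2 s'' \<Longrightarrow> exec (Seq c1 c2) s (t1 + t2) s''"
| IfTrue: "bval b s \<Longrightarrow> exec c1 s t s' \<Longrightarrow> exec (If b c1 c2) s (Suc t) s'"
| IfFalse: "\<not> bval b s \<Longrightarrow> exec c2 s t s' \<Longrightarrow> exec (If b c1 c2) s (Suc t) s'"
| WhileFalse: "\<not> bval b s \<Longrightarrow> exec (While b c) s 1 s"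
| WhileTrue: "bval b s \<Longrightarrow> exec c s t1 s' \<Longrightarrow> exec (While b c) s' t2 s'' \<Longrightarrow>
    exec (While b c) s (Suc (t1 + t2)) s''"

definition scalar :: "'v \<Rightarrow> nat \<Rightarrow> nat \<Rightarrow> 'v::zero" where
  "scalar v = (\<lambda>i j. if i = 0 \<and> j = 0 then v else 0)"

definition vector :: "nat \<Rightarrow> (nat \<Rightarrow> 'v) \<Rightarrow> nat \<Rightarrow> nat \<Rightarrow> 'v::zero" where
  "vector k f = (\<lambda>i j. if i < k \<and> j = 0 then f i else 0)"

text \<open>
  A family of \<open>k\<close> finite sets, the \<open>i\<close>-th one enumerated by the list \<open>L i\<close>, is stored by the sizes,
  the elements in the order of the enumeration, and the characteristic vectors. Thus the size of a
  set, its \<open>j\<close>-th element, and a membership test are available in one step each.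
\<close>

definition sizes :: "nat \<Rightarrow> (nat \<Rightarrow> nat list) \<Rightarrow> nat \<Rightarrow> nat \<Rightarrow> nat" where
  "sizes k L = vector k (\<lambda>i. length (L i))"

definition elements :: "nat \<Rightarrow> (nat \<Rightarrow> nat list) \<Rightarrow> nat \<Rightarrow> nat \<Rightarrow> nat" where
  "elements k L = (\<lambda>i j. if i < k \<and> j < length (L i) then L i ! j else 0)"

definition members :: "nat \<Rightarrow> (nat \<Rightarrow> nat list) \<Rightarrow> nat \<Rightarrow> nat \<Rightarrow> nat" where
  "members k L = (\<lambda>i x. if i < k \<and> x \<in> set (L i) then 1 else 0)"

definition enumerates :: "nat list \<Rightarrow> nat set \<Rightarrow> bool" where
  "enumerates xs S \<longleftrightarrow> distinct xs \<and> set xs = S"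


section \<open>Maximum-profit circulations\<close>

record network =
  graph :: "(nat, nat) pre_digraph"
  capacity :: "nat \<Rightarrow> real"
  profit :: "nat \<Rightarrow> real"

text \<open>Parallel arcs and loops are allowed.\<close>

definition flow_network :: "network \<Rightarrow> bool" where
  "flow_network D \<longleftrightarrow> fin_digraph (graph D) \<and>
     verts (graph D) = {..<card (verts (graph D))} \<and>
     arcs (graph D) = {..<card (arcs (graph D))} \<and>
     (\<forall>e\<in>arcs (graph D). 0 \<le> capacity D e)"

definition circulation :: "network \<Rightarrow> (nat \<Rightarrow> real) \<Rightarrow> bool" where
  "circulation D f \<longleftrightarrow>
     (\<forall>e\<in>arcs (graph D). 0 \<le> f e \<and> f e \<le> capacity D e) \<and>
     (\<forall>v\<in>verts (graph D). (\<Sum>e\<in>in_arcs (graph D) v. f e) = (\<Sum>e\<in>out_arcs (graph D) v. f e))"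

definition flow_profit :: "network \<Rightarrow> (nat \<Rightarrow> real) \<Rightarrow> real" where
  "flow_profit D f = (\<Sum>e\<in>arcs (graph D). profit D e * f e)"

definition max_profit_circulation :: "network \<Rightarrow> (nat \<Rightarrow> real) \<Rightarrow> bool" where
  "max_profit_circulation D f \<longleftrightarrow> circulation D f \<and>
     (\<forall>g. circulation D g \<longrightarrow> flow_profit D g \<le> flow_profit D f)"

definition network_input :: "network \<Rightarrow> state" where
  "network_input D = (let n = card (verts (graph D)); m = card (arcs (graph D)) in
     \<lparr>nmem = (\<lambda>_ _ _. 0)
        (''n'' := scalar n,
         ''m'' := scalar m,
         ''tail'' := vector m (tail (graph D)),
         ''head'' := vector m (head (graph D))),
      rmem = (\<lambda>_ _ _. 0)
        (''capacity'' := vector m (capacity D),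
         ''profit'' := vector m (profit D))\<rparr>)"

text \<open>
  \<open>T n m\<close> is, up to a constant factor, a bound on the running time of one fixed program computing
  maximum-profit circulations in networks with \<open>O(n)\<close> nodes and \<open>O(m)\<close> arcs. The constant \<open>d\<close> may
  depend on the constant \<open>c\<close> hidden in \<open>O(n)\<close> and \<open>O(m)\<close>, but the program may not.
\<close>

definition max_profit_circulation_time :: "(nat \<Rightarrow> nat \<Rightarrow> nat) \<Rightarrow> bool" where
  "max_profit_circulation_time T \<longleftrightarrow>
     (\<exists>Q. \<forall>c. \<exists>d. \<forall>n m D. flow_network D \<and>
        card (verts (graph D)) \<le> c * n \<and> card (arcs (graph D)) \<le> c * m \<longrightarrow>
        (\<exists>t s'. exec Q (network_input D) t s' \<and> t \<le> d * T n m \<and>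
           max_profit_circulation D (\<lambda>e. rmem s' ''flow'' e 0)))"


section \<open>The reward-penalty-selection problem\<close>

text \<open>
  The sets are indexed from 0: the reward sets are \<open>reward_set I i\<close> for \<open>i < num_rewards I\<close>, the
  penalty sets \<open>penalty_set I j\<close> for \<open>j < num_penalties I\<close>.
\<close>

record rpsp =
  ground :: "nat set"
  num_rewards :: nat
  reward_set :: "nat \<Rightarrow> nat set"
  reward :: "nat \<Rightarrow> real"
  num_penalties :: nat
  penalty_set :: "nat \<Rightarrow> nat set"
  penalty :: "nat \<Rightarrow> real"

definition rpsp_instance :: "rpsp \<Rightarrow> bool" where
  "rpsp_instance I \<longleftrightarrow> finite (ground I) \<and>
     (\<forall>i<num_rewards I. reward_set I i \<subseteq> ground I \<and> 0 \<le> reward I i) \<and>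
     (\<forall>j<num_penalties I. penalty_set I j \<subseteq> ground I \<and> 0 \<le> penalty I j)"

definition rpsp_value :: "rpsp \<Rightarrow> nat set \<Rightarrow> real" where
  "rpsp_value I X =
     (\<Sum>i | i < num_rewards I \<and> reward_set I i \<inter> X \<noteq> {}. reward I i) -
     (\<Sum>j | j < num_penalties I \<and> penalty_set I j \<subseteq> X. penalty I j)"

definition rpsp_optimal :: "rpsp \<Rightarrow> nat set \<Rightarrow> bool" where
  "rpsp_optimal I X \<longleftrightarrow> X \<subseteq> ground I \<and> (\<forall>Y\<subseteq>ground I. rpsp_value I Y \<le> rpsp_value I X)"

definition rpsp_family :: "rpsp \<Rightarrow> nat set set" where
  "rpsp_family I = reward_set I ` {..<num_rewards I} \<union> penalty_set I ` {..<num_penalties I}"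

definition laminar :: "'a set set \<Rightarrow> bool" where
  "laminar \<S> \<longleftrightarrow> (\<forall>S1\<in>\<S>. \<forall>S2\<in>\<S>. S1 \<inter> S2 = {} \<or> S1 \<subseteq> S2 \<or> S2 \<subseteq> S1)"

definition containment_digraph :: "'a set set \<Rightarrow> ('a set, 'a set \<times> 'a set) pre_digraph" where
  "containment_digraph \<S> =
     \<lparr>verts = \<S>, arcs = {(S1, S2). S1 \<in> \<S> \<and> S2 \<in> \<S> \<and> S2 \<subseteq> S1}, tail = fst, head = snd\<rparr>"

text \<open>
  The initial states representing the instance: the elements of each set may be listed in any order,
  and every cell not used for the input is 0. The containment digraph is not part of the input.
\<close>

definition rpsp_input :: "rpsp \<Rightarrow> state \<Rightarrow> bool" where
  "rpsp_input I s \<longleftrightarrow> (let h = num_rewards I; l = num_penalties I in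
     \<exists>N A B. enumerates N (ground I) \<and>
       (\<forall>i<h. enumerates (A i) (reward_set I i)) \<and>
       (\<forall>j<l. enumerates (B j) (penalty_set I j)) \<and>
       s = \<lparr>nmem = (\<lambda>_ _ _. 0)
              (''h'' := scalar h,
               ''l'' := scalar l,
               ''N_size'' := sizes 1 (\<lambda>_. N),
               ''N_elem'' := elements 1 (\<lambda>_. N),
               ''N_mem'' := members 1 (\<lambda>_. N),
               ''A_size'' := sizes h A,
               ''A_elem'' := elements h A,
               ''A_mem'' := members h A,
               ''B_size'' := sizes l B,
               ''B_elem'' := elements l B,
               ''B_mem'' := members l B),
            rmem = (\<lambda>_ _ _. 0)
              (''a'' := vector h (reward I),
               ''b'' := vector l (penalty I))\<rparr>)"

text \<open>The selection must be written out explicitly, as a list of elements.\<close>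

definition rpsp_output :: "state \<Rightarrow> nat set" where
  "rpsp_output s = nmem s ''X_elem'' 0 ` {..<nmem s ''X_size'' 0 0}"

end

theory Submission
  imports Defs
begin

text \<open>
  No flow computation is needed. Call a set of the family covered if all its elements belong to the
  set \<open>Z\<close> of those \<open>x\<close> for which \<open>{x}\<close> is a set of the family. The remaining sets can all be hit
  without being contained in the selection: whenever a reward set that is not covered is disjoint
  from the current selection, one of its elements outside \<open>Z\<close> is added; by laminarity, this could
  only complete a singleton of the family, whose element would lie in \<open>Z\<close>. So it suffices to find
  an optimal subset of \<open>Z\<close> for the covered sets. These are taken in the order of their sizes, which
  makes each one a union of blocks merged before. For every block, the values of the empty
  selection, of the full one and of a best nonempty proper one determine the corresponding values
  after a merger. Each covered set contributes as many arcs to the containment digraph as it has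
  elements, so this takes time \<open>O(m (n + m))\<close>. Laminarity makes it unnecessary to read the other,
  possibly huge, sets beyond their first element outside \<open>Z\<close>.
\<close>

section \<open>Reasoning about programs\<close>

text \<open>The bound involves only the numbers of nodes and arcs of the containment digraph, while
  the ground set and the sets may be arbitrarily larger. Three values per block suffice because a
  covered set of larger size contains each present block or is disjoint from it: it sees only
  whether the selection in the block is empty, full or in between. Adding the item of a whole block
  shifts all nonempty proper selections by the same amount, so the recorded best one stays best.
  Blocks exist only as labels, and a merger rewrites labels by a pass over all of \<open>Z\<close>.
  This crude update is affordable: \<open>Z\<close> has at most h + l elements, which is at most 2
  n, and each listed element of a covered set causes at most one merger. Empty sets never enter a
  block: an empty reward set earns nothing and an empty penalty set is always paid, whatever is
  selected.\<close>

definition runs :: "com \<Rightarrow> state \<Rightarrow> nat \<Rightarrow> (state \<Rightarrow> bool) \<Rightarrow> bool" where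
  "runs c s k Q \<longleftrightarrow> (\<exists>t s'. exec c s t s' \<and> t \<le> k \<and> Q s')"

primrec nwrites :: "com \<Rightarrow> string set" where
  "nwrites Skip = {}"
| "nwrites (NAssign x i j e) = {x}"
| "nwrites (RAssign x i j e) = {}"
| "nwrites (Seq c1 c2) = nwrites c1 \<union> nwrites c2"
| "nwrites (If b c1 c2) = nwrites c1 \<union> nwrites c2"
| "nwrites (While b c) = nwrites c"

primrec rwrites :: "com \<Rightarrow> string set" where
  "rwrites Skip = {}"
| "rwrites (NAssign x i j e) = {}"
| "rwrites (RAssign x i j e) = {x}"
| "rwrites (Seq c1 c2) = rwrites c1 \<union> rwrites c2"
| "rwrites (If b c1 c2) = rwrites c1 \<union> rwrites c2"
| "rwrites (While b c) = rwrites c"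

text \<open>Arrays that a command never names as a target keep their contents. The rules for
  sequences and loops supply this fact, so postconditions and invariants need only speak of the
  arrays that are written.\<close>

definition frame :: "com \<Rightarrow> state \<Rightarrow> state \<Rightarrow> bool" where
  "frame c s s' \<longleftrightarrow>
     (\<forall>x. x \<notin> nwrites c \<longrightarrow> nmem s' x = nmem s x) \<and> (\<forall>x. x \<notin> rwrites c \<longrightarrow> rmem s' x = rmem s x)"

text \<open>Loop-free code is executed symbolically: the simplifier computes \<open>effect\<close>,
  and \<open>max_steps\<close> bounds the time, so invariants are needed only around loops.\<close>

primrec loop_free :: "com \<Rightarrow> bool" where
  "loop_free Skip \<longleftrightarrow> True"
| "loop_free (NAssign x i j e) \<longleftrightarrow> True"
| "loop_free (RAssign x i j e) \<longleftrightarrow> True"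
| "loop_free (Seq c1 c2) \<longleftrightarrow> loop_free c1 \<and> loop_free c2"
| "loop_free (If b c1 c2) \<longleftrightarrow> loop_free c1 \<and> loop_free c2"
| "loop_free (While b c) \<longleftrightarrow> False"

text \<open>The values of \<open>effect\<close> and \<open>max_steps\<close> on loops are irrelevant.\<close>

primrec effect :: "com \<Rightarrow> state \<Rightarrow> state" where
  "effect Skip s = s"
| "effect (NAssign x i j e) s = s\<lparr>nmem := upd (nmem s) x (nval i s) (nval j s) (nval e s)\<rparr>"
| "effect (RAssign x i j e) s = s\<lparr>rmem := upd (rmem s) x (nval i s) (nval j s) (rval e s)\<rparr>"
| "effect (Seq c1 c2) s = effect c2 (effect c1 s)"
| "effect (If b c1 c2) s = (if bval b s then effect c1 s else effect c2 s)"
| "effect (While b c) s = s"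

primrec max_steps :: "com \<Rightarrow> nat" where
  "max_steps Skip = 1"
| "max_steps (NAssign x i j e) = 1"
| "max_steps (RAssign x i j e) = 1"
| "max_steps (Seq c1 c2) = max_steps c1 + max_steps c2"
| "max_steps (If b c1 c2) = Suc (max (max_steps c1) (max_steps c2))"
| "max_steps (While b c) = 0"

lemma upd_apply [simp]:
  "upd M x i j v y i' j' = (if y = x \<and> i' = i \<and> j' = j then v else M y i' j')"
  by (auto simp: upd_def)

lemma upd_other [simp]: "y \<noteq> x \<Longrightarrow> upd M x i j v y = M y"
  by (simp add: upd_def)

lemma exec_frame: "exec c s t s' \<Longrightarrow> frame c s s'"
  unfolding frame_def by (induction rule: exec.induct) auto

lemma frame_nmem: "frame c s s' \<Longrightarrow> x \<notin> nwrites c \<Longrightarrow> nmem s' x = nmem s x"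
  by (simp add: frame_def)

lemma frame_rmem: "frame c s s' \<Longrightarrow> x \<notin> rwrites c \<Longrightarrow> rmem s' x = rmem s x"
  by (simp add: frame_def)

lemma exec_time_pos: "exec c s t s' \<Longrightarrow> 0 < t"
  by (induction rule: exec.induct) auto

lemma runs_mono:
  assumes "runs c s k Q" "k \<le> k'" "\<And>s'. Q s' \<Longrightarrow> frame c s s' \<Longrightarrow> Q' s'"
  shows "runs c s k' Q'"
  using assms exec_frame unfolding runs_def by (meson order_trans)

lemma runs_Seq:
  assumes "runs c1 s k1 Q1" and "\<And>s'. Q1 s' \<Longrightarrow> frame c1 s s' \<Longrightarrow> runs c2 s' k2 Q"
  shows "runs (Seq c1 c2) s (k1 + k2) Q"
proof -
  obtain t1 s1 where 1: "exec c1 s t1 s1" "t1 \<le> k1" "Q1 s1"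
    using assms(1) unfolding runs_def by blast
  then obtain t2 s2 where 2: "exec c2 s1 t2 s2" "t2 \<le> k2" "Q s2"
    using assms(2) exec_frame unfolding runs_def by blast
  have "exec (Seq c1 c2) s (t1 + t2) s2"
    using 1 2 exec.Seq by blast
  then show ?thesis
    using 1 2 unfolding runs_def by (meson add_mono)
qed

lemma runs_If:
  assumes "bval b s \<Longrightarrow> runs c1 s k Q" and "\<not> bval b s \<Longrightarrow> runs c2 s k Q"
  shows "runs (If b c1 c2) s (Suc k) Q"
  using assms unfolding runs_def by (meson Suc_le_mono exec.IfFalse exec.IfTrue)

lemma exec_effect: "loop_free c \<Longrightarrow> \<exists>t\<le>max_steps c. exec c s t (effect c s)"
proof (induction c arbitrary: s)
  case (Seq c1 c2)
  then obtain t1 t2 where "t1 \<le> max_steps c1" "exec c1 s t1 (effect c1 s)"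
    "t2 \<le> max_steps c2" "exec c2 (effect c1 s) t2 (effect c2 (effect c1 s))"
    by (metis loop_free.simps(4))
  then show ?case
    by (auto intro!: exI[of _ "t1 + t2"] exec.Seq)
next
  case (If b c1 c2)
  then obtain t1 t2 where "t1 \<le> max_steps c1" "exec c1 s t1 (effect c1 s)"
    "t2 \<le> max_steps c2" "exec c2 s t2 (effect c2 s)"
    by (metis loop_free.simps(5))
  then show ?case
    by (cases "bval b s")
      (auto intro: exI[of _ "Suc t1"] exec.IfTrue, auto intro: exI[of _ "Suc t2"] exec.IfFalse)
qed (auto intro!: exI[of _ 1] exec.intros[unfolded One_nat_def])

lemma runs_loop_free:
  assumes "loop_free c" "max_steps c \<le> k" "Q (effect c s)"
  shows "runs c s k Q"
  using exec_effect[OF assms(1), of s] assms(2,3) unfolding runs_def by (meson order_trans)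

lemma runs_Seq_loop_free:
  assumes "loop_free c1" "runs c2 (effect c1 s) k Q"
  shows "runs (Seq c1 c2) s (max_steps c1 + k) Q"
  by (rule runs_Seq[where ?Q1.0 = "\<lambda>s'. s' = effect c1 s"])
    (use assms in \<open>auto intro: runs_loop_free\<close>)

lemma runs_Seq_NAssign:
  "runs c (effect (NAssign x i j e) s) k Q \<Longrightarrow> runs (Seq (NAssign x i j e) c) s (Suc k) Q"
  using runs_Seq_loop_free[of "NAssign x i j e"] by simp

lemma runs_Seq_RAssign:
  "runs c (effect (RAssign x i j e) s) k Q \<Longrightarrow> runs (Seq (RAssign x i j e) c) s (Suc k) Q"
  using runs_Seq_loop_free[of "RAssign x i j e"] by simp

lemma runs_le: "runs c s k Q \<Longrightarrow> k \<le> k' \<Longrightarrow> runs c s k' Q"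
  by (rule runs_mono)

text \<open>The potential \<open>\<phi>\<close> bounds the number of remaining steps.\<close>

lemma runs_While:
  assumes "I s"
    and pos: "\<And>s'. I s' \<Longrightarrow> 0 < \<phi> s'"
    and step: "\<And>s'. I s' \<Longrightarrow> bval b s' \<Longrightarrow>
      \<exists>k. runs c s' k (\<lambda>s''. I s'' \<and> Suc (k + \<phi> s'') \<le> \<phi> s')"
  shows "runs (While b c) s (\<phi> s) (\<lambda>s'. I s' \<and> \<not> bval b s')"
  using \<open>I s\<close>
proof (induction "\<phi> s" arbitrary: s rule: less_induct)
  case less
  show ?case
  proof (cases "bval b s")
    case False
    then show ?thesis
      using less.prems pos exec.WhileFalse unfolding runs_def by (metis One_nat_def Suc_leI)
  next
    case True
    obtain k t1 s1 where 1: "exec c s t1 s1" "t1 \<le> k" "I s1" "Suc (k + \<phi> s1) \<le> \<phi> s"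
      using step[OF less.prems True] unfolding runs_def by blast
    then obtain t2 s2 where 2: "exec (While b c) s1 t2 s2" "t2 \<le> \<phi> s1" "I s2" "\<not> bval b s2"
      using less.hyps[of s1] unfolding runs_def by (metis Suc_le_lessD add_lessD1 add.commute)
    have "exec (While b c) s (Suc (t1 + t2)) s2"
      using True 1 2 exec.WhileTrue by blast
    moreover have "Suc (t1 + t2) \<le> \<phi> s"
      using 1 2 by linarith
    ultimately show ?thesis
      using 2 unfolding runs_def by blast
  qed
qed

section \<open>Counting loops\<close>

abbreviation N0 :: nexp where "N0 \<equiv> NConst 0"
abbreviation N1 :: nexp where "N1 \<equiv> NConst 1"
abbreviation Var :: "string \<Rightarrow> nexp" where "Var x \<equiv> NCell x N0 N0"
abbreviation Set :: "string \<Rightarrow> nexp \<Rightarrow> com" where "Set x e \<equiv> NAssign x N0 N0 e"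

definition NEq :: "nexp \<Rightarrow> nexp \<Rightarrow> bexp" where
  "NEq e1 e2 = BAnd (BNot (NLess e1 e2)) (BNot (NLess e2 e1))"

lemma bval_NEq [simp]: "bval (NEq e1 e2) s \<longleftrightarrow> nval e1 s = nval e2 s"
  by (auto simp: NEq_def)

definition For :: "string \<Rightarrow> nexp \<Rightarrow> com \<Rightarrow> com" where
  "For x e c = Seq (Set x N0) (While (NLess (Var x) e) (Seq c (Set x (NPlus (Var x) N1))))"

lemma nwrites_For [simp]: "nwrites (For x e c) = insert x (nwrites c)"
  by (simp add: For_def)

lemma rwrites_For [simp]: "rwrites (For x e c) = rwrites c"
  by (simp add: For_def)

text \<open>The round number is passed to \<open>I\<close> separately, so \<open>I\<close> has to
  survive any value of the loop variable; the bound is evaluated at every test, so its value has to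
  persist. Each round pays two steps besides the body, for test and increment; the final 2 pays for
  the initialisation and the failing test.\<close>

lemma runs_For:
  assumes init: "I 0 s"
    and var: "\<And>i k s'. I i s' \<Longrightarrow> I i (s'\<lparr>nmem := upd (nmem s') x 0 0 k\<rparr>)"
    and bound: "\<And>i s'. I i s' \<Longrightarrow> frame (For x e c) s s' \<Longrightarrow> nval e s' = n"
    and fresh: "x \<notin> nwrites c"
    and step: "\<And>i s'. i < n \<Longrightarrow> I i s' \<Longrightarrow> nmem s' x 0 0 = i \<Longrightarrow> frame (For x e c) s s' \<Longrightarrow>
      runs c s' (\<tau> i) (I (Suc i))"
  shows "runs (For x e c) s ((\<Sum>i<n. \<tau> i + 2) + 2) (I n)"
proof -
  let ?J = "\<lambda>s'. nmem s' x 0 0 \<le> n \<and> I (nmem s' x 0 0) s' \<and> frame (For x e c) s s'"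
  let ?\<phi> = "\<lambda>s'. (\<Sum>i = nmem s' x 0 0..<n. \<tau> i + 2) + 1"
  let ?b = "NLess (Var x) e" and ?c = "Seq c (Set x (NPlus (Var x) N1))"
  let ?s = "s\<lparr>nmem := upd (nmem s) x 0 0 0\<rparr>"
  have "runs (While ?b ?c) ?s (?\<phi> ?s) (\<lambda>s'. ?J s' \<and> \<not> bval ?b s')"
  proof (rule runs_While)
    show "?J ?s"
      using var[OF init] by (simp add: frame_def)
  next
    fix s' assume J: "?J s'" and b: "bval ?b s'"
    let ?i = "nmem s' x 0 0"
    have i: "?i < n"
      using J b bound[of ?i s'] by simp
    have "runs ?c s' (\<tau> ?i + 1) (\<lambda>s''. ?J s'' \<and> nmem s'' x 0 0 = Suc ?i)"
    proof (rule runs_Seq)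
      show "runs c s' (\<tau> ?i) (I (Suc ?i))"
        using step i J by blast
    next
      fix s'' assume s'': "I (Suc ?i) s''" "frame c s' s''"
      have eq: "nmem s'' x 0 0 = ?i"
        using s'' fresh by (simp add: frame_def)
      show "runs (Set x (NPlus (Var x) N1)) s'' 1 (\<lambda>s''. ?J s'' \<and> nmem s'' x 0 0 = Suc ?i)"
        by (rule runs_loop_free) (use s'' J i eq var in \<open>auto simp: frame_def\<close>)
    qed
    moreover have "?\<phi> s' = \<tau> ?i + 2 + ((\<Sum>i = Suc ?i..<n. \<tau> i + 2) + 1)"
      using i by (simp add: sum.atLeast_Suc_lessThan)
    ultimately show "\<exists>k. runs ?c s' k (\<lambda>s''. ?J s'' \<and> Suc (k + ?\<phi> s'') \<le> ?\<phi> s')"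
      by (intro exI[of _ "\<tau> ?i + 1"]) (erule runs_mono, auto)
  qed simp
  then have loop: "runs (While ?b ?c) ?s ((\<Sum>i<n. \<tau> i + 2) + 1) (I n)"
  proof (rule runs_mono)
    fix s' assume "?J s' \<and> \<not> bval ?b s'"
    then show "I n s'"
      using bound[of "nmem s' x 0 0" s'] by (metis bval.simps(1) le_antisym not_less nval.simps(1,2))
  qed (simp add: atLeast0LessThan)
  have "runs (Set x N0) s 1 (\<lambda>s'. s' = ?s)"
    by (rule runs_loop_free) auto
  then have "runs (For x e c) s (1 + ((\<Sum>i<n. \<tau> i + 2) + 1)) (I n)"
    unfolding For_def by (rule runs_Seq) (use loop in blast)
  then show ?thesis
    by simp
qed

lemma runs_For_uniform:
  assumes init: "I 0 s"
    and var: "\<And>i k s'. I i s' \<Longrightarrow> I i (s'\<lparr>nmem := upd (nmem s') x 0 0 k\<rparr>)"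
    and bound: "\<And>i s'. I i s' \<Longrightarrow> frame (For x e c) s s' \<Longrightarrow> nval e s' = n"
    and fresh: "x \<notin> nwrites c"
    and step: "\<And>i s'. i < n \<Longrightarrow> I i s' \<Longrightarrow> nmem s' x 0 0 = i \<Longrightarrow> frame (For x e c) s s' \<Longrightarrow>
      runs c s' k (I (Suc i))"
  shows "runs (For x e c) s (n * (k + 2) + 2) (I n)"
  using runs_For[of I s x e c n "\<lambda>_. k"] assms by simp

section \<open>Optimal selections in unions of blocks\<close>

text \<open>An abstraction of the objective as a sum of terms that each depend on one set of
  \<open>F\<close> and vanish on selections missing that set. Joining two blocks uses nothing else
  about it.\<close>

definition separable :: "(nat set \<Rightarrow> real) \<Rightarrow> nat set set \<Rightarrow> bool" where
  "separable v F \<longleftrightarrow>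
     v {} = 0 \<and> (\<forall>X Y. (\<forall>S\<in>F. S \<inter> X = {} \<or> S \<inter> Y = {}) \<longrightarrow> v (X \<union> Y) = v X + v Y)"

text \<open>
  Three kinds of selections in a block \<open>U\<close> are distinguished: 0 is the empty one, 1 is \<open>U\<close>, and 2 is
  a best nonempty proper subset of \<open>U\<close>, recorded in \<open>sol\<close> with its value \<open>p\<close>; \<open>f\<close> is the value of
  \<open>U\<close>. The flag \<open>k\<close> is 0 iff kind 2 does not exist, in which case \<open>p\<close> is meaningless.
\<close>

definition block_table :: "(nat set \<Rightarrow> real) \<Rightarrow> nat set \<Rightarrow> nat set \<Rightarrow> nat \<Rightarrow> real \<Rightarrow> real \<Rightarrow> bool" where
  "block_table v U sol k p f \<longleftrightarrow> f = v U \<and>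
     (if k = 0 then \<exists>x. U = {x}
      else U \<inter> sol \<noteq> {} \<and> U \<inter> sol \<noteq> U \<and> p = v (U \<inter> sol) \<and>
        (\<forall>X\<subseteq>U. X \<noteq> {} \<longrightarrow> X \<noteq> U \<longrightarrow> v X \<le> p))"

definition choice :: "nat \<Rightarrow> nat set \<Rightarrow> nat set \<Rightarrow> nat set" where
  "choice c U sol = (if c = 0 then {} else if c = 1 then U else U \<inter> sol)"

definition choice_value :: "nat \<Rightarrow> real \<Rightarrow> real \<Rightarrow> real" where
  "choice_value c p f = (if c = 0 then 0 else if c = 1 then f else p)"

definition admissible :: "nat \<Rightarrow> nat \<Rightarrow> bool" where
  "admissible c k \<longleftrightarrow> c < 2 \<or> c = 2 \<and> k \<noteq> 0"

lemma value_choice: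
  assumes "block_table v U sol k p f" "admissible c k" "v {} = 0"
  shows "v (choice c U sol) = choice_value c p f"
  using assms by (auto simp: block_table_def choice_def choice_value_def admissible_def)

lemma choice_eq_iff:
  assumes "block_table v U sol k p f" "admissible c k" "U \<noteq> {}"
  shows "choice c U sol = {} \<longleftrightarrow> c = 0" and "choice c U sol = U \<longleftrightarrow> c = 1"
  using assms by (auto simp: block_table_def choice_def admissible_def)

text \<open>By maximality of the recorded proper selection, the part of a selection inside a block
  can be replaced by the representative of its kind without loss. Emptiness and fullness are
  preserved. In a block with flag 0, a singleton, the third kind does not arise.\<close>

lemma ex_choice_ge:
  assumes "block_table v U sol k p f" "U \<noteq> {}" "v {} = 0" "X \<subseteq> U"
  obtains c where "admissible c k" "c = 0 \<longleftrightarrow> X = {}" "c = 1 \<longleftrightarrow> X = U" "v X \<le> choice_value c p f"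
proof -
  consider "X = {}" | "X = U" | "X \<noteq> {}" "X \<noteq> U"
    by blast
  then show ?thesis
  proof cases
    case 1
    then show ?thesis
      using that[of 0] assms by (auto simp: admissible_def choice_value_def)
  next
    case 2
    then show ?thesis
      using that[of 1] assms by (auto simp: admissible_def choice_value_def block_table_def)
  next
    case 3
    then show ?thesis
      using that[of 2] assms
      by (auto simp: admissible_def choice_value_def block_table_def subset_singleton_iff split: if_splits)
  qed
qed

text \<open>A selection is nonempty and proper in the union iff its two traces are neither both
  empty nor both full. Values add over the two blocks, so the optimum is a maximum over pairs of
  kinds. The new flag is 1 because the union of two disjoint nonempty blocks always has a nonempty
  proper subset.\<close>

lemma block_table_join:
  assumes U: "block_table v U sol k p f" "U \<noteq> {}" and W: "block_table v W sol k' p' f'" "W \<noteq> {}"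
    and disj: "U \<inter> W = {}" and "v {} = 0"
    and add: "\<And>X Y. X \<subseteq> U \<Longrightarrow> Y \<subseteq> W \<Longrightarrow> v (X \<union> Y) = v X + v Y"
    and st: "admissible s k" "admissible t k'" "(s, t) \<noteq> (0, 0)" "(s, t) \<noteq> (1, 1)"
    and best: "best = choice_value s p f + choice_value t p' f'"
    and max: "\<And>s' t'. admissible s' k \<Longrightarrow> admissible t' k' \<Longrightarrow> (s', t') \<noteq> (0, 0) \<Longrightarrow>
      (s', t') \<noteq> (1, 1) \<Longrightarrow> choice_value s' p f + choice_value t' p' f' \<le> best"
    and sol': "(U \<union> W) \<inter> sol' = choice s U sol \<union> choice t W sol"
  shows "block_table v (U \<union> W) sol' 1 best (f + f')"
proof -
  let ?X = "choice s U sol" and ?Y = "choice t W sol"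
  have sub: "?X \<subseteq> U" "?Y \<subseteq> W"
    by (auto simp: choice_def)
  have "f + f' = v (U \<union> W)"
    using U W add by (auto simp: block_table_def)
  moreover have "best = v (?X \<union> ?Y)"
    using add[OF sub] best value_choice[OF U(1) st(1) \<open>v {} = 0\<close>]
      value_choice[OF W(1) st(2) \<open>v {} = 0\<close>] by simp
  moreover have "?X \<union> ?Y \<noteq> {}"
    using choice_eq_iff[OF U(1) st(1) U(2)] choice_eq_iff[OF W(1) st(2) W(2)] st(3) by auto
  moreover have "?X \<union> ?Y \<noteq> U \<union> W"
    using choice_eq_iff[OF U(1) st(1) U(2)] choice_eq_iff[OF W(1) st(2) W(2)] st(4) sub disj by blast
  moreover have "v X \<le> best" if X: "X \<subseteq> U \<union> W" "X \<noteq> {}" "X \<noteq> U \<union> W" for X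
  proof -
    obtain s' where s': "admissible s' k" "s' = 0 \<longleftrightarrow> X \<inter> U = {}" "s' = 1 \<longleftrightarrow> X \<inter> U = U"
      "v (X \<inter> U) \<le> choice_value s' p f"
      using ex_choice_ge[OF U \<open>v {} = 0\<close>, of "X \<inter> U"] by auto
    obtain t' where t': "admissible t' k'" "t' = 0 \<longleftrightarrow> X \<inter> W = {}" "t' = 1 \<longleftrightarrow> X \<inter> W = W"
      "v (X \<inter> W) \<le> choice_value t' p' f'"
      using ex_choice_ge[OF W \<open>v {} = 0\<close>, of "X \<inter> W"] by auto
    have "X = (X \<inter> U) \<union> (X \<inter> W)"
      using X by blast
    then have "v X = v (X \<inter> U) + v (X \<inter> W)"
      using add[of "X \<inter> U" "X \<inter> W"] by auto
    also have "\<dots> \<le> choice_value s' p f + choice_value t' p' f'"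
      using s' t' by linarith
    also have "\<dots> \<le> best"
    proof (rule max)
      show "(s', t') \<noteq> (0, 0)" "(s', t') \<noteq> (1, 1)"
        using X s' t' by auto
    qed (use s' t' in auto)
    finally show ?thesis .
  qed
  ultimately show ?thesis
    unfolding block_table_def sol' by simp
qed

lemma block_table_cong:
  assumes "block_table v U sol k p f" "\<And>X. X \<subseteq> U \<Longrightarrow> v' X = v X" "U \<inter> sol' = U \<inter> sol"
  shows "block_table v' U sol' k p f"
proof -
  have "v' (U \<inter> sol) = v (U \<inter> sol)" "v' U = v U"
    using assms(2) by auto
  then show ?thesis
    using assms(1) unfolding block_table_def assms(3) by (cases "k = 0") (simp_all add: assms(2), metis)
qed

text \<open>Every nonempty selection in the block earns the reward, but only the full one pays the
  penalty. All nonempty proper selections thus change by the same amount, and the best of them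
  remains best.\<close>

lemma block_table_add_item:
  assumes "block_table v U sol k p f" "U \<noteq> {}"
    and "\<And>X. v' X = v X + (if U \<inter> X \<noteq> {} then a else 0) - (if U \<subseteq> X then b else 0)"
  shows "block_table v' U sol k (p + a) (f + a - b)"
proof -
  have "v' X = v X + a" if "X \<subseteq> U" "X \<noteq> {}" "X \<noteq> U" for X
    using that assms(3)[of X] by auto
  moreover have "v' U = v U + a - b"
    using assms by simp
  ultimately show ?thesis
    using assms(1) by (cases "k = 0") (simp_all add: block_table_def, metis add_right_mono)
qed

section \<open>Blocks as classes of a labelling, and the objective as a set function\<close>

definition block :: "nat set \<Rightarrow> (nat \<Rightarrow> nat) \<Rightarrow> nat \<Rightarrow> nat set" where
  "block Z lab c = {x \<in> Z. lab x = c}"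

definition uniform :: "(nat \<Rightarrow> nat) \<Rightarrow> nat set \<Rightarrow> bool" where
  "uniform lab S \<longleftrightarrow> (\<forall>x\<in>S. \<forall>y\<in>S. lab x = lab y)"

text \<open>For \<open>S \<subseteq> Z\<close> this makes \<open>S\<close> a union of blocks,
  whereas \<open>uniform\<close> confines \<open>S\<close> to a single block.\<close>

definition saturated :: "nat set \<Rightarrow> (nat \<Rightarrow> nat) \<Rightarrow> nat set \<Rightarrow> bool" where
  "saturated Z lab S \<longleftrightarrow> (\<forall>x\<in>S. \<forall>y\<in>Z. lab y = lab x \<longrightarrow> y \<in> S)"

text \<open>The objective restricted to reward indices \<open>R\<close> and penalty indices
  \<open>Q\<close>. Conditional summands keep the index sets independent of \<open>X\<close>, so
  items can be inserted one at a time.\<close>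

definition gain :: "(nat \<Rightarrow> nat set) \<Rightarrow> (nat \<Rightarrow> real) \<Rightarrow> (nat \<Rightarrow> nat set) \<Rightarrow> (nat \<Rightarrow> real) \<Rightarrow>
    nat set \<Rightarrow> nat set \<Rightarrow> nat set \<Rightarrow> real" where
  "gain A a B b R Q X =
     (\<Sum>i\<in>R. if A i \<inter> X \<noteq> {} then a i else 0) - (\<Sum>j\<in>Q. if B j \<subseteq> X then b j else 0)"

text \<open>A set that misses \<open>X\<close> or \<open>Y\<close> reacts to the other one alone.
  Nonemptiness is needed for penalties: an empty penalty set is contained in every selection and
  would be counted twice in the sum.\<close>

lemma separable_gain:
  assumes "\<And>S. S \<in> A ` R \<union> B ` Q \<Longrightarrow> S \<noteq> {}"
  shows "separable (gain A a B b R Q) (A ` R \<union> B ` Q)"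
  unfolding separable_def
proof (intro conjI allI impI)
  show "gain A a B b R Q {} = 0"
    using assms by (auto simp: gain_def intro!: sum.neutral)
next
  fix X Y assume sep: "\<forall>S\<in>A ` R \<union> B ` Q. S \<inter> X = {} \<or> S \<inter> Y = {}"
  have "(\<Sum>i\<in>R. if A i \<inter> (X \<union> Y) \<noteq> {} then a i else 0) =
      (\<Sum>i\<in>R. (if A i \<inter> X \<noteq> {} then a i else 0) + (if A i \<inter> Y \<noteq> {} then a i else 0))"
    using sep by (intro sum.cong) auto
  moreover have "(\<Sum>j\<in>Q. if B j \<subseteq> X \<union> Y then b j else 0) =
      (\<Sum>j\<in>Q. (if B j \<subseteq> X then b j else 0) + (if B j \<subseteq> Y then b j else 0))"
  proof (intro sum.cong refl)
    fix j assume "j \<in> Q"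
    then have "B j \<noteq> {}" "B j \<inter> X = {} \<or> B j \<inter> Y = {}"
      using assms sep by auto
    then show "(if B j \<subseteq> X \<union> Y then b j else 0) =
        (if B j \<subseteq> X then b j else 0) + (if B j \<subseteq> Y then b j else 0)"
    proof (elim disjE)
      assume "B j \<inter> X = {}"
      then have "\<not> B j \<subseteq> X" "B j \<subseteq> X \<union> Y \<longleftrightarrow> B j \<subseteq> Y"
        using \<open>B j \<noteq> {}\<close> by blast+
      then show ?thesis
        by simp
    next
      assume "B j \<inter> Y = {}"
      then have "\<not> B j \<subseteq> Y" "B j \<subseteq> X \<union> Y \<longleftrightarrow> B j \<subseteq> X"
        using \<open>B j \<noteq> {}\<close> by blast+
      then show ?thesis
        by simp
    qed
  qed
  ultimately show "gain A a B b R Q (X \<union> Y) = gain A a B b R Q X + gain A a B b R Q Y"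
    by (simp add: gain_def sum.distrib)
qed

lemma gain_insert_reward:
  "finite R \<Longrightarrow> i \<notin> R \<Longrightarrow>
    gain A a B b (insert i R) Q X = gain A a B b R Q X + (if A i \<inter> X \<noteq> {} then a i else 0)"
  by (simp add: gain_def)

lemma gain_insert_penalty:
  "finite Q \<Longrightarrow> j \<notin> Q \<Longrightarrow>
    gain A a B b R (insert j Q) X = gain A a B b R Q X - (if B j \<subseteq> X then b j else 0)"
  by (simp add: gain_def)

section \<open>Merging blocks\<close>

abbreviation label :: "state \<Rightarrow> nat \<Rightarrow> nat" where
  "label s x \<equiv> nmem s ''lab'' x 0"

abbreviation selected :: "state \<Rightarrow> nat set" where
  "selected s \<equiv> {x. nmem s ''sol'' x 0 = 1}"

text \<open>The row of a block is addressed by its label. Rows of labels no longer in use may hold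
  anything.\<close>

definition block_tables :: "(nat set \<Rightarrow> real) \<Rightarrow> nat set \<Rightarrow> state \<Rightarrow> bool" where
  "block_tables v Z s \<longleftrightarrow> (\<forall>c\<in>label s ` Z.
     block_table v (block Z (label s) c) (selected s)
       (nmem s ''ok'' c 0) (rmem s ''p'' c 0) (rmem s ''f'' c 0))"

definition list_at :: "state \<Rightarrow> string \<Rightarrow> string \<Rightarrow> nat \<Rightarrow> nat list \<Rightarrow> bool" where
  "list_at s sz el i xs \<longleftrightarrow> nmem s sz i 0 = length xs \<and> (\<forall>j<length xs. nmem s el i j = xs ! j)"

text \<open>The kind is a number of the logic, not of the program: the case distinction is resolved
  when the program text is built.\<close>

definition value_exp :: "nat \<Rightarrow> string \<Rightarrow> rexp" where
  "value_exp c x =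
     (if c = 0 then RConst 0 else RCell (if c = 1 then ''f'' else ''p'') (Var x) N0)"

text \<open>\<open>NLess N0 N1\<close> is a test that always succeeds: kinds 0 and 1 exist in every
  block.\<close>

definition admissible_test :: "nat \<Rightarrow> string \<Rightarrow> bexp" where
  "admissible_test c x = (if c < 2 then NLess N0 N1 else NLess N0 (NCell ''ok'' (Var x) N0))"

definition try_pair :: "nat \<Rightarrow> nat \<Rightarrow> com" where
  "try_pair s t =
     If (BAnd (BAnd (admissible_test s ''c'') (admissible_test t ''d''))
          (RLess (RCell ''best'' N0 N0) (RPlus (value_exp s ''c'') (value_exp t ''d''))))
       (Seq (Set ''s'' (NConst s)) (Seq (Set ''t'' (NConst t))
         (RAssign ''best'' N0 N0 (RPlus (value_exp s ''c'') (value_exp t ''d'')))))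
       Skip"

primrec try_pairs :: "(nat \<times> nat) list \<Rightarrow> com" where
  "try_pairs [] = Skip"
| "try_pairs (st # L) = Seq (try_pair (fst st) (snd st)) (try_pairs L)"

text \<open>For kind 2 the flags stored for the block already describe the wanted selection. For
  kinds 0 and 1 the number of the kind is itself the flag to be written.\<close>

definition relabel_body :: com where
  "relabel_body =
     Seq (Set ''x'' (NCell ''Z_elem'' N0 (Var ''k'')))
       (If (NEq (NCell ''lab'' (Var ''x'') N0) (Var ''c''))
         (If (NLess (Var ''s'') (NConst 2)) (NAssign ''sol'' (Var ''x'') N0 (Var ''s'')) Skip)
         (If (NEq (NCell ''lab'' (Var ''x'') N0) (Var ''d''))
           (Seq (NAssign ''lab'' (Var ''x'') N0 (Var ''c''))
             (If (NLess (Var ''t'') (NConst 2)) (NAssign ''sol'' (Var ''x'') N0 (Var ''t'')) Skip))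
           Skip))"

definition relabel :: com where
  "relabel = For ''k'' (Var ''Z_size'')
     relabel_body"

text \<open>
  Together with the initial candidate \<open>(0, 1)\<close>, the listed pairs are the combinations of kinds of
  selections in the blocks \<open>c\<close> and \<open>d\<close> that amount to a nonempty proper subset of their union.
\<close>

definition join :: com where
  "join =
     Seq (RAssign ''best'' N0 N0 (value_exp 1 ''d''))
    (Seq (Set ''s'' N0)
    (Seq (Set ''t'' N1)
    (Seq (try_pairs [(1, 0), (0, 2), (2, 0), (2, 2), (2, 1), (1, 2)])
    (Seq relabel
    (Seq (RAssign ''p'' (Var ''c'') N0 (RCell ''best'' N0 N0))
    (Seq (RAssign ''f'' (Var ''c'') N0 (RPlus (value_exp 1 ''c'') (value_exp 1 ''d'')))
         (NAssign ''ok'' (Var ''c'') N0 N1)))))))"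

text \<open>The block of the first element absorbs all others, so \<open>c\<close> stays fixed
  during the loop and afterwards addresses the row of the merged block, where
  \<open>add_value\<close> expects it.\<close>

definition merge :: "string \<Rightarrow> string \<Rightarrow> com" where
  "merge sz el =
     Seq (Set ''c'' (NCell ''lab'' (NCell el (Var ''i'') N0) N0))
       (For ''j'' (NCell sz (Var ''i'') N0)
         (Seq (Set ''d'' (NCell ''lab'' (NCell el (Var ''i'') (Var ''j'')) N0))
           (If (NEq (Var ''d'') (Var ''c'')) Skip join)))"

lemma nwrites_try_pairs: "nwrites (try_pairs L) \<subseteq> {''s'', ''t''}"
  by (induction L) (auto simp: try_pair_def)

lemma rwrites_try_pairs: "rwrites (try_pairs L) \<subseteq> {''best''}"
  by (induction L) (auto simp: try_pair_def)

lemma nwrites_relabel: "nwrites relabel = {''k'', ''x'', ''sol'', ''lab''}"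
  by (auto simp: relabel_def relabel_body_def)

lemma rwrites_relabel: "rwrites relabel = {}"
  by (auto simp: relabel_def relabel_body_def)

lemma nwrites_join: "nwrites join = {''s'', ''t'', ''k'', ''x'', ''sol'', ''lab'', ''ok''}"
  by (auto simp: join_def nwrites_relabel try_pair_def)

lemma rwrites_join: "rwrites join = {''best'', ''p'', ''f''}"
  by (auto simp: join_def rwrites_relabel try_pair_def)

lemma nwrites_merge:
  "nwrites (merge sz el) = {''c'', ''d'', ''j'', ''s'', ''t'', ''k'', ''x'', ''sol'', ''lab'', ''ok''}"
  by (auto simp: merge_def nwrites_join)

lemma rwrites_merge: "rwrites (merge sz el) = {''best'', ''p'', ''f''}"
  by (auto simp: merge_def rwrites_join)

section \<open>Correctness of a join\<close>

definition pair_admissible :: "state \<Rightarrow> nat \<Rightarrow> nat \<Rightarrow> bool" where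
  "pair_admissible s x y \<longleftrightarrow> (x, y) \<noteq> (0, 0) \<and> (x, y) \<noteq> (1, 1) \<and>
     admissible x (nmem s ''ok'' (nmem s ''c'' 0 0) 0) \<and>
     admissible y (nmem s ''ok'' (nmem s ''d'' 0 0) 0)"

definition pair_value :: "state \<Rightarrow> nat \<Rightarrow> nat \<Rightarrow> real" where
  "pair_value s x y =
     choice_value x (rmem s ''p'' (nmem s ''c'' 0 0) 0) (rmem s ''f'' (nmem s ''c'' 0 0) 0) +
     choice_value y (rmem s ''p'' (nmem s ''d'' 0 0) 0) (rmem s ''f'' (nmem s ''d'' 0 0) 0)"

lemma rval_value_exp:
  "rval (value_exp c x) s =
     choice_value c (rmem s ''p'' (nmem s x 0 0) 0) (rmem s ''f'' (nmem s x 0 0) 0)"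
  by (simp add: value_exp_def choice_value_def)

lemma bval_admissible_test:
  "c \<le> 2 \<Longrightarrow> bval (admissible_test c x) s \<longleftrightarrow> admissible c (nmem s ''ok'' (nmem s x 0 0) 0)"
  by (auto simp: admissible_test_def admissible_def)

definition current_pair :: "state \<Rightarrow> bool" where
  "current_pair s \<longleftrightarrow> pair_admissible s (nmem s ''s'' 0 0) (nmem s ''t'' 0 0) \<and>
     rmem s ''best'' 0 0 = pair_value s (nmem s ''s'' 0 0) (nmem s ''t'' 0 0)"

lemma runs_try_pair:
  assumes "x \<le> 2" "y \<le> 2" "(x, y) \<noteq> (0, 0)" "(x, y) \<noteq> (1, 1)" "current_pair s"
  shows "runs (try_pair x y) s 4 (\<lambda>s'. current_pair s' \<and> rmem s ''best'' 0 0 \<le> rmem s' ''best'' 0 0 \<and>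
    (pair_admissible s x y \<longrightarrow> pair_value s x y \<le> rmem s' ''best'' 0 0))"
  by (rule runs_loop_free)
    (use assms in \<open>auto simp: try_pair_def current_pair_def pair_admissible_def pair_value_def
      rval_value_exp bval_admissible_test\<close>)

lemma pair_frame:
  assumes "frame (try_pairs L) s s'"
  shows "pair_admissible s' = pair_admissible s" "pair_value s' = pair_value s"
proof -
  have "nmem s' x = nmem s x" if "x \<in> {''ok'', ''c'', ''d''}" for x
    using that nwrites_try_pairs[of L] by (intro frame_nmem[OF assms]) auto
  moreover have "rmem s' x = rmem s x" if "x \<in> {''p'', ''f''}" for x
    using that rwrites_try_pairs[of L] by (intro frame_rmem[OF assms]) auto
  ultimately show "pair_admissible s' = pair_admissible s" "pair_value s' = pair_value s"
    by (auto simp: pair_admissible_def pair_value_def fun_eq_iff)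
qed

lemma runs_try_pairs:
  assumes "\<forall>(x, y)\<in>set L. x \<le> 2 \<and> y \<le> 2 \<and> (x, y) \<noteq> (0, 0) \<and> (x, y) \<noteq> (1, 1)" "current_pair s"
  shows "runs (try_pairs L) s (4 * length L + 1)
    (\<lambda>s'. current_pair s' \<and> rmem s ''best'' 0 0 \<le> rmem s' ''best'' 0 0 \<and>
      (\<forall>(x, y)\<in>set L. pair_admissible s x y \<longrightarrow> pair_value s x y \<le> rmem s' ''best'' 0 0))"
  using assms
proof (induction L arbitrary: s)
  case Nil
  then show ?case
    by (intro runs_loop_free) auto
next
  case (Cons st L)
  obtain x y where st: "st = (x, y)"
    by fastforce
  have "runs (try_pairs (st # L)) s (4 + (4 * length L + 1))
    (\<lambda>s'. current_pair s' \<and> rmem s ''best'' 0 0 \<le> rmem s' ''best'' 0 0 \<and>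
      (\<forall>(x, y)\<in>set (st # L). pair_admissible s x y \<longrightarrow> pair_value s x y \<le> rmem s' ''best'' 0 0))"
    unfolding try_pairs.simps st fst_conv snd_conv
  proof (rule runs_Seq)
    show "runs (try_pair x y) s 4 (\<lambda>s'. current_pair s' \<and> rmem s ''best'' 0 0 \<le> rmem s' ''best'' 0 0 \<and>
      (pair_admissible s x y \<longrightarrow> pair_value s x y \<le> rmem s' ''best'' 0 0))"
      by (rule runs_try_pair) (use Cons.prems st in auto)
  next
    fix s' assume s': "current_pair s' \<and> rmem s ''best'' 0 0 \<le> rmem s' ''best'' 0 0 \<and>
      (pair_admissible s x y \<longrightarrow> pair_value s x y \<le> rmem s' ''best'' 0 0)"
    assume "frame (try_pair x y) s s'"
    then have eq: "pair_admissible s' = pair_admissible s" "pair_value s' = pair_value s"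
      using pair_frame[of "[(x, y)]" s s'] by (auto simp: frame_def)
    have "runs (try_pairs L) s' (4 * length L + 1)
      (\<lambda>s''. current_pair s'' \<and> rmem s' ''best'' 0 0 \<le> rmem s'' ''best'' 0 0 \<and>
        (\<forall>(x, y)\<in>set L. pair_admissible s' x y \<longrightarrow> pair_value s' x y \<le> rmem s'' ''best'' 0 0))"
      using Cons.IH[of s'] Cons.prems(1) s' by simp
    then show "runs (try_pairs L) s' (4 * length L + 1)
      (\<lambda>s'. current_pair s' \<and> rmem s ''best'' 0 0 \<le> rmem s' ''best'' 0 0 \<and>
        (\<forall>(x, y)\<in>set ((x, y) # L). pair_admissible s x y \<longrightarrow>
          pair_value s x y \<le> rmem s' ''best'' 0 0))"
      by (rule runs_mono) (use s' in \<open>auto simp: eq\<close>)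
  qed
  moreover have "4 + (4 * length L + 1) = 4 * length (st # L) + 1"
    by simp
  ultimately show ?case
    by (simp only:)
qed

lemma runs_relabel:
  assumes Z: "list_at s ''Z_size'' ''Z_elem'' 0 Zs" "distinct Zs"
    and cd: "nmem s ''c'' 0 0 = c" "nmem s ''d'' 0 0 = d"
    and st: "nmem s ''s'' 0 0 = x" "nmem s ''t'' 0 0 = y" and "c \<noteq> d"
  shows "runs relabel s (length Zs * 8 + 2) (\<lambda>s'.
    (\<forall>z. label s' z = (if z \<in> set Zs \<and> label s z = d then c else label s z)) \<and>
    (\<forall>z. nmem s' ''sol'' z 0 =
      (if z \<in> set Zs \<and> label s z = c \<and> x < 2 then x
       else if z \<in> set Zs \<and> label s z = d \<and> y < 2 then y
       else nmem s ''sol'' z 0)))"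
proof -
  let ?I = "\<lambda>k s'. let Y = set (take k Zs) in
    (\<forall>z. label s' z = (if z \<in> Y \<and> label s z = d then c else label s z)) \<and>
    (\<forall>z. nmem s' ''sol'' z 0 =
      (if z \<in> Y \<and> label s z = c \<and> x < 2 then x
       else if z \<in> Y \<and> label s z = d \<and> y < 2 then y
       else nmem s ''sol'' z 0))"
  have "runs relabel s (length Zs * (6 + 2) + 2) (?I (length Zs))"
    unfolding relabel_def
  proof (rule runs_For_uniform[where I = ?I and n = "length Zs" and k = 6])
    fix k s' assume k: "k < length Zs" and I: "?I k s'" "nmem s' ''k'' 0 0 = k"
      and frame: "frame (For ''k'' (Var ''Z_size'') relabel_body) s s'"
    have fr: "nmem s' n = nmem s n" if "n \<in> {''Z_elem'', ''c'', ''d'', ''s'', ''t''}" for n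
      using that by (intro frame_nmem[OF frame]) (auto simp: relabel_body_def)
    have e: "nmem s ''Z_elem'' 0 k = Zs ! k"
      using Z k by (auto simp: list_at_def)
    have ins: "set (take (Suc k) Zs) = insert (Zs ! k) (set (take k Zs))"
      using k by (simp add: take_Suc_conv_app_nth)
    \<comment> \<open>An element moved from d to c would, on a second visit, be taken for an
      original member of c and receive the wrong flag.\<close>
    have new: "Zs ! k \<notin> set (take k Zs)"
      using k Z(2) by (auto simp: in_set_conv_nth nth_eq_iff_index_eq)
    have lab: "label s' z = (if z \<in> set (take k Zs) \<and> label s z = d then c else label s z)" for z
      using I(1) unfolding Let_def by blast
    have sol: "nmem s' ''sol'' z 0 = (if z \<in> set (take k Zs) \<and> label s z = c \<and> x < 2 then x
       else if z \<in> set (take k Zs) \<and> label s z = d \<and> y < 2 then y else nmem s ''sol'' z 0)" for z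
      using I(1) unfolding Let_def by blast
    show "runs relabel_body s' 6 (?I (Suc k))"
      by (rule runs_loop_free)
        (use new I(2) fr cd st \<open>c \<noteq> d\<close> in \<open>auto simp: relabel_body_def Let_def ins e lab sol\<close>)
  next
    fix k s' assume "frame (For ''k'' (Var ''Z_size'') relabel_body) s s'"
    then have "nmem s' ''Z_size'' = nmem s ''Z_size''"
      by (rule frame_nmem) (simp add: relabel_body_def)
    then show "nval (Var ''Z_size'') s' = length Zs"
      using Z by (simp add: list_at_def)
  qed (simp_all add: Let_def relabel_body_def)
  then show ?thesis
    by (rule runs_mono) (simp_all add: Let_def)
qed

lemma block_tables_cong:
  assumes "nmem s' ''lab'' = nmem s ''lab''" "nmem s' ''sol'' = nmem s ''sol''"
    "nmem s' ''ok'' = nmem s ''ok''" "rmem s' ''p'' = rmem s ''p''" "rmem s' ''f'' = rmem s ''f''"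
  shows "block_tables v Z s' = block_tables v Z s"
  using assms by (simp add: block_tables_def)

text \<open>Each set of \<open>F\<close> lies in one block, so none meets both c and d; this is what
  makes \<open>v\<close> additive across the two. The other rows remain valid because neither their
  labels nor their flags change.\<close>

lemma block_tables_join:
  assumes T: "block_tables v Z s" and sep: "separable v F"
    and uni: "\<And>S. S \<in> F \<Longrightarrow> uniform (label s) S"
    and cd: "c \<in> label s ` Z" "d \<in> label s ` Z" "c \<noteq> d"
    and pair: "admissible x (nmem s ''ok'' c 0)" "admissible y (nmem s ''ok'' d 0)"
      "(x, y) \<noteq> (0, 0)" "(x, y) \<noteq> (1, 1)"
    and best: "best = choice_value x (rmem s ''p'' c 0) (rmem s ''f'' c 0) +
      choice_value y (rmem s ''p'' d 0) (rmem s ''f'' d 0)"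
    and max: "\<And>x' y'. admissible x' (nmem s ''ok'' c 0) \<Longrightarrow> admissible y' (nmem s ''ok'' d 0) \<Longrightarrow>
      (x', y') \<noteq> (0, 0) \<Longrightarrow> (x', y') \<noteq> (1, 1) \<Longrightarrow>
      choice_value x' (rmem s ''p'' c 0) (rmem s ''f'' c 0) +
      choice_value y' (rmem s ''p'' d 0) (rmem s ''f'' d 0) \<le> best"
    and lab: "\<And>z. z \<in> Z \<Longrightarrow> label s' z = (if label s z = d then c else label s z)"
    and sol: "\<And>z. z \<in> Z \<Longrightarrow> nmem s' ''sol'' z 0 =
      (if label s z = c \<and> x < 2 then x else if label s z = d \<and> y < 2 then y else nmem s ''sol'' z 0)"
    and new: "nmem s' ''ok'' c 0 = 1" "rmem s' ''p'' c 0 = best"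
      "rmem s' ''f'' c 0 = rmem s ''f'' c 0 + rmem s ''f'' d 0"
    and old: "\<And>e. e \<noteq> c \<Longrightarrow> nmem s' ''ok'' e 0 = nmem s ''ok'' e 0"
      "\<And>e. e \<noteq> c \<Longrightarrow> rmem s' ''p'' e 0 = rmem s ''p'' e 0"
      "\<And>e. e \<noteq> c \<Longrightarrow> rmem s' ''f'' e 0 = rmem s ''f'' e 0"
  shows "block_tables v Z s'"
  unfolding block_tables_def
proof
  fix e assume "e \<in> label s' ` Z"
  then obtain z where z: "z \<in> Z" "e = label s' z"
    by blast
  show "block_table v (block Z (label s') e) (selected s')
    (nmem s' ''ok'' e 0) (rmem s' ''p'' e 0) (rmem s' ''f'' e 0)"
  proof (cases "e = c")
    case False
    have e: "e = label s z" "e \<noteq> d"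
      using z False lab by (auto split: if_splits)
    have "block Z (label s') e = block Z (label s) e"
      using lab False e by (auto simp: block_def split: if_splits)
    moreover have "block Z (label s) e \<inter> selected s' = block Z (label s) e \<inter> selected s"
      using sol False e(2) by (auto simp: block_def)
    moreover have "block_table v (block Z (label s) e) (selected s)
      (nmem s ''ok'' e 0) (rmem s ''p'' e 0) (rmem s ''f'' e 0)"
      using T z e by (auto simp: block_tables_def)
    ultimately show ?thesis
      using block_table_cong old[OF False] by (metis (no_types, lifting))
  next
    case True
    let ?U = "block Z (label s) c" and ?W = "block Z (label s) d"
    have "block_table v (?U \<union> ?W) (selected s') 1 best (rmem s ''f'' c 0 + rmem s ''f'' d 0)"
    proof (rule block_table_join)
      show "block_table v ?U (selected s) (nmem s ''ok'' c 0) (rmem s ''p'' c 0) (rmem s ''f'' c 0)"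
        "block_table v ?W (selected s) (nmem s ''ok'' d 0) (rmem s ''p'' d 0) (rmem s ''f'' d 0)"
        using T cd by (auto simp: block_tables_def)
      show "?U \<noteq> {}" "?W \<noteq> {}" "?U \<inter> ?W = {}"
        using cd by (auto simp: block_def)
      show "v {} = 0"
        using sep by (simp add: separable_def)
      show "v (X \<union> Y) = v X + v Y" if "X \<subseteq> ?U" "Y \<subseteq> ?W" for X Y
      proof -
        have "S \<inter> X = {} \<or> S \<inter> Y = {}" if "S \<in> F" for S
        proof (rule ccontr)
          assume "\<not> ?thesis"
          then obtain p q where "p \<in> S" "p \<in> X" "q \<in> S" "q \<in> Y"
            by blast
          moreover from this have "label s p = c" "label s q = d"
            using \<open>X \<subseteq> ?U\<close> \<open>Y \<subseteq> ?W\<close> unfolding block_def by blast+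
          moreover have "\<forall>x\<in>S. \<forall>y\<in>S. label s x = label s y"
            using uni[OF \<open>S \<in> F\<close>] unfolding uniform_def .
          ultimately show False
            using cd(3) by metis
        qed
        then show ?thesis
          using sep by (simp add: separable_def)
      qed
      have "?U \<inter> selected s' = choice x ?U (selected s)"
        using sol pair(1) cd(3) by (auto simp: block_def choice_def admissible_def split: if_splits)
      moreover have "?W \<inter> selected s' = choice y ?W (selected s)"
        using sol pair(2) cd(3) by (auto simp: block_def choice_def admissible_def split: if_splits)
      ultimately show "(?U \<union> ?W) \<inter> selected s' = choice x ?U (selected s) \<union> choice y ?W (selected s)"
        by (simp add: Int_Un_distrib2)
    qed (use pair best max in auto)
    moreover have "block Z (label s') c = ?U \<union> ?W"
      using lab by (auto simp: block_def split: if_splits)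
    ultimately show ?thesis
      using True new by simp
  qed
qed

text \<open>The 33 consists of three initial assignments, 25 steps for the six candidate pairs, 2
  for the relabelling loop and three final assignments.\<close>

lemma runs_join:
  assumes Z: "list_at s ''Z_size'' ''Z_elem'' 0 Zs" "distinct Zs"
    and T: "block_tables v (set Zs) s" and sep: "separable v F"
    and uni: "\<And>S. S \<in> F \<Longrightarrow> uniform (label s) S"
    and cd: "nmem s ''c'' 0 0 = c" "nmem s ''d'' 0 0 = d"
      "c \<in> label s ` set Zs" "d \<in> label s ` set Zs" "c \<noteq> d"
  shows "runs join s (length Zs * 8 + 33) (\<lambda>s'. block_tables v (set Zs) s' \<and>
    (\<forall>z\<in>set Zs. label s' z = (if label s z = d then c else label s z)))"
proof -
  let ?L = "[(1, 0), (0, 2), (2, 0), (2, 2), (2, 1), (1, 2)] :: (nat \<times> nat) list"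
  define s1 where "s1 = effect (Seq (RAssign ''best'' N0 N0 (value_exp 1 ''d''))
    (Seq (Set ''s'' N0) (Set ''t'' N1))) s"
  have n1: "nmem s1 n = nmem s n" if "n \<noteq> ''s''" "n \<noteq> ''t''" for n
    using that by (simp add: s1_def)
  have r1: "rmem s1 n = rmem s n" if "n \<noteq> ''best''" for n
    using that by (simp add: s1_def)
  have v1: "pair_value s1 = pair_value s" "pair_admissible s1 = pair_admissible s"
    by (simp_all add: pair_value_def pair_admissible_def n1 r1 fun_eq_iff)
  have best1: "rmem s1 ''best'' 0 0 = pair_value s 0 1"
    by (simp add: s1_def rval_value_exp pair_value_def choice_value_def)
  have cur1: "current_pair s1"
    using best1 by (simp add: current_pair_def v1)
      (simp add: s1_def pair_admissible_def admissible_def)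
  let ?Q2 = "\<lambda>s2. current_pair s2 \<and> rmem s1 ''best'' 0 0 \<le> rmem s2 ''best'' 0 0 \<and>
    (\<forall>(x, y)\<in>set ?L. pair_admissible s1 x y \<longrightarrow> pair_value s1 x y \<le> rmem s2 ''best'' 0 0)"
  let ?tail = "Seq (RAssign ''p'' (Var ''c'') N0 (RCell ''best'' N0 N0))
    (Seq (RAssign ''f'' (Var ''c'') N0 (RPlus (value_exp 1 ''c'') (value_exp 1 ''d'')))
      (NAssign ''ok'' (Var ''c'') N0 N1))"
  let ?Q = "\<lambda>s'. block_tables v (set Zs) s' \<and>
    (\<forall>z\<in>set Zs. label s' z = (if label s z = d then c else label s z))"
  have "runs (Seq (try_pairs ?L) (Seq relabel ?tail)) s1
    ((4 * length ?L + 1) + ((length Zs * 8 + 2) + 3)) ?Q"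
  proof (rule runs_Seq)
    show "runs (try_pairs ?L) s1 (4 * length ?L + 1) ?Q2"
      by (rule runs_try_pairs) (use cur1 in auto)
  next
    fix s2 assume Q2: "?Q2 s2" and fr: "frame (try_pairs ?L) s1 s2"
    have n2: "nmem s2 n = nmem s n" if "n \<noteq> ''s''" "n \<noteq> ''t''" for n
    proof -
      have "n \<notin> nwrites (try_pairs ?L)"
        using that nwrites_try_pairs by blast
      then show ?thesis
        using frame_nmem[OF fr] n1[OF that] by simp
    qed
    have r2: "rmem s2 n = rmem s n" if "n \<noteq> ''best''" for n
    proof -
      have "n \<notin> rwrites (try_pairs ?L)"
        using that rwrites_try_pairs by blast
      then show ?thesis
        using frame_rmem[OF fr] r1[OF that] by simp
    qed
    have v2: "pair_value s2 = pair_value s" "pair_admissible s2 = pair_admissible s"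
      using pair_frame[OF fr] v1 by simp_all
    define x y best where "x = nmem s2 ''s'' 0 0" "y = nmem s2 ''t'' 0 0" "best = rmem s2 ''best'' 0 0"
    have pair: "pair_admissible s x y" "best = pair_value s x y"
      using Q2 unfolding current_pair_def v2 x_y_best_def by auto
    have max: "pair_value s x' y' \<le> best" if "pair_admissible s x' y'" for x' y'
    proof -
      \<comment> \<open>Of the nine pairs of kinds, two are excluded; the remaining seven are the
        initial candidate and the six in the list.\<close>
      have "(x', y') \<in> insert (0, 1) (set ?L)"
        using that by (auto simp: pair_admissible_def admissible_def less_2_cases_iff)
      then show ?thesis
        using Q2 that unfolding best1 v1 x_y_best_def by blast
    qed
    let ?Q3 = "\<lambda>s3. (\<forall>z. label s3 z = (if z \<in> set Zs \<and> label s2 z = d then c else label s2 z)) \<and>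
      (\<forall>z. nmem s3 ''sol'' z 0 =
        (if z \<in> set Zs \<and> label s2 z = c \<and> x < 2 then x
         else if z \<in> set Zs \<and> label s2 z = d \<and> y < 2 then y
         else nmem s2 ''sol'' z 0))"
    show "runs (Seq relabel ?tail) s2 ((length Zs * 8 + 2) + 3) ?Q"
    proof (rule runs_Seq)
      show "runs relabel s2 (length Zs * 8 + 2) ?Q3"
        by (rule runs_relabel) (use Z cd in \<open>simp_all add: list_at_def n2 x_y_best_def\<close>)
    next
      fix s3 assume Q3: "?Q3 s3" and fr3: "frame relabel s2 s3"
      have n3: "nmem s3 n = nmem s2 n" if "n \<notin> {''k'', ''x'', ''sol'', ''lab''}" for n
        using frame_nmem[OF fr3] that by (simp add: nwrites_relabel)
      have r3: "rmem s3 n = rmem s2 n" for n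
        using frame_rmem[OF fr3] by (simp add: rwrites_relabel)
      let ?s' = "effect ?tail s3"
      have lab: "label ?s' z = (if label s z = d then c else label s z)" if "z \<in> set Zs" for z
        using Q3 that by (simp add: n2)
      have "block_tables v (set Zs) ?s'"
      proof (rule block_tables_join[OF T sep uni cd(3-5)])
        show "admissible x (nmem s ''ok'' c 0)" "admissible y (nmem s ''ok'' d 0)"
          "(x, y) \<noteq> (0, 0)" "(x, y) \<noteq> (1, 1)"
          using pair(1) cd by (auto simp: pair_admissible_def)
        show "best = choice_value x (rmem s ''p'' c 0) (rmem s ''f'' c 0) +
            choice_value y (rmem s ''p'' d 0) (rmem s ''f'' d 0)"
          using pair(2) cd by (simp add: pair_value_def)
        show "choice_value x' (rmem s ''p'' c 0) (rmem s ''f'' c 0) +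
            choice_value y' (rmem s ''p'' d 0) (rmem s ''f'' d 0) \<le> best"
          if "admissible x' (nmem s ''ok'' c 0)" "admissible y' (nmem s ''ok'' d 0)"
            "(x', y') \<noteq> (0, 0)" "(x', y') \<noteq> (1, 1)" for x' y'
          using max[of x' y'] that cd by (simp add: pair_admissible_def pair_value_def)
        show "nmem ?s' ''sol'' z 0 = (if label s z = c \<and> x < 2 then x
            else if label s z = d \<and> y < 2 then y else nmem s ''sol'' z 0)" if "z \<in> set Zs" for z
          using Q3 that by (simp add: n2)
      qed (use lab cd in \<open>simp_all add: n2 n3 r2 r3 rval_value_exp choice_value_def x_y_best_def\<close>)
      then show "runs ?tail s3 3 ?Q"
        by (intro runs_loop_free) (use lab in simp_all)
    qed
  qed
  then have "runs (Seq (try_pairs ?L) (Seq relabel ?tail)) s1 (length Zs * 8 + 30) ?Q"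
    by (rule runs_le) simp
  then have "runs join s (Suc (Suc (Suc (length Zs * 8 + 30)))) ?Q"
    unfolding join_def s1_def effect.simps(4) by (intro runs_Seq_NAssign runs_Seq_RAssign)
  then show ?thesis
    by (rule runs_le) simp
qed

text \<open>Each join absorbs the whole block of the next element. Since the set is a union of
  blocks, nothing outside it is drawn in, and the outcome is one block equal to the set. The 37 adds
  to the 33 of a join the reading of the label, the comparison, and the test and increment of the
  loop.\<close>

lemma runs_merge:
  assumes Z: "list_at s ''Z_size'' ''Z_elem'' 0 Zs" "distinct Zs"
    and T: "block_tables v (set Zs) s" and sep: "separable v F"
    and F: "\<And>S. S \<in> F \<Longrightarrow> S \<subseteq> set Zs \<and> uniform (label s) S"
    and xs: "list_at s sz el (nmem s ''i'' 0 0) xs" "xs \<noteq> []" "set xs \<subseteq> set Zs"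
    and sat: "saturated (set Zs) (label s) (set xs)"
    and fresh: "sz \<notin> nwrites (merge sz el)" "el \<notin> nwrites (merge sz el)"
  shows "runs (merge sz el) s (length xs * (length Zs * 8 + 37) + 3) (\<lambda>s'.
    block_tables v (set Zs) s' \<and> nmem s' ''c'' 0 0 = label s (xs ! 0) \<and>
    (\<forall>z\<in>set Zs. label s' z = (if z \<in> set xs then label s (xs ! 0) else label s z)))"
proof -
  let ?Z = "set Zs" and ?c = "label s (xs ! 0)"
  let ?body = "Seq (Set ''d'' (NCell ''lab'' (NCell el (Var ''i'') (Var ''j'')) N0))
    (If (NEq (Var ''d'') (Var ''c'')) Skip join)"
  \<comment> \<open>The initial labels that have been absorbed into \<open>?c\<close> after j
    elements.\<close>
  let ?D = "\<lambda>j. insert ?c (label s ` set (take j xs))"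
  let ?I = "\<lambda>j s'. block_tables v ?Z s' \<and> nmem s' ''c'' 0 0 = ?c \<and>
    (\<forall>z\<in>?Z. label s' z = (if label s z \<in> ?D j then ?c else label s z))"
  define s1 where "s1 = effect (Set ''c'' (NCell ''lab'' (NCell el (Var ''i'') N0) N0)) s"
  have c1: "nmem s1 ''c'' 0 0 = ?c"
    using xs by (simp add: s1_def list_at_def)
  have n1: "nmem s1 n = nmem s n" if "n \<noteq> ''c''" for n
    using that by (simp add: s1_def)
  have r1: "rmem s1 = rmem s"
    by (simp add: s1_def)
  have x0: "xs ! 0 \<in> ?Z"
    using xs by (metis length_greater_0_conv nth_mem subsetD)
  have "runs (For ''j'' (NCell sz (Var ''i'') N0) ?body) s1
    (length xs * ((length Zs * 8 + 35) + 2) + 2) (?I (length xs))"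
  proof (rule runs_For_uniform[where I = ?I and n = "length xs"])
    show "?I 0 s1"
      using T c1 block_tables_cong[of s1 s] by (auto simp: n1 r1)
  next
    show "?I j (s'\<lparr>nmem := upd (nmem s') ''j'' 0 0 k\<rparr>)" if "?I j s'" for j k s'
    proof -
      have "block_tables v ?Z (s'\<lparr>nmem := upd (nmem s') ''j'' 0 0 k\<rparr>) = block_tables v ?Z s'"
        by (rule block_tables_cong) simp_all
      then show ?thesis
        using that by simp
    qed
  next
    fix j s' assume "frame (For ''j'' (NCell sz (Var ''i'') N0) ?body) s1 s'"
    from frame_nmem[OF this] show "nval (NCell sz (Var ''i'') N0) s' = length xs"
      using xs fresh by (simp add: nwrites_join nwrites_merge n1 list_at_def)
  next
    show "''j'' \<notin> nwrites ?body"
      by (simp add: nwrites_join)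
  next
    fix j s' assume j: "j < length xs" and I: "?I j s'" and j': "nmem s' ''j'' 0 0 = j"
      and fr: "frame (For ''j'' (NCell sz (Var ''i'') N0) ?body) s1 s'"
    have n': "nmem s' n = nmem s n" if "n \<notin> nwrites (merge sz el)" for n
      using frame_nmem[OF fr, of n] that n1[of n] by (simp add: nwrites_join nwrites_merge)
    have elem: "nmem s' el (nmem s' ''i'' 0 0) j = xs ! j"
      using xs j n'[of el] n'[of "''i''"] fresh by (simp add: list_at_def nwrites_merge)
    have xj: "xs ! j \<in> ?Z"
      using xs j by auto
    have lab: "label s' z = (if label s z \<in> ?D j then ?c else label s z)" if "z \<in> ?Z" for z
      using I that by blast
    have take: "set (take (Suc j) xs) = insert (xs ! j) (set (take j xs))"
      using j by (simp add: take_Suc_conv_app_nth)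
    let ?d = "label s' (xs ! j)"
    define s2 where "s2 = effect (Set ''d'' (NCell ''lab'' (NCell el (Var ''i'') (Var ''j'')) N0)) s'"
    have d2: "nmem s2 ''d'' 0 0 = ?d"
      by (simp add: s2_def elem j')
    have n2: "nmem s2 n = nmem s' n" if "n \<noteq> ''d''" for n
      using that by (simp add: s2_def)
    have r2: "rmem s2 = rmem s'"
      by (simp add: s2_def)
    have T2: "block_tables v ?Z s2"
      using I block_tables_cong[of s2 s'] by (simp add: n2 r2)
    have c2: "nmem s2 ''c'' 0 0 = ?c"
      using I by (simp add: n2)
    have "runs (If (NEq (Var ''d'') (Var ''c'')) Skip join) s2 (Suc (length Zs * 8 + 33)) (?I (Suc j))"
    proof (rule runs_If)
      assume "bval (NEq (Var ''d'') (Var ''c'')) s2"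
      then have "?d = ?c"
        by (simp add: d2 c2)
      then have "label s (xs ! j) \<in> ?D j"
        using lab[OF xj] by (auto split: if_splits)
      then have "?D (Suc j) = ?D j"
        unfolding take by auto
      then have "?I (Suc j) s2"
        using T2 c2 lab by (simp add: n2)
      then show "runs Skip s2 (length Zs * 8 + 33) (?I (Suc j))"
        by (intro runs_loop_free) simp_all
    next
      assume "\<not> bval (NEq (Var ''d'') (Var ''c'')) s2"
      then have neq: "?c \<noteq> ?d"
        by (simp add: d2 c2)
      then have d: "?d = label s (xs ! j)" "?d \<notin> ?D j"
        using lab[OF xj] by (auto split: if_splits)
      have "runs join s2 (length Zs * 8 + 33) (\<lambda>s3. block_tables v ?Z s3 \<and>
        (\<forall>z\<in>?Z. label s3 z = (if label s2 z = ?d then ?c else label s2 z)))"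
      proof (rule runs_join[OF _ Z(2) T2 sep])
        show "list_at s2 ''Z_size'' ''Z_elem'' 0 Zs"
          using Z n' by (simp add: list_at_def n2 nwrites_merge)
        show "uniform (label s2) S" if "S \<in> F" for S
        proof -
          \<comment> \<open>The current label is a function of the initial one, so elements that
            shared a label still share one.\<close>
          have "label s2 z = (if label s z \<in> ?D j then ?c else label s z)" if "z \<in> S" for z
            using F[OF \<open>S \<in> F\<close>] lab[of z] that by (auto simp: n2)
          then show ?thesis
            using F[OF that] unfolding uniform_def by metis
        qed
        show "?c \<in> label s2 ` ?Z"
          using lab[OF x0] x0 by (auto simp: n2 intro!: rev_image_eqI)
        show "?d \<in> label s2 ` ?Z"
          using xj by (simp add: n2)
      qed (use d2 c2 neq in simp_all)
      then show "runs join s2 (length Zs * 8 + 33) (?I (Suc j))"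
      proof (rule runs_mono)
        fix s3 assume s3: "block_tables v ?Z s3 \<and>
          (\<forall>z\<in>?Z. label s3 z = (if label s2 z = ?d then ?c else label s2 z))"
        assume "frame join s2 s3"
        then have "nmem s3 ''c'' = nmem s2 ''c''"
          by (rule frame_nmem) (simp add: nwrites_join)
        moreover have "?D (Suc j) = insert ?d (?D j)"
          unfolding take d(1) by auto
        moreover have "label s3 z = (if label s z \<in> insert ?d (?D j) then ?c else label s z)"
          if "z \<in> ?Z" for z
        proof -
          have "label s3 z = (if label s' z = ?d then ?c else label s' z)"
            using s3 that by (simp add: n2)
          then show ?thesis
            using lab[OF that] d neq by (cases "label s z \<in> ?D j") simp_all
        qed
        ultimately show "?I (Suc j) s3"
          using s3 c2 by simp
      qed simp
    qed
    then have "runs ?body s' (Suc (Suc (length Zs * 8 + 33))) (?I (Suc j))"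
      unfolding s2_def by (rule runs_Seq_NAssign)
    then show "runs ?body s' (length Zs * 8 + 35) (?I (Suc j))"
      by (rule runs_le) simp
  qed
  then have "runs (merge sz el) s (Suc (length xs * ((length Zs * 8 + 35) + 2) + 2)) (?I (length xs))"
    unfolding s1_def merge_def by (rule runs_Seq_NAssign)
  then show ?thesis
  proof (rule runs_mono)
    fix s' assume I: "?I (length xs) s'"
    \<comment> \<open>Saturation turns a statement about labels into one about elements: a label
      occurs in the set only if its whole block does.\<close>
    have "label s z \<in> ?D (length xs) \<longleftrightarrow> z \<in> set xs" if "z \<in> ?Z" for z
      using sat that xs(2) unfolding saturated_def by (auto intro!: imageI)
    then show "block_tables v ?Z s' \<and> nmem s' ''c'' 0 0 = ?c \<and>
      (\<forall>z\<in>?Z. label s' z = (if z \<in> set xs then ?c else label s z))"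
      using I by simp
  qed (simp add: algebra_simps)
qed

section \<open>Adding the covered sets of one size\<close>

definition add_value :: "rexp \<Rightarrow> rexp \<Rightarrow> com" where
  "add_value e1 e2 =
     Seq (RAssign ''p'' (Var ''c'') N0 (RPlus (RCell ''p'' (Var ''c'') N0) e1))
         (RAssign ''f'' (Var ''c'') N0 (RMinus (RPlus (RCell ''f'' (Var ''c'') N0) e1) e2))"

text \<open>The entries of \<open>ptr\<close> and \<open>sz\<close> agree exactly for the covered sets.\<close>

definition process_body :: "string \<Rightarrow> string \<Rightarrow> string \<Rightarrow> rexp \<Rightarrow> rexp \<Rightarrow> com" where
  "process_body sz el ptr e1 e2 =
     If (BAnd (NEq (NCell sz (Var ''i'') N0) (NPlus (Var ''r'') N1))
          (NEq (NCell ptr (Var ''i'') N0) (NCell sz (Var ''i'') N0)))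
       (Seq (merge sz el) (add_value e1 e2)) Skip"

definition process :: "string \<Rightarrow> string \<Rightarrow> string \<Rightarrow> string \<Rightarrow> rexp \<Rightarrow> rexp \<Rightarrow> com" where
  "process bnd sz el ptr e1 e2 = For ''i'' (Var bnd) (process_body sz el ptr e1 e2)"

lemma nwrites_process_body: "nwrites (process_body sz el ptr e1 e2) = nwrites (merge sz el)"
  by (simp add: process_body_def add_value_def)

lemma rwrites_process_body: "rwrites (process_body sz el ptr e1 e2) = rwrites (merge sz el)"
  by (auto simp: process_body_def add_value_def rwrites_merge)

text \<open>\<open>F\<close> collects the sets already counted in \<open>v\<close>; each must lie in
  one block for \<open>v\<close> to be additive across blocks. \<open>G\<close> collects sets that
  must remain unions of blocks so that merging them later is exact.\<close>

definition dp_inv :: "(nat set \<Rightarrow> real) \<Rightarrow> nat set set \<Rightarrow> nat set set \<Rightarrow> nat set \<Rightarrow> state \<Rightarrow> bool" where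
  "dp_inv v F G Z s \<longleftrightarrow> block_tables v Z s \<and> (\<forall>S\<in>F. S \<subseteq> Z \<and> uniform (label s) S) \<and>
     (\<forall>S\<in>G. S \<subseteq> Z \<and> saturated Z (label s) S)"

lemma dp_inv_upd:
  assumes "dp_inv v F G Z s" "x \<notin> {''lab'', ''sol'', ''ok''}"
  shows "dp_inv v F G Z (s\<lparr>nmem := upd (nmem s) x i j k\<rparr>)"
proof -
  have "block_tables v Z (s\<lparr>nmem := upd (nmem s) x i j k\<rparr>) = block_tables v Z s"
    using assms(2) by (intro block_tables_cong) auto
  then show ?thesis
    using assms by (auto simp: dp_inv_def)
qed

lemma dp_inv_antimono: "dp_inv v F G Z s \<Longrightarrow> G' \<subseteq> G \<Longrightarrow> dp_inv v F G' Z s"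
  unfolding dp_inv_def by blast

text \<open>On selections inside another block the item contributes nothing: \<open>S\<close> is
  disjoint from that block and, being nonempty, is not contained in such a selection.\<close>

lemma block_tables_add_value:
  assumes T: "block_tables v Z s" and "S \<noteq> {}" "S \<subseteq> Z" and c: "nmem s ''c'' 0 0 = c"
    and S: "block Z (label s) c = S"
    and v': "\<And>X. v' X = v X + (if S \<inter> X \<noteq> {} then \<alpha> else 0) - (if S \<subseteq> X then \<beta> else 0)"
    and e: "\<And>s'. nmem s' = nmem s \<Longrightarrow> (\<And>n. n \<notin> {''p'', ''f''} \<Longrightarrow> rmem s' n = rmem s n) \<Longrightarrow>
      rval e1 s' = \<alpha> \<and> rval e2 s' = \<beta>"
  shows "block_tables v' Z (effect (add_value e1 e2) s)"
proof -
  define s' where "s' = effect (add_value e1 e2) s"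
  let ?s1 = "effect (RAssign ''p'' (Var ''c'') N0 (RPlus (RCell ''p'' (Var ''c'') N0) e1)) s"
  \<comment> \<open>\<open>e1\<close> is evaluated a second time after \<open>p\<close> has been
    overwritten, so its value must not depend on that write.\<close>
  have e': "rval e1 s = \<alpha>" "rval e1 ?s1 = \<alpha>" "rval e2 ?s1 = \<beta>"
    using e[of s] e[of ?s1] by simp_all
  have n: "nmem s' = nmem s"
    by (simp add: s'_def add_value_def)
  have p: "rmem s' ''p'' d 0 = rmem s ''p'' d 0 + (if d = c then \<alpha> else 0)"
    and f: "rmem s' ''f'' d 0 = rmem s ''f'' d 0 + (if d = c then \<alpha> - \<beta> else 0)" for d
    using e' c by (simp_all add: s'_def add_value_def)
  have "block_table v' (block Z (label s) d) (selected s)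
      (nmem s ''ok'' d 0) (rmem s' ''p'' d 0) (rmem s' ''f'' d 0)" if "d \<in> label s ` Z" for d
  proof -
    have d: "block_table v (block Z (label s) d) (selected s)
      (nmem s ''ok'' d 0) (rmem s ''p'' d 0) (rmem s ''f'' d 0)"
      using T that unfolding block_tables_def by blast
    show ?thesis
    proof (cases "d = c")
      case True
      then show ?thesis
        using block_table_add_item[of v S _ _ _ _ v' \<alpha> \<beta>] d S \<open>S \<noteq> {}\<close> v'
        by (simp add: p f add_diff_eq)
    next
      case False
      have "S \<inter> block Z (label s) d = {}"
        using S False unfolding block_def by blast
      then have "v' X = v X" if "X \<subseteq> block Z (label s) d" for X
        using that \<open>S \<noteq> {}\<close> v'[of X] by auto
      then show ?thesis
        using block_table_cong[OF d] False by (simp add: p f)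
    qed
  qed
  then show ?thesis
    unfolding s'_def[symmetric] block_tables_def n by blast
qed

text \<open>A counted set lies in one old block, which is either inside the new set or disjoint from
  it, so it still lies in one block. A set of \<open>G\<close> contains the new set or is disjoint
  from it, so it still is a union of blocks.\<close>

lemma runs_add_set:
  assumes Z: "list_at s ''Z_size'' ''Z_elem'' 0 Zs" "distinct Zs"
    and inv: "dp_inv v F G (set Zs) s" and sep: "separable v F"
    and xs: "list_at s sz el (nmem s ''i'' 0 0) xs" "xs \<noteq> []" "set xs \<subseteq> set Zs" "set xs \<in> G"
    and G: "\<And>S. S \<in> G \<Longrightarrow> set xs \<inter> S = {} \<or> set xs \<subseteq> S"
    and fresh: "sz \<notin> nwrites (merge sz el)" "el \<notin> nwrites (merge sz el)"
    and v': "\<And>X. v' X = v X + (if set xs \<inter> X \<noteq> {} then \<alpha> else 0) - (if set xs \<subseteq> X then \<beta> else 0)"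
    and e: "\<And>s'. nmem s' ''i'' = nmem s ''i'' \<Longrightarrow>
      (\<And>n. n \<notin> {''best'', ''p'', ''f''} \<Longrightarrow> rmem s' n = rmem s n) \<Longrightarrow> rval e1 s' = \<alpha> \<and> rval e2 s' = \<beta>"
  shows "runs (Seq (merge sz el) (add_value e1 e2)) s (length xs * (length Zs * 8 + 37) + 5)
    (dp_inv v' (insert (set xs) F) G (set Zs))"
proof -
  let ?Z = "set Zs" and ?c = "label s (xs ! 0)"
  have sat: "saturated ?Z (label s) (set xs)"
    using inv xs by (simp add: dp_inv_def)
  have x0: "xs ! 0 \<in> set xs"
    using xs(2) by simp
  have "runs (Seq (merge sz el) (add_value e1 e2)) s
    ((length xs * (length Zs * 8 + 37) + 3) + 2) (dp_inv v' (insert (set xs) F) G ?Z)"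
  proof (rule runs_Seq)
    show "runs (merge sz el) s (length xs * (length Zs * 8 + 37) + 3) (\<lambda>s'.
      block_tables v ?Z s' \<and> nmem s' ''c'' 0 0 = ?c \<and>
      (\<forall>z\<in>?Z. label s' z = (if z \<in> set xs then ?c else label s z)))"
      by (rule runs_merge[OF Z _ sep _ xs(1-3) sat fresh]) (use inv in \<open>auto simp: dp_inv_def\<close>)
  next
    fix s1 assume s1: "block_tables v ?Z s1 \<and> nmem s1 ''c'' 0 0 = ?c \<and>
      (\<forall>z\<in>?Z. label s1 z = (if z \<in> set xs then ?c else label s z))"
    assume fr: "frame (merge sz el) s s1"
    have lab: "label s1 z = (if z \<in> set xs then ?c else label s z)" if "z \<in> ?Z" for z
      using s1 that by blast
    have outside: "label s z \<noteq> ?c" if "z \<in> ?Z" "z \<notin> set xs" for z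
      using sat that x0 unfolding saturated_def by blast
    have "block_tables v' ?Z (effect (add_value e1 e2) s1)"
    proof (rule block_tables_add_value)
      show "block_tables v ?Z s1" "nmem s1 ''c'' 0 0 = ?c"
        using s1 by auto
      show "block ?Z (label s1) ?c = set xs"
        using lab outside xs(3) by (auto simp: block_def split: if_splits)
      show "rval e1 s' = \<alpha> \<and> rval e2 s' = \<beta>"
        if "nmem s' = nmem s1" "\<And>n. n \<notin> {''p'', ''f''} \<Longrightarrow> rmem s' n = rmem s1 n" for s'
      proof (rule e)
        show "nmem s' ''i'' = nmem s ''i''"
          using frame_nmem[OF fr, of "''i''"] that by (simp add: nwrites_merge)
        show "rmem s' n = rmem s n" if "n \<notin> {''best'', ''p'', ''f''}" for n
          using frame_rmem[OF fr, of n] that \<open>\<And>n. n \<notin> {''p'', ''f''} \<Longrightarrow> rmem s' n = rmem s1 n\<close>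
          by (simp add: rwrites_merge)
      qed
    qed (use xs v' in simp_all)
    moreover have "nmem (effect (add_value e1 e2) s1) = nmem s1"
      by (simp add: add_value_def)
    moreover have "S \<subseteq> ?Z \<and> uniform (label s1) S" if "S \<in> insert (set xs) F" for S
    proof (cases "S = set xs")
      case True
      have "label s1 x = ?c" if "x \<in> set xs" for x
        using lab[of x] xs(3) that by auto
      then show ?thesis
        using True xs(3) unfolding uniform_def by simp
    next
      case False
      then have S: "S \<subseteq> ?Z" "uniform (label s) S"
        using that inv by (auto simp: dp_inv_def)
      have "label s1 x = label s1 y" if "x \<in> S" "y \<in> S" for x y
      proof -
        have "label s x = label s y"
          using S that unfolding uniform_def by blast
        then have "x \<in> set xs \<longleftrightarrow> y \<in> set xs"
          using sat S(1) that unfolding saturated_def by fastforce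
        moreover have "x \<in> ?Z" "y \<in> ?Z"
          using S(1) that by auto
        ultimately show ?thesis
          using lab[of x] lab[of y] \<open>label s x = label s y\<close> by simp
      qed
      then show ?thesis
        using S unfolding uniform_def by blast
    qed
    moreover have "S \<subseteq> ?Z \<and> saturated ?Z (label s1) S" if "S \<in> G" for S
    proof
      have satS: "saturated ?Z (label s) S"
        using inv that by (simp add: dp_inv_def)
      show "S \<subseteq> ?Z"
        using inv that by (simp add: dp_inv_def)
      show "saturated ?Z (label s1) S"
        unfolding saturated_def
      proof (intro ballI impI)
        fix x y assume xy: "x \<in> S" "y \<in> ?Z" "label s1 y = label s1 x"
        have "x \<in> ?Z"
          using \<open>S \<subseteq> ?Z\<close> xy(1) by blast
        note labs = lab[OF this] lab[OF xy(2)] xy(3) outside[OF this] outside[OF xy(2)]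
        show "y \<in> S"
        proof (cases "x \<in> set xs")
          case True
          then have "y \<in> set xs"
            using labs by (auto split: if_splits)
          then show ?thesis
            using G[OF that] True xy(1) by blast
        next
          case False
          then have "label s y = label s x"
            using labs by (auto split: if_splits)
          then show ?thesis
            using satS xy unfolding saturated_def by blast
        qed
      qed
    qed
    ultimately show "runs (add_value e1 e2) s1 2 (dp_inv v' (insert (set xs) F) G ?Z)"
      by (intro runs_loop_free) (simp_all add: dp_inv_def, simp_all add: add_value_def)
  qed
  then show ?thesis
    by (rule runs_le) simp
qed

text \<open>Shared by rewards and penalties: \<open>w\<close> is the objective as a function of the
  index set being enlarged, and \<open>F\<close> holds the counted sets of the other sort. The sets
  of size k + 1 must be minimal in \<open>G\<close>, up to equality, for their mergers not to cut
  through other sets of \<open>G\<close>.\<close>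

lemma runs_process:
  fixes L :: "nat \<Rightarrow> nat list" and w :: "nat set \<Rightarrow> nat set \<Rightarrow> real"
  assumes Z: "list_at s ''Z_size'' ''Z_elem'' 0 Zs" "distinct Zs"
    and L: "\<And>i. i < n \<Longrightarrow> list_at s sz el i (L i)"
    and ptr: "\<And>i. i < n \<Longrightarrow> nmem s ptr i 0 = length (L i) \<longleftrightarrow> set (L i) \<subseteq> set Zs"
    and bnd: "nmem s bnd 0 0 = n" and r: "nmem s ''r'' 0 0 = k"
    and inv: "dp_inv (w R) (F \<union> (\<lambda>i. set (L i)) ` R) G (set Zs) s"
    and R: "R \<subseteq> {i. i < n \<and> L i \<noteq> [] \<and> length (L i) \<le> k}"
    and G: "\<And>i S. i < n \<Longrightarrow> length (L i) = Suc k \<Longrightarrow> set (L i) \<subseteq> set Zs \<Longrightarrow>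
      set (L i) \<in> G \<and> (S \<in> G \<longrightarrow> set (L i) \<inter> S = {} \<or> set (L i) \<subseteq> S)"
    and sep: "\<And>R'. R' \<subseteq> {i. i < n \<and> L i \<noteq> []} \<Longrightarrow>
      separable (w R') (F \<union> (\<lambda>i. set (L i)) ` R')"
    and w: "\<And>R' i X. R' \<subseteq> {..<n} \<Longrightarrow> i < n \<Longrightarrow> i \<notin> R' \<Longrightarrow> w (insert i R') X =
      w R' X + (if set (L i) \<inter> X \<noteq> {} then \<alpha> i else 0) - (if set (L i) \<subseteq> X then \<beta> i else 0)"
    and e: "\<And>i s'. i < n \<Longrightarrow> nmem s' ''i'' 0 0 = i \<Longrightarrow>
      (\<And>m. m \<notin> {''best'', ''p'', ''f''} \<Longrightarrow> rmem s' m = rmem s m) \<Longrightarrow>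
      rval e1 s' = \<alpha> i \<and> rval e2 s' = \<beta> i"
    and fresh: "{bnd, sz, el, ptr} \<inter> insert ''i'' (nwrites (merge sz el)) = {}"
  shows "runs (process bnd sz el ptr e1 e2) s
    ((\<Sum>i<n. (if length (L i) = Suc k \<and> set (L i) \<subseteq> set Zs
        then Suc (length (L i) * (length Zs * 8 + 37) + 5) else 2) + 2) + 2)
    (let R' = R \<union> {i. i < n \<and> length (L i) = Suc k \<and> set (L i) \<subseteq> set Zs}
      in dp_inv (w R') (F \<union> (\<lambda>i. set (L i)) ` R') G (set Zs))"
proof -
  let ?Z = "set Zs" and ?body = "process_body sz el ptr e1 e2"
  let ?el = "\<lambda>i. length (L i) = Suc k \<and> set (L i) \<subseteq> ?Z"
  let ?R = "\<lambda>i. R \<union> {i'. i' < i \<and> ?el i'}"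
  let ?I = "\<lambda>i. dp_inv (w (?R i)) (F \<union> (\<lambda>i. set (L i)) ` ?R i) G ?Z"
  let ?\<tau> = "\<lambda>i. if ?el i then Suc (length (L i) * (length Zs * 8 + 37) + 5) else 2"
  have "runs (process bnd sz el ptr e1 e2) s ((\<Sum>i<n. ?\<tau> i + 2) + 2) (?I n)"
    unfolding process_def
  proof (rule runs_For[where I = ?I])
    show "?I 0 s"
      using inv by simp
    show "?I i (s'\<lparr>nmem := upd (nmem s') ''i'' 0 0 m\<rparr>)" if "?I i s'" for i m s'
      using that by (rule dp_inv_upd) simp
    show "''i'' \<notin> nwrites ?body"
      by (simp add: nwrites_process_body nwrites_merge)
  next
    fix i s' assume fr: "frame (For ''i'' (Var bnd) ?body) s s'"
    have "nmem s' bnd = nmem s bnd"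
      using fresh by (intro frame_nmem[OF fr]) (auto simp: nwrites_process_body)
    then show "nval (Var bnd) s' = n"
      using bnd by simp
  next
    fix i s' assume i: "i < n" "nmem s' ''i'' 0 0 = i" and I: "?I i s'"
      and fr: "frame (For ''i'' (Var bnd) ?body) s s'"
    have n': "nmem s' m = nmem s m" if "m \<notin> insert ''i'' (nwrites (merge sz el))" for m
      using frame_nmem[OF fr, of m] that by (simp add: nwrites_process_body)
    have r': "rmem s' m = rmem s m" if "m \<notin> {''best'', ''p'', ''f''}" for m
      using frame_rmem[OF fr, of m] that by (simp add: rwrites_process_body rwrites_merge)
    have names: "nmem s' sz = nmem s sz" "nmem s' el = nmem s el" "nmem s' ptr = nmem s ptr"
      "nmem s' ''r'' = nmem s ''r''"
      "nmem s' ''Z_size'' = nmem s ''Z_size''" "nmem s' ''Z_elem'' = nmem s ''Z_elem''"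
      using fresh by (auto intro!: n' simp: nwrites_merge)
    have Li: "list_at s' sz el i (L i)" and Z': "list_at s' ''Z_size'' ''Z_elem'' 0 Zs"
      using L[OF i(1)] Z(1) by (simp_all add: list_at_def names)
    have test: "bval (BAnd (NEq (NCell sz (Var ''i'') N0) (NPlus (Var ''r'') N1))
          (NEq (NCell ptr (Var ''i'') N0) (NCell sz (Var ''i'') N0))) s' \<longleftrightarrow> ?el i"
      using L[OF i(1)] ptr[OF i(1)] r i(2) by (simp add: names list_at_def)
    show "runs ?body s' (?\<tau> i) (?I (Suc i))"
    proof (cases "?el i")
      case True
      have ins: "?R (Suc i) = insert i (?R i)"
        using True by (auto simp: less_Suc_eq)
      \<comment> \<open>Index i is new: previous rounds counted lists of length at most k, and this
        round only smaller indices.\<close>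
      have sub: "?R i \<subseteq> {..<n}" "?R i \<subseteq> {i. i < n \<and> L i \<noteq> []}" "i \<notin> ?R i"
        using R i True by auto
      have "runs (Seq (merge sz el) (add_value e1 e2)) s' (length (L i) * (length Zs * 8 + 37) + 5)
        (dp_inv (w (insert i (?R i))) (insert (set (L i)) (F \<union> (\<lambda>i. set (L i)) ` ?R i)) G ?Z)"
      proof (rule runs_add_set[OF Z' Z(2) I sep[OF sub(2)]])
        show "list_at s' sz el (nmem s' ''i'' 0 0) (L i)"
          using Li i by simp
        show "w (insert i (?R i)) X = w (?R i) X + (if set (L i) \<inter> X \<noteq> {} then \<alpha> i else 0) -
          (if set (L i) \<subseteq> X then \<beta> i else 0)" for X
          using w[OF sub(1) i(1) sub(3)] .
        show "rval e1 s'' = \<alpha> i \<and> rval e2 s'' = \<beta> i" if "nmem s'' ''i'' = nmem s' ''i''"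
          "\<And>m. m \<notin> {''best'', ''p'', ''f''} \<Longrightarrow> rmem s'' m = rmem s' m" for s''
          by (rule e) (use i that r' in simp_all)
      qed (use True G[OF i(1)] fresh in auto)
      then have "runs (Seq (merge sz el) (add_value e1 e2)) s' (length (L i) * (length Zs * 8 + 37) + 5)
        (?I (Suc i))"
        unfolding ins by simp
      then have "runs ?body s' (Suc (length (L i) * (length Zs * 8 + 37) + 5)) (?I (Suc i))"
        unfolding process_body_def using test True by (intro runs_If) blast+
      then show ?thesis
        using True by simp
    next
      case False
      have "?R (Suc i) = ?R i"
        using False by (auto simp: less_Suc_eq)
      then have "?I (Suc i) s'"
        using I by (simp only:)
      then have "runs Skip s' 1 (?I (Suc i))"
        by (intro runs_loop_free) simp_all
      then have "runs ?body s' (Suc 1) (?I (Suc i))"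
        unfolding process_body_def using test False by (intro runs_If) blast+
      then show ?thesis
        by (rule runs_le) (use False in auto)
    qed
  qed
  then show ?thesis
    by (simp add: Let_def)
qed

section \<open>Singletons and sets covered by them\<close>

lemma list_at_append:
  assumes "list_at s sz el 0 xs" "nmem s' sz 0 0 = Suc (length xs)" "nmem s' el 0 (length xs) = x"
    "\<And>j. j < length xs \<Longrightarrow> nmem s' el 0 j = nmem s el 0 j"
  shows "list_at s' sz el 0 (xs @ [x])"
  using assms by (auto simp: list_at_def nth_append less_Suc_eq)

definition push :: "string \<Rightarrow> string \<Rightarrow> nexp \<Rightarrow> com" where
  "push sz el e = Seq (NAssign el N0 (Var sz) e) (Set sz (NPlus (Var sz) N1))"

lemma list_at_effect_push:
  assumes "list_at s sz el 0 xs" "sz \<noteq> el"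
  shows "list_at (effect (push sz el e) s) sz el 0 (xs @ [nval e s])"
  by (rule list_at_append[OF assms(1)]) (use assms in \<open>auto simp: push_def list_at_def\<close>)

lemma nmem_effect_push: "n \<noteq> sz \<Longrightarrow> n \<noteq> el \<Longrightarrow> nmem (effect (push sz el e) s) n = nmem s n"
  by (simp add: push_def)

text \<open>The flag \<open>sing\<close> prevents x from being listed twice when {x} is both a
  reward set and a penalty set. Every listed element starts as a block of its own, labelled by
  itself.\<close>

definition mark_body :: "string \<Rightarrow> string \<Rightarrow> com" where
  "mark_body sz el = (let x = NCell el (Var ''i'') N0 in
     If (BAnd (NEq (NCell sz (Var ''i'') N0) N1) (NEq (NCell ''sing'' x N0) N0))
       (Seq (push ''Z_size'' ''Z_elem'' x) (Seq (NAssign ''lab'' x N0 x) (NAssign ''sing'' x N0 N1)))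
       Skip)"

definition mark :: "string \<Rightarrow> string \<Rightarrow> string \<Rightarrow> com" where
  "mark bnd sz el = For ''i'' (Var bnd) (mark_body sz el)"

definition marked :: "nat list \<Rightarrow> state \<Rightarrow> bool" where
  "marked Zs s \<longleftrightarrow> list_at s ''Z_size'' ''Z_elem'' 0 Zs \<and> distinct Zs \<and>
     (\<forall>x. nmem s ''sing'' x 0 = (if x \<in> set Zs then 1 else 0)) \<and> (\<forall>x\<in>set Zs. label s x = x)"

lemma nwrites_mark_body: "nwrites (mark_body sz el) = {''Z_size'', ''Z_elem'', ''lab'', ''sing''}"
  by (auto simp: mark_body_def push_def Let_def)

lemma rwrites_mark: "rwrites (mark bnd sz el) = {}"
  by (simp add: mark_def mark_body_def push_def Let_def)

lemma nwrites_mark: "nwrites (mark bnd sz el) = {''i'', ''Z_size'', ''Z_elem'', ''lab'', ''sing''}"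
  by (simp add: mark_def nwrites_mark_body)

lemma runs_mark:
  fixes L :: "nat \<Rightarrow> nat list"
  assumes init: "marked Zs s" and L: "\<And>i. i < n \<Longrightarrow> list_at s sz el i (L i)"
    and bnd: "nmem s bnd 0 0 = n" and fresh: "{bnd, sz, el} \<inter> nwrites (mark bnd sz el) = {}"
  shows "runs (mark bnd sz el) s (n * 7 + 2) (\<lambda>s'. \<exists>Zs'. marked Zs' s' \<and>
    set Zs' = set Zs \<union> {x. \<exists>i<n. L i = [x]} \<and> length Zs' \<le> length Zs + n)"
proof -
  let ?I = "\<lambda>i s'. \<exists>Zs'. marked Zs' s' \<and>
    set Zs' = set Zs \<union> {x. \<exists>i'<i. L i' = [x]} \<and> length Zs' \<le> length Zs + i"
  have "runs (mark bnd sz el) s (n * (5 + 2) + 2) (?I n)"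
    unfolding mark_def
  proof (rule runs_For_uniform[where I = ?I])
    show "?I 0 s"
      using init by auto
    show "?I i (s'\<lparr>nmem := upd (nmem s') ''i'' 0 0 m\<rparr>)" if "?I i s'" for i m s'
      using that by (simp add: marked_def list_at_def)
    show "''i'' \<notin> nwrites (mark_body sz el)"
      by (simp add: nwrites_mark_body)
  next
    fix s' assume fr: "frame (For ''i'' (Var bnd) (mark_body sz el)) s s'"
    have "nmem s' bnd = nmem s bnd"
      using fresh by (intro frame_nmem[OF fr]) (auto simp: nwrites_mark nwrites_mark_body)
    then show "nval (Var bnd) s' = n"
      using bnd by simp
  next
    fix i s' assume i: "i < n" "nmem s' ''i'' 0 0 = i" and I: "?I i s'"
      and fr: "frame (For ''i'' (Var bnd) (mark_body sz el)) s s'"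
    obtain Zs' where Zs': "marked Zs' s'" "set Zs' = set Zs \<union> {x. \<exists>i'<i. L i' = [x]}"
      "length Zs' \<le> length Zs + i"
      using I by blast
    have names: "nmem s' sz = nmem s sz" "nmem s' el = nmem s el"
      using fresh by (auto intro!: frame_nmem[OF fr] simp: nwrites_mark nwrites_mark_body)
    have Li: "nmem s' sz i 0 = length (L i)" "L i \<noteq> [] \<Longrightarrow> nmem s' el i 0 = L i ! 0"
      using L[OF i(1)] by (auto simp: list_at_def names)
    have "?I (Suc i) (effect (mark_body sz el) s')"
    proof (cases "length (L i) = 1 \<and> L i ! 0 \<notin> set Zs'")
      case True
      then obtain x where x: "L i = [x]" "x \<notin> set Zs'"
        by (cases "L i") auto
      let ?e = "NCell el (Var ''i'') N0"
      let ?s1 = "effect (push ''Z_size'' ''Z_elem'' ?e) s'"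
      let ?s2 = "effect (mark_body sz el) s'"
      have e: "nval ?e s' = x" "nmem s' sz i 0 = 1" "nmem s' ''sing'' x 0 = 0"
        using Li x i(2) Zs'(1) by (simp_all add: marked_def)
      have el: "el \<noteq> ''Z_size''" "el \<noteq> ''Z_elem''" "el \<noteq> ''lab''" "el \<noteq> ''sing''"
        using fresh by (auto simp: nwrites_mark)
      have s2: "?s2 = ?s1\<lparr>nmem := upd (upd (nmem ?s1) ''lab'' x 0 x) ''sing'' x 0 1\<rparr>"
        using e el i(2) by (simp add: mark_body_def Let_def push_def)
      have "list_at ?s1 ''Z_size'' ''Z_elem'' 0 (Zs' @ [x])"
        using list_at_effect_push[of s' "''Z_size''" "''Z_elem''" Zs' ?e] Zs'(1) e(1)
        by (simp add: marked_def)
      then have "list_at ?s2 ''Z_size'' ''Z_elem'' 0 (Zs' @ [x])"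
        unfolding s2 by (simp add: list_at_def)
      then have "marked (Zs' @ [x]) ?s2"
        using Zs'(1) x unfolding s2 marked_def by (simp add: nmem_effect_push)
      moreover have "set (Zs' @ [x]) = set Zs \<union> {x. \<exists>i'<Suc i. L i' = [x]}"
        using Zs'(2) x by (auto simp: less_Suc_eq)
      ultimately show ?thesis
        using Zs'(3) by (intro exI[of _ "Zs' @ [x]"]) simp
    next
      case False
      have "nmem s' sz i 0 \<noteq> 1 \<or> nmem s' ''sing'' (nmem s' el i 0) 0 \<noteq> 0"
        using False Li Zs'(1) by (cases "L i") (auto simp: marked_def)
      then have "effect (mark_body sz el) s' = s'"
        using i(2) by (auto simp: mark_body_def Let_def)
      moreover have "{x. \<exists>i'<Suc i. L i' = [x]} \<subseteq> {x. \<exists>i'<i. L i' = [x]} \<union> set Zs'"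
        using False by (auto simp: less_Suc_eq)
      then have "set Zs' = set Zs \<union> {x. \<exists>i'<Suc i. L i' = [x]}"
        using Zs'(2) by (auto simp: less_Suc_eq)
      ultimately show ?thesis
        using Zs' by (intro exI[of _ Zs']) simp
    qed
    then show "runs (mark_body sz el) s' 5 (?I (Suc i))"
      by (intro runs_loop_free) (simp_all add: mark_body_def Let_def push_def)
  qed
  then show ?thesis
    by simp
qed

section \<open>Finding elements outside \<open>Z\<close>\<close>

definition scan_body :: "string \<Rightarrow> string \<Rightarrow> string \<Rightarrow> com" where
  "scan_body sz el ptr =
     Seq (Set ''j'' N0)
    (Seq (While (BAnd (NLess (Var ''j'') (NCell sz (Var ''i'') N0))
            (NEq (NCell ''sing'' (NCell el (Var ''i'') (Var ''j'')) N0) N1))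
           (Set ''j'' (NPlus (Var ''j'') N1)))
         (NAssign ptr (Var ''i'') N0 (Var ''j'')))"

definition scan :: "string \<Rightarrow> string \<Rightarrow> string \<Rightarrow> string \<Rightarrow> com" where
  "scan bnd sz el ptr = For ''i'' (Var bnd) (scan_body sz el ptr)"

lemma nwrites_scan: "nwrites (scan bnd sz el ptr) = {''i'', ''j'', ptr}"
  by (auto simp: scan_def scan_body_def)

lemma rwrites_scan: "rwrites (scan bnd sz el ptr) = {}"
  by (simp add: scan_def scan_body_def)

definition first_outside :: "nat set \<Rightarrow> nat list \<Rightarrow> nat \<Rightarrow> bool" where
  "first_outside Z xs q \<longleftrightarrow>
     q \<le> length xs \<and> set (take q xs) \<subseteq> Z \<and> (q < length xs \<longrightarrow> xs ! q \<notin> Z)"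

lemma first_outside_length_iff: "first_outside Z xs q \<Longrightarrow> q = length xs \<longleftrightarrow> set xs \<subseteq> Z"
  unfolding first_outside_def by (metis le_neq_implies_less nth_mem order_refl subsetD take_all)

text \<open>The elements passed over are distinct members of \<open>Z\<close>, so the scan stops
  after at most |Z| advances, however long the list is.\<close>

lemma runs_scan_body:
  assumes Z: "\<And>x. nmem s ''sing'' x 0 = (if x \<in> set Zs then 1 else 0)"
    and xs: "list_at s sz el (nmem s ''i'' 0 0) xs" "distinct xs"
    and fresh: "sz \<noteq> ''j''" "el \<noteq> ''j''" "ptr \<noteq> ''j''"
  shows "runs (scan_body sz el ptr) s (2 * length Zs + 3)
    (\<lambda>s'. \<exists>q. first_outside (set Zs) xs q \<and>
      nmem s' = upd (upd (nmem s) ''j'' 0 0 q) ptr (nmem s ''i'' 0 0) 0 q)"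
proof -
  let ?i = "nmem s ''i'' 0 0"
  let ?s = "\<lambda>j. s\<lparr>nmem := upd (nmem s) ''j'' 0 0 j\<rparr>"
  let ?b = "BAnd (NLess (Var ''j'') (NCell sz (Var ''i'') N0))
            (NEq (NCell ''sing'' (NCell el (Var ''i'') (Var ''j'')) N0) N1)"
  let ?c = "Set ''j'' (NPlus (Var ''j'') N1)"
  let ?I = "\<lambda>s'. \<exists>j\<le>length xs. s' = ?s j \<and> set (take j xs) \<subseteq> set Zs"
  let ?\<phi> = "\<lambda>s'. 2 * (length Zs - nmem s' ''j'' 0 0) + 1"
  have b: "bval ?b (?s j) \<longleftrightarrow> j < length xs \<and> xs ! j \<in> set Zs" if "j \<le> length xs" for j
    using xs(1) fresh Z by (auto simp: list_at_def)
  have loop: "runs (While ?b ?c) (?s 0) (?\<phi> (?s 0)) (\<lambda>s'. ?I s' \<and> \<not> bval ?b s')"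
  proof (rule runs_While)
    show "?I (?s 0)"
      by (intro exI[of _ 0]) simp
  next
    fix s' assume "?I s'" and t: "bval ?b s'"
    then obtain j where j: "j \<le> length xs" "s' = ?s j" "set (take j xs) \<subseteq> set Zs"
      by blast
    have j': "j < length xs" "xs ! j \<in> set Zs"
      using b[OF j(1)] t j(2) by simp_all
    then have sub: "set (take (Suc j) xs) \<subseteq> set Zs"
      using j(3) by (simp add: take_Suc_conv_app_nth)
    have "Suc j = card (set (take (Suc j) xs))"
      using xs(2) j'(1) by (simp add: distinct_card)
    also have "\<dots> \<le> length Zs"
      using card_mono[OF _ sub] card_length[of Zs] by simp
    finally have "Suc j \<le> length Zs" .
    moreover have "effect ?c s' = ?s (Suc j)"
      using j(2) by (simp add: upd_def)
    moreover have "?I (?s (Suc j))"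
      using sub j'(1) by (intro exI[of _ "Suc j"]) simp
    ultimately have "runs ?c s' 1 (\<lambda>s''. ?I s'' \<and> Suc (1 + ?\<phi> s'') \<le> ?\<phi> s')"
      using j(2) by (intro runs_loop_free) auto
    then show "\<exists>k. runs ?c s' k (\<lambda>s''. ?I s'' \<and> Suc (k + ?\<phi> s'') \<le> ?\<phi> s')"
      by blast
  qed simp
  have "runs (Seq (While ?b ?c) (NAssign ptr (Var ''i'') N0 (Var ''j''))) (?s 0) (?\<phi> (?s 0) + 1)
    (\<lambda>s'. \<exists>q. first_outside (set Zs) xs q \<and> nmem s' = upd (nmem (?s q)) ptr ?i 0 q)"
  proof (rule runs_Seq[OF loop])
    fix s' assume "?I s' \<and> \<not> bval ?b s'"
    then obtain j where j: "j \<le> length xs" "s' = ?s j" "set (take j xs) \<subseteq> set Zs" "\<not> bval ?b (?s j)"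
      by blast
    then have "first_outside (set Zs) xs j"
      using b[OF j(1)] by (auto simp: first_outside_def)
    then show "runs (NAssign ptr (Var ''i'') N0 (Var ''j'')) s' 1
      (\<lambda>s'. \<exists>q. first_outside (set Zs) xs q \<and> nmem s' = upd (nmem (?s q)) ptr ?i 0 q)"
      using j(2) by (intro runs_loop_free) auto
  qed
  then have "runs (scan_body sz el ptr) s (Suc (?\<phi> (?s 0) + 1))
    (\<lambda>s'. \<exists>q. first_outside (set Zs) xs q \<and> nmem s' = upd (nmem (?s q)) ptr ?i 0 q)"
    unfolding scan_body_def by (intro runs_Seq_NAssign) simp
  then show ?thesis
    by (simp add: numeral_3_eq_3)
qed

lemma runs_scan:
  fixes L :: "nat \<Rightarrow> nat list"
  assumes Z: "\<And>x. nmem s ''sing'' x 0 = (if x \<in> set Zs then 1 else 0)"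
    and L: "\<And>i. i < n \<Longrightarrow> list_at s sz el i (L i) \<and> distinct (L i)"
    and bnd: "nmem s bnd 0 0 = n"
    and fresh: "{bnd, sz, el, ''sing''} \<inter> nwrites (scan bnd sz el ptr) = {}" "ptr \<notin> {''i'', ''j''}"
  shows "runs (scan bnd sz el ptr) s (n * (2 * length Zs + 5) + 2)
    (\<lambda>s'. \<forall>i<n. first_outside (set Zs) (L i) (nmem s' ptr i 0))"
proof -
  let ?I = "\<lambda>i s'. \<forall>i'<i. first_outside (set Zs) (L i') (nmem s' ptr i' 0)"
  let ?body = "scan_body sz el ptr"
  have "runs (scan bnd sz el ptr) s (n * ((2 * length Zs + 3) + 2) + 2) (?I n)"
    unfolding scan_def
  proof (rule runs_For_uniform[where I = ?I])
    fix s' assume fr: "frame (For ''i'' (Var bnd) ?body) s s'"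
    have "nmem s' bnd = nmem s bnd"
      using fresh by (intro frame_nmem[OF fr]) (auto simp: nwrites_scan scan_body_def)
    then show "nval (Var bnd) s' = n"
      using bnd by simp
  next
    fix i s' assume i: "i < n" "nmem s' ''i'' 0 0 = i" and I: "?I i s'"
      and fr: "frame (For ''i'' (Var bnd) ?body) s s'"
    have names: "nmem s' sz = nmem s sz" "nmem s' el = nmem s el" "nmem s' ''sing'' = nmem s ''sing''"
      using fresh by (auto intro!: frame_nmem[OF fr] simp: nwrites_scan scan_body_def)
    have "runs ?body s' (2 * length Zs + 3) (\<lambda>s''. \<exists>q. first_outside (set Zs) (L i) q \<and>
      nmem s'' = upd (upd (nmem s') ''j'' 0 0 q) ptr (nmem s' ''i'' 0 0) 0 q)"
      by (rule runs_scan_body)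
        (use L[OF i(1)] Z fresh i(2) in \<open>auto simp: names list_at_def nwrites_scan\<close>)
    then show "runs ?body s' (2 * length Zs + 3) (?I (Suc i))"
      by (rule runs_mono) (use I i(2) fresh(2) in \<open>auto simp: less_Suc_eq\<close>)
  qed (use fresh(2) in \<open>auto simp: scan_body_def\<close>)
  then show ?thesis
    by (simp add: algebra_simps)
qed

section \<open>Selecting the elements\<close>

definition best_choice :: com where
  "best_choice =
     Seq (RAssign ''best'' N0 N0 (RConst 0))
    (Seq (Set ''s'' N0)
    (Seq (If (RLess (RCell ''best'' N0 N0) (RCell ''f'' (Var ''c'') N0))
           (Seq (Set ''s'' N1) (RAssign ''best'' N0 N0 (RCell ''f'' (Var ''c'') N0))) Skip)
         (If (BAnd (NLess N0 (NCell ''ok'' (Var ''c'') N0))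
               (RLess (RCell ''best'' N0 N0) (RCell ''p'' (Var ''c'') N0)))
           (Set ''s'' (NConst 2)) Skip)))"

text \<open>For empty \<open>Z\<close> the row that is read belongs to no block and its content is
  arbitrary, but then every kind denotes the empty selection.\<close>

lemma runs_best_choice:
  assumes "Z \<noteq> {} \<Longrightarrow> block_table v Z sol (nmem s ''ok'' (nmem s ''c'' 0 0) 0)
      (rmem s ''p'' (nmem s ''c'' 0 0) 0) (rmem s ''f'' (nmem s ''c'' 0 0) 0)"
    and "v {} = 0"
  shows "runs best_choice s 7 (\<lambda>s'. nmem s' ''s'' 0 0 \<le> 2 \<and>
    (\<forall>X\<subseteq>Z. v X \<le> v (choice (nmem s' ''s'' 0 0) Z sol)))"
proof -
  let ?c = "nmem s ''c'' 0 0"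
  let ?k = "nmem s ''ok'' ?c 0" and ?p = "rmem s ''p'' ?c 0" and ?f = "rmem s ''f'' ?c 0"
  define x where "x = nmem (effect best_choice s) ''s'' 0 0"
  have x: "x = (if 0 < ?k \<and> max 0 ?f < ?p then 2 else if 0 < ?f then 1 else 0)"
    by (auto simp: x_def best_choice_def)
  have "v X \<le> v (choice x Z sol)" if sub: "X \<subseteq> Z" for X
  proof (cases "Z = {}")
    case True
    then show ?thesis
      using sub by (simp add: choice_def)
  next
    case False
    note T = assms(1)[OF False]
    obtain y where y: "admissible y ?k" "v X \<le> choice_value y ?p ?f"
      using ex_choice_ge[OF T False assms(2) sub] by blast
    have "choice_value y ?p ?f \<le> choice_value x ?p ?f"
      using y(1) by (auto simp: x choice_value_def admissible_def)
    moreover have "choice_value x ?p ?f = v (choice x Z sol)"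
      using value_choice[OF T _ assms(2), of x] by (simp add: x admissible_def)
    ultimately show ?thesis
      using y by simp
  qed
  moreover have "x \<le> 2"
    by (simp add: x)
  ultimately show ?thesis
    by (intro runs_loop_free) (simp_all add: x_def, simp_all add: best_choice_def)
qed

definition select_body :: com where
  "select_body =
     Seq (Set ''x'' (NCell ''Z_elem'' N0 (Var ''k'')))
       (If (NEq (Var ''s'') N1) (push ''X_size'' ''X_elem'' (Var ''x''))
         (If (BAnd (NEq (Var ''s'') (NConst 2)) (NEq (NCell ''sol'' (Var ''x'') N0) N1))
           (push ''X_size'' ''X_elem'' (Var ''x'')) Skip))"

definition select :: com where
  "select = For ''k'' (Var ''Z_size'') select_body"

lemma nwrites_select_body: "nwrites select_body = {''x'', ''X_size'', ''X_elem''}"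
  by (auto simp: select_body_def push_def)

lemma nwrites_select: "nwrites select = {''k'', ''x'', ''X_size'', ''X_elem''}"
  by (simp add: select_def nwrites_select_body)

lemma runs_select:
  assumes Z: "list_at s ''Z_size'' ''Z_elem'' 0 Zs" and X: "nmem s ''X_size'' 0 0 = 0"
    and "nmem s ''s'' 0 0 \<le> 2"
  shows "runs select s (length Zs * 7 + 2) (\<lambda>s'. \<exists>Xs. list_at s' ''X_size'' ''X_elem'' 0 Xs \<and>
    set Xs = choice (nmem s ''s'' 0 0) (set Zs) (selected s) \<and> length Xs \<le> length Zs)"
proof -
  let ?I = "\<lambda>k s'. \<exists>Xs. list_at s' ''X_size'' ''X_elem'' 0 Xs \<and>
    set Xs = choice (nmem s ''s'' 0 0) (set (take k Zs)) (selected s) \<and> length Xs \<le> k"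
  have "runs select s (length Zs * (5 + 2) + 2) (?I (length Zs))"
    unfolding select_def
  proof (rule runs_For_uniform[where I = ?I])
    show "?I 0 s"
      using X by (intro exI[of _ "[]"]) (simp add: list_at_def choice_def)
    show "?I i (s'\<lparr>nmem := upd (nmem s') ''k'' 0 0 m\<rparr>)" if "?I i s'" for i m s'
      using that by (simp add: list_at_def)
    show "''k'' \<notin> nwrites select_body"
      by (simp add: nwrites_select_body)
  next
    fix s' assume fr: "frame (For ''k'' (Var ''Z_size'') select_body) s s'"
    show "nval (Var ''Z_size'') s' = length Zs"
      using frame_nmem[OF fr, of "''Z_size''"] Z by (simp add: nwrites_select_body list_at_def)
  next
    fix k s' assume k: "k < length Zs" "nmem s' ''k'' 0 0 = k" and I: "?I k s'"
      and fr: "frame (For ''k'' (Var ''Z_size'') select_body) s s'"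
    obtain Xs where Xs: "list_at s' ''X_size'' ''X_elem'' 0 Xs"
      "set Xs = choice (nmem s ''s'' 0 0) (set (take k Zs)) (selected s)" "length Xs \<le> k"
      using I by blast
    have names: "nmem s' n = nmem s n" if "n \<in> {''Z_elem'', ''s'', ''sol''}" for n
      using that by (intro frame_nmem[OF fr]) (auto simp: nwrites_select_body)
    let ?x = "Zs ! k"
    have e: "nmem s' ''Z_elem'' 0 k = ?x"
      using names Z k by (simp add: list_at_def)
    let ?s1 = "effect (Set ''x'' (NCell ''Z_elem'' N0 (Var ''k''))) s'"
    let ?take = "nmem s ''s'' 0 0 = 1 \<or> nmem s ''s'' 0 0 = 2 \<and> ?x \<in> selected s"
    have body: "effect select_body s' =
        (if ?take then effect (push ''X_size'' ''X_elem'' (Var ''x'')) ?s1 else ?s1)"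
      using k(2) e names by (auto simp: select_body_def)
    have X1: "list_at ?s1 ''X_size'' ''X_elem'' 0 Xs"
      using Xs(1) by (simp add: list_at_def)
    have ins: "set (take (Suc k) Zs) = insert ?x (set (take k Zs))"
      using k by (simp add: take_Suc_conv_app_nth)
    have "?I (Suc k) (effect select_body s')"
    proof (cases ?take)
      case True
      have "list_at (effect select_body s') ''X_size'' ''X_elem'' 0 (Xs @ [?x])"
        using list_at_effect_push[OF X1, of "Var ''x''"] True k(2) e by (simp add: body)
      moreover have "set (Xs @ [?x]) = choice (nmem s ''s'' 0 0) (set (take (Suc k) Zs)) (selected s)"
        using True Xs(2) by (auto simp: ins choice_def)
      ultimately show ?thesis
        using Xs(3) by (intro exI[of _ "Xs @ [?x]"]) simp
    next
      case False
      then have "set Xs = choice (nmem s ''s'' 0 0) (set (take (Suc k) Zs)) (selected s)"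
        using Xs(2) \<open>nmem s ''s'' 0 0 \<le> 2\<close> by (auto simp: ins choice_def)
      moreover have "effect select_body s' = ?s1"
        using body False by (simp only: if_False)
      ultimately show ?thesis
        using Xs(3) X1 by (intro exI[of _ Xs]) simp
    qed
    then show "runs select_body s' 5 (?I (Suc k))"
      by (intro runs_loop_free) (simp_all add: select_body_def push_def)
  qed
  then show ?thesis
    by simp
qed

section \<open>Hitting the reward sets that are not covered\<close>

definition test_hit :: com where
  "test_hit = For ''j'' (Var ''X_size'')
     (If (NEq (NCell ''A_mem'' (Var ''i'') (NCell ''X_elem'' N0 (Var ''j''))) N1)
       (Set ''hit'' N1) Skip)"

definition hit_body :: com where
  "hit_body =
     If (NLess (NCell ''A_ptr'' (Var ''i'') N0) (NCell ''A_size'' (Var ''i'') N0))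
       (Seq (Set ''hit'' N0) (Seq test_hit
         (If (NEq (Var ''hit'') N0)
           (push ''X_size'' ''X_elem'' (NCell ''A_elem'' (Var ''i'') (NCell ''A_ptr'' (Var ''i'') N0)))
           Skip)))
       Skip"

definition hit_all :: com where
  "hit_all = For ''i'' (Var ''h'') hit_body"

lemma nwrites_test_hit: "nwrites test_hit = {''j'', ''hit''}"
  by (auto simp: test_hit_def)

lemma nwrites_hit_body: "nwrites hit_body = {''j'', ''hit'', ''X_size'', ''X_elem''}"
  by (auto simp: hit_body_def nwrites_test_hit push_def)

text \<open>The loop runs over the selection and looks its elements up in the membership table, so
  the cost depends on the number of selected elements and not on the size of the reward set.\<close>

lemma runs_test_hit:
  assumes X: "list_at s ''X_size'' ''X_elem'' 0 Xs" and "nmem s ''hit'' 0 0 = 0"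
    and mem: "\<And>x. nmem s ''A_mem'' (nmem s ''i'' 0 0) x = (if x \<in> S then 1 else 0)"
  shows "runs test_hit s (length Xs * 4 + 2)
    (\<lambda>s'. nmem s' ''hit'' 0 0 = (if S \<inter> set Xs = {} then 0 else 1))"
proof -
  let ?I = "\<lambda>j s'. nmem s' ''hit'' 0 0 = (if S \<inter> set (take j Xs) = {} then 0 else 1 :: nat)"
  let ?body = "If (NEq (NCell ''A_mem'' (Var ''i'') (NCell ''X_elem'' N0 (Var ''j''))) N1)
       (Set ''hit'' N1) Skip"
  have "runs test_hit s (length Xs * (2 + 2) + 2) (?I (length Xs))"
    unfolding test_hit_def
  proof (rule runs_For_uniform[where I = ?I])
    fix s' assume fr: "frame (For ''j'' (Var ''X_size'') ?body) s s'"
    show "nval (Var ''X_size'') s' = length Xs"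
      using frame_nmem[OF fr, of "''X_size''"] X by (simp add: list_at_def)
  next
    fix j s' assume j: "j < length Xs" "nmem s' ''j'' 0 0 = j" and I: "?I j s'"
      and fr: "frame (For ''j'' (Var ''X_size'') ?body) s s'"
    have names: "nmem s' n = nmem s n" if "n \<in> {''A_mem'', ''X_elem'', ''i''}" for n
      using that by (intro frame_nmem[OF fr]) auto
    have "nmem s ''X_elem'' 0 j = Xs ! j"
      using X j by (simp add: list_at_def)
    moreover have "set (take (Suc j) Xs) = insert (Xs ! j) (set (take j Xs))"
      using j by (simp add: take_Suc_conv_app_nth)
    ultimately show "runs ?body s' 2 (?I (Suc j))"
      using j(2) I by (intro runs_loop_free) (simp_all add: names mem)
  qed (use assms in simp_all)
  then show ?thesis
    by simp
qed

text \<open>Added elements lie outside \<open>Z\<close>, so covered sets do not notice them. At most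
  one is added per reward set, which keeps each hit test within |Xs0| + h rounds.\<close>

lemma runs_hit_all:
  fixes L :: "nat \<Rightarrow> nat list"
  assumes X: "list_at s ''X_size'' ''X_elem'' 0 Xs0" "set Xs0 \<subseteq> Z"
    and h: "nmem s ''h'' 0 0 = h"
    and L: "\<And>i. i < h \<Longrightarrow> list_at s ''A_size'' ''A_elem'' i (L i)"
    and mem: "\<And>i x. i < h \<Longrightarrow> nmem s ''A_mem'' i x = (if x \<in> set (L i) then 1 else 0)"
    and ptr: "\<And>i. i < h \<Longrightarrow> first_outside Z (L i) (nmem s ''A_ptr'' i 0)"
    and lam: "laminar F" and F: "\<And>i. i < h \<Longrightarrow> set (L i) \<in> F"
    and single: "\<And>x. {x} \<in> F \<Longrightarrow> x \<in> Z"
  shows "runs hit_all s (h * (4 * (length Xs0 + h) + 10) + 2) (\<lambda>s'. \<exists>Xs.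
    list_at s' ''X_size'' ''X_elem'' 0 Xs \<and> set Xs \<inter> Z = set Xs0 \<and>
    set Xs \<subseteq> Z \<union> (\<Union>i<h. set (L i)) \<and> (\<forall>S\<in>F. \<not> S \<subseteq> Z \<longrightarrow> \<not> S \<subseteq> set Xs) \<and>
    (\<forall>i<h. \<not> set (L i) \<subseteq> Z \<longrightarrow> set (L i) \<inter> set Xs \<noteq> {}))"
proof -
  let ?P = "\<lambda>i Xs. length Xs \<le> length Xs0 + i \<and> set Xs \<inter> Z = set Xs0 \<and>
    set Xs \<subseteq> Z \<union> (\<Union>i<h. set (L i)) \<and> (\<forall>S\<in>F. \<not> S \<subseteq> Z \<longrightarrow> \<not> S \<subseteq> set Xs) \<and>
    (\<forall>i'<i. \<not> set (L i') \<subseteq> Z \<longrightarrow> set (L i') \<inter> set Xs \<noteq> {})"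
  let ?I = "\<lambda>i s'. \<exists>Xs. list_at s' ''X_size'' ''X_elem'' 0 Xs \<and> ?P i Xs"
  have "runs hit_all s (h * ((4 * (length Xs0 + h) + 8) + 2) + 2) (?I h)"
    unfolding hit_all_def
  proof (rule runs_For_uniform[where I = ?I])
    show "?I 0 s"
      using X by (intro exI[of _ Xs0]) auto
    show "?I i (s'\<lparr>nmem := upd (nmem s') ''i'' 0 0 m\<rparr>)" if "?I i s'" for i m s'
      using that by (simp add: list_at_def)
    show "''i'' \<notin> nwrites hit_body"
      by (simp add: nwrites_hit_body)
  next
    fix s' assume fr: "frame (For ''i'' (Var ''h'') hit_body) s s'"
    show "nval (Var ''h'') s' = h"
      using frame_nmem[OF fr, of "''h''"] h by (simp add: nwrites_hit_body)
  next
    fix i s' assume i: "i < h" "nmem s' ''i'' 0 0 = i" and I: "?I i s'"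
      and fr: "frame (For ''i'' (Var ''h'') hit_body) s s'"
    obtain Xs where Xs: "list_at s' ''X_size'' ''X_elem'' 0 Xs" and P: "?P i Xs"
      using I by blast
    have names: "nmem s' n = nmem s n" if "n \<in> {''A_size'', ''A_elem'', ''A_mem'', ''A_ptr''}" for n
      using that by (intro frame_nmem[OF fr]) (auto simp: nwrites_hit_body)
    let ?q = "nmem s ''A_ptr'' i 0"
    have len: "nmem s ''A_size'' i 0 = length (L i)"
      using L[OF i(1)] by (simp add: list_at_def)
    have free: "?q < length (L i) \<longleftrightarrow> \<not> set (L i) \<subseteq> Z"
      using ptr[OF i(1)] first_outside_length_iff[OF ptr[OF i(1)]]
      by (auto simp: first_outside_def)
    have test: "bval (NLess (NCell ''A_ptr'' (Var ''i'') N0) (NCell ''A_size'' (Var ''i'') N0)) s'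
      \<longleftrightarrow> \<not> set (L i) \<subseteq> Z"
      using len free i(2) by (simp add: names)
    let ?push = "push ''X_size'' ''X_elem'' (NCell ''A_elem'' (Var ''i'') (NCell ''A_ptr'' (Var ''i'') N0))"
    have keep: "?P (Suc i) Xs" if "set (L i) \<subseteq> Z \<or> set (L i) \<inter> set Xs \<noteq> {}"
      using P that by (auto simp: less_Suc_eq)
    have "runs hit_body s' (Suc (4 * length Xs + 6)) (?I (Suc i))"
      unfolding hit_body_def
    proof (rule runs_If)
      assume "\<not> bval (NLess (NCell ''A_ptr'' (Var ''i'') N0) (NCell ''A_size'' (Var ''i'') N0)) s'"
      then show "runs Skip s' (4 * length Xs + 6) (?I (Suc i))"
        using Xs keep test by (intro runs_loop_free) auto
    next
      assume "bval (NLess (NCell ''A_ptr'' (Var ''i'') N0) (NCell ''A_size'' (Var ''i'') N0)) s'"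
      then have nsub: "\<not> set (L i) \<subseteq> Z" and q: "?q < length (L i)"
        using test free by blast+
      define y where "y = L i ! ?q"
      have y: "y \<in> set (L i)" "y \<notin> Z"
        using ptr[OF i(1)] q by (auto simp: y_def first_outside_def)
      let ?s1 = "effect (Set ''hit'' N0) s'"
      have "runs (Seq test_hit (If (NEq (Var ''hit'') N0) ?push Skip)) ?s1
        ((length Xs * 4 + 2) + 3) (?I (Suc i))"
      proof (rule runs_Seq)
        show "runs test_hit ?s1 (length Xs * 4 + 2)
          (\<lambda>s''. nmem s'' ''hit'' 0 0 = (if set (L i) \<inter> set Xs = {} then 0 else 1))"
          by (rule runs_test_hit) (use Xs i mem in \<open>simp_all add: list_at_def names\<close>)
      next
        fix s2 assume s2: "nmem s2 ''hit'' 0 0 = (if set (L i) \<inter> set Xs = {} then 0 else 1)"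
          and fr2: "frame test_hit ?s1 s2"
        have n2: "nmem s2 n = nmem s' n" if "n \<notin> {''j'', ''hit''}" for n
          using frame_nmem[OF fr2, of n] that by (simp add: nwrites_test_hit)
        have X2: "list_at s2 ''X_size'' ''X_elem'' 0 Xs"
          using Xs by (simp add: list_at_def n2)
        have "?I (Suc i) (effect (If (NEq (Var ''hit'') N0) ?push Skip) s2)"
        proof (cases "set (L i) \<inter> set Xs = {}")
          case False
          then show ?thesis
            using s2 X2 keep by (intro exI[of _ Xs]) simp
        next
          case True
          have "nval (NCell ''A_elem'' (Var ''i'') (NCell ''A_ptr'' (Var ''i'') N0)) s2 = y"
            using L[OF i(1)] i q by (simp add: n2 names list_at_def y_def)
          then have "list_at (effect (If (NEq (Var ''hit'') N0) ?push Skip) s2)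
              ''X_size'' ''X_elem'' 0 (Xs @ [y])"
            using list_at_effect_push[OF X2, of
                "NCell ''A_elem'' (Var ''i'') (NCell ''A_ptr'' (Var ''i'') N0)"] s2 True by simp
          moreover have "\<not> S \<subseteq> set (Xs @ [y])" if S: "S \<in> F" "\<not> S \<subseteq> Z" for S
          proof
            assume sub: "S \<subseteq> set (Xs @ [y])"
            then have "y \<in> S"
              using P S by auto
            have "\<not> {y} \<in> F"
              using single y by blast
            \<comment> \<open>\<open>L i\<close> misses \<open>Xs\<close>, and \<open>S\<close> lies
              in \<open>Xs\<close> together with y. Whichever of the two sets is the smaller one
              therefore lies in {y}, and it contains y.\<close>
            consider "S \<subseteq> set (L i)" | "set (L i) \<subseteq> S"
              using lam F[OF i(1)] S y(1) \<open>y \<in> S\<close> unfolding laminar_def by blast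
            then show False
            proof cases
              case 1
              then have "S = {y}"
                using sub True \<open>y \<in> S\<close> by auto
              then show ?thesis
                using \<open>\<not> {y} \<in> F\<close> S by simp
            next
              case 2
              then have "set (L i) = {y}"
                using sub True y(1) by auto
              then show ?thesis
                using \<open>\<not> {y} \<in> F\<close> F[OF i(1)] by simp
            qed
          qed
          then have "?P (Suc i) (Xs @ [y])"
            using P y i(1) by (auto simp: less_Suc_eq)
          ultimately show ?thesis
            by blast
        qed
        then show "runs (If (NEq (Var ''hit'') N0) ?push Skip) s2 3 (?I (Suc i))"
          by (intro runs_loop_free) (simp_all add: push_def)
      qed
      then have "runs (Seq (Set ''hit'' N0) (Seq test_hit (If (NEq (Var ''hit'') N0) ?push Skip))) s'
          (Suc ((length Xs * 4 + 2) + 3)) (?I (Suc i))"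
        by (rule runs_Seq_NAssign)
      then show "runs (Seq (Set ''hit'' N0) (Seq test_hit (If (NEq (Var ''hit'') N0) ?push Skip))) s'
          (4 * length Xs + 6) (?I (Suc i))"
        by (rule runs_le) simp
    qed
    then show "runs hit_body s' (4 * (length Xs0 + h) + 8) (?I (Suc i))"
      by (rule runs_le) (use P i(1) in simp)
  qed
  then show ?thesis
    by (rule runs_mono) (simp, blast)
qed

section \<open>The algorithm\<close>

text \<open>A set that is both reward and penalty set is met twice in the round of its size. The
  second time it already is a block, so only its value is added.\<close>

definition process_both :: com where
  "process_both =
     Seq (process ''h'' ''A_size'' ''A_elem'' ''A_ptr'' (RCell ''a'' (Var ''i'') N0) (RConst 0))
         (process ''l'' ''B_size'' ''B_elem'' ''B_ptr'' (RConst 0) (RCell ''b'' (Var ''i'') N0))"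

text \<open>Round r treats the size r + 1, so empty sets are never touched. The number of rounds
  suffices because a covered set has at most |Z| elements and \<open>Z\<close> has at most h +
  l.\<close>

definition process_all :: com where
  "process_all = For ''r'' (NPlus (Var ''h'') (Var ''l'')) process_both"

text \<open>The list of \<open>Z\<close> occupies row 0 of its arrays, so with i = 0 the procedure
  \<open>merge\<close> treats \<open>Z\<close> like one more set; the guard ensures that the list is
  nonempty.\<close>

definition merge_all :: com where
  "merge_all =
     Seq (Set ''i'' N0) (If (NLess N0 (Var ''Z_size'')) (merge ''Z_size'' ''Z_elem'') Skip)"

definition prepare :: com where
  "prepare =
     Seq (mark ''h'' ''A_size'' ''A_elem'')
    (Seq (mark ''l'' ''B_size'' ''B_elem'')
    (Seq (scan ''h'' ''A_size'' ''A_elem'' ''A_ptr'')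
         (scan ''l'' ''B_size'' ''B_elem'' ''B_ptr'')))"

definition finish :: com where
  "finish = Seq merge_all (Seq best_choice (Seq select hit_all))"

definition solve :: com where
  "solve = Seq prepare (Seq process_all finish)"

lemma nwrites_process: "nwrites (process bnd sz el ptr e1 e2) = insert ''i'' (nwrites (merge sz el))"
  by (simp add: process_def nwrites_process_body)

lemma rwrites_process: "rwrites (process bnd sz el ptr e1 e2) = rwrites (merge sz el)"
  by (simp add: process_def rwrites_process_body)

lemma nwrites_process_both: "nwrites process_both =
    {''i'', ''c'', ''d'', ''j'', ''s'', ''t'', ''k'', ''x'', ''sol'', ''lab'', ''ok''}"
  by (auto simp: process_both_def nwrites_process nwrites_merge)

lemma rwrites_process_both: "rwrites process_both = {''best'', ''p'', ''f''}"
  by (simp add: process_both_def rwrites_process rwrites_merge)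

lemma nwrites_process_all: "nwrites process_all =
    {''r'', ''i'', ''c'', ''d'', ''j'', ''s'', ''t'', ''k'', ''x'', ''sol'', ''lab'', ''ok''}"
  by (simp add: process_all_def nwrites_process_both)

lemma rwrites_process_all: "rwrites process_all = {''best'', ''p'', ''f''}"
  by (simp add: process_all_def rwrites_process_both)

lemma nwrites_merge_all: "nwrites merge_all =
    {''i'', ''c'', ''d'', ''j'', ''s'', ''t'', ''k'', ''x'', ''sol'', ''lab'', ''ok''}"
  by (auto simp: merge_all_def nwrites_merge)

lemma rwrites_merge_all: "rwrites merge_all = {''best'', ''p'', ''f''}"
  by (simp add: merge_all_def rwrites_merge)

lemma nwrites_best_choice: "nwrites best_choice = {''s''}"
  by (simp add: best_choice_def)

lemma rwrites_best_choice: "rwrites best_choice = {''best''}"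
  by (simp add: best_choice_def)

lemma rwrites_select: "rwrites select = {}"
  by (simp add: select_def select_body_def push_def)

section \<open>Invariants for a laminar family given by lists\<close>

locale laminar_lists =
  fixes h l :: nat and A B :: "nat \<Rightarrow> nat list" and a b :: "nat \<Rightarrow> real"
  assumes distinct_A: "i < h \<Longrightarrow> distinct (A i)" and distinct_B: "j < l \<Longrightarrow> distinct (B j)"
    and laminar: "laminar ((\<lambda>i. set (A i)) ` {..<h} \<union> (\<lambda>j. set (B j)) ` {..<l})"
begin

definition family :: "nat set set" where
  "family = (\<lambda>i. set (A i)) ` {..<h} \<union> (\<lambda>j. set (B j)) ` {..<l}"

definition Z :: "nat set" where
  "Z = {x. {x} \<in> family}"

definition input :: "state \<Rightarrow> bool" where
  "input s \<longleftrightarrow> nmem s ''h'' 0 0 = h \<and> nmem s ''l'' 0 0 = l \<and>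
     (\<forall>i<h. list_at s ''A_size'' ''A_elem'' i (A i)) \<and>
     (\<forall>j<l. list_at s ''B_size'' ''B_elem'' j (B j)) \<and>
     (\<forall>i<h. \<forall>x. nmem s ''A_mem'' i x = (if x \<in> set (A i) then 1 else 0)) \<and>
     (\<forall>i<h. rmem s ''a'' i 0 = a i) \<and> (\<forall>j<l. rmem s ''b'' j 0 = b j)"

lemma input_frame:
  assumes "input s" and fr: "frame c s s'"
    and "nwrites c \<inter> {''h'', ''l'', ''A_size'', ''A_elem'', ''A_mem'', ''B_size'', ''B_elem''} = {}"
    and "rwrites c \<inter> {''a'', ''b''} = {}"
  shows "input s'"
proof -
  have "nmem s' ''h'' = nmem s ''h''" "nmem s' ''l'' = nmem s ''l''"
    "nmem s' ''A_size'' = nmem s ''A_size''" "nmem s' ''A_elem'' = nmem s ''A_elem''"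
    "nmem s' ''A_mem'' = nmem s ''A_mem''" "nmem s' ''B_size'' = nmem s ''B_size''"
    "nmem s' ''B_elem'' = nmem s ''B_elem''"
    using assms(3) by (simp_all add: frame_nmem[OF fr])
  moreover have "rmem s' ''a'' = rmem s ''a''" "rmem s' ''b'' = rmem s ''b''"
    using assms(4) by (simp_all add: frame_rmem[OF fr])
  ultimately show ?thesis
    using assms(1) by (simp add: input_def list_at_def)
qed

abbreviation value_of :: "nat set \<Rightarrow> nat set \<Rightarrow> nat set \<Rightarrow> real" where
  "value_of \<equiv> gain (\<lambda>i. set (A i)) a (\<lambda>j. set (B j)) b"

text \<open>Empty sets are left out here and in \<open>covered_B\<close>: an empty penalty set would
  give the empty selection a nonzero value and destroy separability.\<close>

definition covered_A :: "nat \<Rightarrow> nat set" where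
  "covered_A k = {i. i < h \<and> A i \<noteq> [] \<and> length (A i) \<le> k \<and> set (A i) \<subseteq> Z}"

definition covered_B :: "nat \<Rightarrow> nat set" where
  "covered_B k = {j. j < l \<and> B j \<noteq> [] \<and> length (B j) \<le> k \<and> set (B j) \<subseteq> Z}"

definition larger :: "nat \<Rightarrow> nat set set" where
  "larger k = {S \<in> family. S \<subseteq> Z \<and> k < card S}"

definition processed :: "nat \<Rightarrow> state \<Rightarrow> bool" where
  "processed k = dp_inv (value_of (covered_A k) (covered_B k))
     ((\<lambda>i. set (A i)) ` covered_A k \<union> (\<lambda>j. set (B j)) ` covered_B k) (larger k) Z"

definition pointers :: "state \<Rightarrow> bool" where
  "pointers s \<longleftrightarrow> (\<forall>i<h. first_outside Z (A i) (nmem s ''A_ptr'' i 0)) \<and>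
     (\<forall>j<l. first_outside Z (B j) (nmem s ''B_ptr'' j 0))"

lemma separable_value:
  assumes "R \<subseteq> {i. i < h \<and> A i \<noteq> []}" "Q \<subseteq> {j. j < l \<and> B j \<noteq> []}"
  shows "separable (value_of R Q) ((\<lambda>i. set (A i)) ` R \<union> (\<lambda>j. set (B j)) ` Q)"
  by (rule separable_gain) (use assms in auto)

text \<open>This is what the order by size achieves: \<open>T\<close> has at least as many elements
  as \<open>S\<close>, so \<open>T \<subseteq> S\<close> forces equality, and laminarity leaves only
  the two harmless cases.\<close>

lemma larger_comparable:
  assumes "S \<in> family" "S \<subseteq> Z" "card S = Suc k" "T \<in> larger k"
  shows "S \<in> larger k \<and> (S \<inter> T = {} \<or> S \<subseteq> T)"
proof
  show "S \<in> larger k"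
    using assms by (simp add: larger_def)
  have "finite S"
    using assms(3) card.infinite by fastforce
  have "T \<subseteq> S \<Longrightarrow> T = S"
    using card_seteq[OF \<open>finite S\<close>, of T] assms(3,4) by (simp add: larger_def)
  then show "S \<inter> T = {} \<or> S \<subseteq> T"
    using laminar assms(1,4) unfolding laminar_def family_def[symmetric] larger_def by blast
qed

definition cost :: "nat \<Rightarrow> (nat \<Rightarrow> nat list) \<Rightarrow> nat \<Rightarrow> nat \<Rightarrow> nat" where
  "cost n L z k = (\<Sum>i<n. (if length (L i) = Suc k \<and> set (L i) \<subseteq> Z
     then Suc (length (L i) * (z * 8 + 37) + 5) else 2) + 2) + 2"

lemma runs_process_both:
  assumes s: "input s" "pointers s" "processed k s" "nmem s ''r'' 0 0 = k"
    and Zs: "list_at s ''Z_size'' ''Z_elem'' 0 Zs" "distinct Zs" "set Zs = Z"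
  shows "runs process_both s (cost h A (length Zs) k + cost l B (length Zs) k) (processed (Suc k))"
  unfolding process_both_def
proof (rule runs_Seq)
  have RA: "covered_A (Suc k) = covered_A k \<union> {i. i < h \<and> length (A i) = Suc k \<and> set (A i) \<subseteq> set Zs}"
    by (auto simp: covered_A_def le_Suc_eq Zs(3))
  let ?Q1 = "dp_inv (value_of (covered_A (Suc k)) (covered_B k))
     ((\<lambda>i. set (A i)) ` covered_A (Suc k) \<union> (\<lambda>j. set (B j)) ` covered_B k) (larger k) Z"
  have "runs (process ''h'' ''A_size'' ''A_elem'' ''A_ptr'' (RCell ''a'' (Var ''i'') N0) (RConst 0)) s
    (cost h A (length Zs) k) (let R' = covered_A k \<union> {i. i < h \<and> length (A i) = Suc k \<and> set (A i) \<subseteq> set Zs}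
      in dp_inv (value_of R' (covered_B k)) ((\<lambda>j. set (B j)) ` covered_B k \<union> (\<lambda>i. set (A i)) ` R')
        (larger k) (set Zs))"
    unfolding cost_def Zs(3)[symmetric]
  proof (rule runs_process[where \<alpha> = a and \<beta> = "\<lambda>_. 0" and w = "\<lambda>R. value_of R (covered_B k)"])
    show "dp_inv (value_of (covered_A k) (covered_B k))
      ((\<lambda>j. set (B j)) ` covered_B k \<union> (\<lambda>i. set (A i)) ` covered_A k) (larger k) (set Zs) s"
      using s(3) Zs(3) by (simp add: processed_def Un_commute)
    show "nmem s ''A_ptr'' i 0 = length (A i) \<longleftrightarrow> set (A i) \<subseteq> set Zs" if "i < h" for i
      using s(2) that first_outside_length_iff unfolding pointers_def Zs(3) by blast
    show "separable (value_of R' (covered_B k))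
      ((\<lambda>j. set (B j)) ` covered_B k \<union> (\<lambda>i. set (A i)) ` R')" if "R' \<subseteq> {i. i < h \<and> A i \<noteq> []}" for R'
      using separable_value[OF that, of "covered_B k"] by (simp add: covered_B_def Un_commute subset_iff)
    show "set (A i) \<in> larger k \<and> (S \<in> larger k \<longrightarrow> set (A i) \<inter> S = {} \<or> set (A i) \<subseteq> S)"
      if "i < h" "length (A i) = Suc k" "set (A i) \<subseteq> set Zs" for i S
    proof -
      have "set (A i) \<in> family" "card (set (A i)) = Suc k"
        using that distinct_A by (auto simp: family_def distinct_card)
      then show ?thesis
        using larger_comparable that(3) Zs(3) by (auto simp: larger_def)
    qed
    show "value_of (insert i R') (covered_B k) X = value_of R' (covered_B k) X +
        (if set (A i) \<inter> X \<noteq> {} then a i else 0) - (if set (A i) \<subseteq> X then 0 else 0)"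
      if "R' \<subseteq> {..<h}" "i < h" "i \<notin> R'" for R' i X
      using gain_insert_reward[of R' i] finite_subset[OF that(1)] that(3) by simp
  qed (use s Zs in \<open>auto simp: input_def covered_A_def nwrites_merge\<close>)
  then show "runs (process ''h'' ''A_size'' ''A_elem'' ''A_ptr'' (RCell ''a'' (Var ''i'') N0) (RConst 0)) s
      (cost h A (length Zs) k) ?Q1"
    unfolding Let_def RA[symmetric] by (simp add: Zs(3) Un_commute)
next
  fix s1
  assume s1: "dp_inv (value_of (covered_A (Suc k)) (covered_B k))
     ((\<lambda>i. set (A i)) ` covered_A (Suc k) \<union> (\<lambda>j. set (B j)) ` covered_B k) (larger k) Z s1"
    and fr: "frame (process ''h'' ''A_size'' ''A_elem'' ''A_ptr'' (RCell ''a'' (Var ''i'') N0) (RConst 0)) s s1"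
  have RB: "covered_B (Suc k) = covered_B k \<union> {j. j < l \<and> length (B j) = Suc k \<and> set (B j) \<subseteq> set Zs}"
    by (auto simp: covered_B_def le_Suc_eq Zs(3))
  have in1: "input s1"
    by (rule input_frame[OF s(1) fr]) (simp_all add: nwrites_process nwrites_merge rwrites_process rwrites_merge)
  have names: "nmem s1 n = nmem s n" if "n \<in> {''r'', ''Z_size'', ''Z_elem'', ''B_ptr''}" for n
    using that by (intro frame_nmem[OF fr]) (auto simp: nwrites_process nwrites_merge)
  have "runs (process ''l'' ''B_size'' ''B_elem'' ''B_ptr'' (RConst 0) (RCell ''b'' (Var ''i'') N0)) s1
    (cost l B (length Zs) k) (let R' = covered_B k \<union> {i. i < l \<and> length (B i) = Suc k \<and> set (B i) \<subseteq> set Zs}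
      in dp_inv (value_of (covered_A (Suc k)) R')
        ((\<lambda>i. set (A i)) ` covered_A (Suc k) \<union> (\<lambda>j. set (B j)) ` R') (larger k) (set Zs))"
    unfolding cost_def Zs(3)[symmetric]
  proof (rule runs_process[where \<alpha> = "\<lambda>_. 0" and \<beta> = b and w = "\<lambda>R. value_of (covered_A (Suc k)) R"])
    show "dp_inv (value_of (covered_A (Suc k)) (covered_B k))
      ((\<lambda>i. set (A i)) ` covered_A (Suc k) \<union> (\<lambda>j. set (B j)) ` covered_B k) (larger k) (set Zs) s1"
      using s1 Zs(3) by simp
    show "list_at s1 ''Z_size'' ''Z_elem'' 0 Zs"
      using Zs(1) by (simp add: list_at_def names)
    show "nmem s1 ''B_ptr'' i 0 = length (B i) \<longleftrightarrow> set (B i) \<subseteq> set Zs" if "i < l" for i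
      using s(2) that first_outside_length_iff unfolding pointers_def Zs(3) by (simp add: names)
    show "separable (value_of (covered_A (Suc k)) R')
      ((\<lambda>i. set (A i)) ` covered_A (Suc k) \<union> (\<lambda>j. set (B j)) ` R')"
      if "R' \<subseteq> {i. i < l \<and> B i \<noteq> []}" for R'
      using separable_value[OF _ that, of "covered_A (Suc k)"] by (simp add: covered_A_def subset_iff)
    show "set (B i) \<in> larger k \<and> (S \<in> larger k \<longrightarrow> set (B i) \<inter> S = {} \<or> set (B i) \<subseteq> S)"
      if "i < l" "length (B i) = Suc k" "set (B i) \<subseteq> set Zs" for i S
    proof -
      have "set (B i) \<in> family" "card (set (B i)) = Suc k"
        using that distinct_B by (auto simp: family_def distinct_card)
      then show ?thesis
        using larger_comparable that(3) Zs(3) by (auto simp: larger_def)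
    qed
    show "value_of (covered_A (Suc k)) (insert i R') X = value_of (covered_A (Suc k)) R' X +
        (if set (B i) \<inter> X \<noteq> {} then 0 else 0) - (if set (B i) \<subseteq> X then b i else 0)"
      if "R' \<subseteq> {..<l}" "i < l" "i \<notin> R'" for R' i X
      using gain_insert_penalty[of R' i] finite_subset[OF that(1)] that(3) by simp
  qed (use s(4) in1 Zs in \<open>auto simp: input_def covered_B_def nwrites_merge names\<close>)
  then show "runs (process ''l'' ''B_size'' ''B_elem'' ''B_ptr'' (RConst 0) (RCell ''b'' (Var ''i'') N0)) s1
      (cost l B (length Zs) k) (processed (Suc k))"
    unfolding Let_def RB[symmetric] unfolding Zs(3) processed_def
  proof (rule runs_mono)
    \<comment> \<open>The sets of size k + 1 had to stay in \<open>larger k\<close> for both halves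
      of the round; only now may they be dropped.\<close>
    fix s' assume "dp_inv (value_of (covered_A (Suc k)) (covered_B (Suc k)))
      ((\<lambda>i. set (A i)) ` covered_A (Suc k) \<union> (\<lambda>j. set (B j)) ` covered_B (Suc k)) (larger k) Z s'"
    then show "dp_inv (value_of (covered_A (Suc k)) (covered_B (Suc k)))
      ((\<lambda>i. set (A i)) ` covered_A (Suc k) \<union> (\<lambda>j. set (B j)) ` covered_B (Suc k)) (larger (Suc k)) Z s'"
      by (rule dp_inv_antimono) (auto simp: larger_def)
  qed simp
qed

section \<open>Total cost of all rounds\<close>

definition covered_size :: nat where
  "covered_size = (\<Sum>i<h. if set (A i) \<subseteq> Z then length (A i) else 0) +
     (\<Sum>j<l. if set (B j) \<subseteq> Z then length (B j) else 0)"

text \<open>A list is merged in at most one round, the one matching its length; exchanging the two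
  sums charges it once. Otherwise it costs four steps per round.\<close>

lemma sum_cost_le:
  "(\<Sum>k<K. cost n L z k) \<le>
     K * (4 * n + 2) + (\<Sum>i<n. if set (L i) \<subseteq> Z then length (L i) else 0) * (z * 8 + 41)"
proof -
  let ?t = "\<lambda>k i. if Suc k = length (L i) then
    (if set (L i) \<subseteq> Z then length (L i) else 0) * (z * 8 + 41) else 0"
  have "cost n L z k \<le> (4 * n + 2) + (\<Sum>i<n. ?t k i)" for k
  proof -
    have "cost n L z k \<le> (\<Sum>i<n. 4 + ?t k i) + 2"
      \<comment> \<open>With its loop overhead, merging a list of length q costs q (8 z + 37) + 8;
        as q is at least 1, raising 37 to 41 absorbs the excess over 4.\<close>
      unfolding cost_def by (intro add_right_mono sum_mono) (auto simp: algebra_simps)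
    then show ?thesis
      by (simp add: sum.distrib)
  qed
  then have "(\<Sum>k<K. cost n L z k) \<le> (\<Sum>k<K. (4 * n + 2) + (\<Sum>i<n. ?t k i))"
    by (intro sum_mono) blast
  also have "\<dots> = K * (4 * n + 2) + (\<Sum>i<n. \<Sum>k<K. ?t k i)"
    unfolding sum.distrib using sum.swap[of ?t "{..<n}" "{..<K}"] by simp
  also have "(\<Sum>i<n. \<Sum>k<K. ?t k i) \<le>
      (\<Sum>i<n. (if set (L i) \<subseteq> Z then length (L i) else 0) * (z * 8 + 41))"
  proof (rule sum_mono)
    fix i
    let ?c = "(if set (L i) \<subseteq> Z then length (L i) else 0) * (z * 8 + 41)"
    have "(\<Sum>k<K. ?t k i) \<le> (\<Sum>k<K. if k = length (L i) - 1 then ?c else 0)"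
      by (rule sum_mono) auto
    also have "\<dots> \<le> ?c"
      by (simp add: sum.delta)
    finally show "(\<Sum>k<K. ?t k i) \<le> ?c" .
  qed
  finally show ?thesis
    by (simp add: sum_distrib_right)
qed

lemma runs_process_all:
  assumes s: "input s" "pointers s" "processed 0 s"
    and Zs: "list_at s ''Z_size'' ''Z_elem'' 0 Zs" "distinct Zs" "set Zs = Z"
  shows "runs process_all s ((h + l) * (4 * (h + l) + 6) + covered_size * (length Zs * 8 + 41) + 2)
    (processed (h + l))"
proof -
  let ?\<tau> = "\<lambda>k. cost h A (length Zs) k + cost l B (length Zs) k"
  have "runs process_all s ((\<Sum>k<h + l. ?\<tau> k + 2) + 2) (processed (h + l))"
    unfolding process_all_def
  proof (rule runs_For[where I = processed])
    show "processed k (s'\<lparr>nmem := upd (nmem s') ''r'' 0 0 m\<rparr>)" if "processed k s'" for k m s'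
      using that unfolding processed_def by (rule dp_inv_upd) simp
  next
    fix s' assume fr: "frame (For ''r'' (NPlus (Var ''h'') (Var ''l'')) process_both) s s'"
    have "input s'"
      by (rule input_frame[OF s(1) fr]) (simp_all add: nwrites_process_both rwrites_process_both)
    then show "nval (NPlus (Var ''h'') (Var ''l'')) s' = h + l"
      by (simp add: input_def)
  next
    fix k s' assume k: "processed k s'" "nmem s' ''r'' 0 0 = k"
      and fr: "frame (For ''r'' (NPlus (Var ''h'') (Var ''l'')) process_both) s s'"
    have "input s'"
      by (rule input_frame[OF s(1) fr]) (simp_all add: nwrites_process_both rwrites_process_both)
    moreover have names: "nmem s' n = nmem s n"
      if "n \<in> {''Z_size'', ''Z_elem'', ''A_ptr'', ''B_ptr''}" for n
      using that by (intro frame_nmem[OF fr]) (auto simp: nwrites_process_both)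
    ultimately show "runs process_both s' (?\<tau> k) (processed (Suc k))"
      using s(2) Zs k by (intro runs_process_both) (simp_all add: pointers_def list_at_def names)
  qed (use s(3) in \<open>simp_all add: nwrites_process_both\<close>)
  then show ?thesis
  proof (rule runs_le)
    have "(\<Sum>k<h + l. ?\<tau> k + 2) =
        (\<Sum>k<h + l. cost h A (length Zs) k) + (\<Sum>k<h + l. cost l B (length Zs) k) + 2 * (h + l)"
      unfolding sum.distrib by simp
    then show "(\<Sum>k<h + l. ?\<tau> k + 2) + 2 \<le>
        (h + l) * (4 * (h + l) + 6) + covered_size * (length Zs * 8 + 41) + 2"
      using sum_cost_le[where K = "h + l" and n = h and L = A and z = "length Zs"]
        sum_cost_le[where K = "h + l" and n = l and L = B and z = "length Zs"]
      by (simp add: covered_size_def algebra_simps)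
  qed
qed

lemma Z_eq: "Z = {x. \<exists>i<h. A i = [x]} \<union> {x. \<exists>j<l. B j = [x]}"
proof -
  have "set xs = {x} \<longleftrightarrow> xs = [x]" if "distinct xs" for xs and x :: nat
    using that by (cases xs) (auto simp: subset_singleton_iff)
  then show ?thesis
    using distinct_A distinct_B unfolding Z_def family_def by (auto simp: eq_commute)
qed

lemma Z_subset: "Z \<subseteq> \<Union>family"
  unfolding Z_def by blast

text \<open>The zero-filled memory is already a correct table: all blocks are singletons, as flag 0
  says, and with no set counted every value is 0. Any subset of \<open>Z\<close> is a union of
  singleton blocks.\<close>

lemma processed_0:
  assumes Zs: "marked Zs s" "set Zs = Z"
    and ok: "\<And>x. nmem s ''ok'' x 0 = 0" and f: "\<And>x. rmem s ''f'' x 0 = 0"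
  shows "processed 0 s"
proof -
  have lab: "label s x = x" if "x \<in> Z" for x
    using Zs that by (simp add: marked_def)
  have "block_table v (block Z (label s) c) sol (nmem s ''ok'' c 0) p (rmem s ''f'' c 0)"
    if "c \<in> label s ` Z" "\<And>X. v X = 0" for v sol c p
  proof -
    have "c \<in> Z"
      using that(1) lab by auto
    then have "block Z (label s) c = {c}"
      using lab by (auto simp: block_def)
    then show ?thesis
      using ok f that(2) by (simp add: block_table_def)
  qed
  moreover have "covered_A 0 = {}" "covered_B 0 = {}"
    by (auto simp: covered_A_def covered_B_def)
  moreover have "saturated Z (label s) S" if "S \<subseteq> Z" for S
    using lab that unfolding saturated_def by (metis subsetD)
  ultimately show ?thesis
    by (auto simp: processed_def dp_inv_def block_tables_def gain_def larger_def)
qed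

lemma runs_prepare:
  assumes s: "input s" and zero: "nmem s ''Z_size'' 0 0 = 0" "\<And>x. nmem s ''sing'' x 0 = 0"
    "\<And>x. nmem s ''ok'' x 0 = 0" "\<And>x. rmem s ''f'' x 0 = 0" "nmem s ''X_size'' 0 0 = 0"
  shows "runs prepare s ((h + l) * (2 * (h + l) + 12) + 8) (\<lambda>s'. \<exists>Zs.
    list_at s' ''Z_size'' ''Z_elem'' 0 Zs \<and> distinct Zs \<and> set Zs = Z \<and> length Zs \<le> h + l \<and>
    input s' \<and> pointers s' \<and> processed 0 s' \<and> nmem s' ''X_size'' 0 0 = 0)" (is "runs _ _ _ ?Q")
proof -
  let ?mA = "mark ''h'' ''A_size'' ''A_elem''" and ?mB = "mark ''l'' ''B_size'' ''B_elem''"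
  let ?sA = "scan ''h'' ''A_size'' ''A_elem'' ''A_ptr''" and ?sB = "scan ''l'' ''B_size'' ''B_elem'' ''B_ptr''"
  let ?K = "h + l"
  have "runs prepare s ((h * 7 + 2) + ((l * 7 + 2) + ((h * (2 * ?K + 5) + 2) + (l * (2 * ?K + 5) + 2)))) ?Q"
    unfolding prepare_def
  proof (rule runs_Seq)
    show "runs ?mA s (h * 7 + 2) (\<lambda>s'. \<exists>Zs'. marked Zs' s' \<and>
      set Zs' = set [] \<union> {x. \<exists>i<h. A i = [x]} \<and> length Zs' \<le> length ([] :: nat list) + h)"
      by (rule runs_mark) (use s zero in \<open>auto simp: marked_def list_at_def input_def nwrites_mark\<close>)
  next
    fix s1 assume "\<exists>Zs'. marked Zs' s1 \<and>
      set Zs' = set [] \<union> {x. \<exists>i<h. A i = [x]} \<and> length Zs' \<le> length ([] :: nat list) + h"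
    then obtain Zs1 where Zs1: "marked Zs1 s1" "set Zs1 = {x. \<exists>i<h. A i = [x]}" "length Zs1 \<le> h"
      by auto
    assume fr1: "frame ?mA s s1"
    have in1: "input s1"
      by (rule input_frame[OF s fr1]) (simp_all add: nwrites_mark rwrites_mark)
    show "runs (Seq ?mB (Seq ?sA ?sB)) s1
      ((l * 7 + 2) + ((h * (2 * ?K + 5) + 2) + (l * (2 * ?K + 5) + 2))) ?Q"
    proof (rule runs_Seq)
      show "runs ?mB s1 (l * 7 + 2) (\<lambda>s'. \<exists>Zs'. marked Zs' s' \<and>
        set Zs' = set Zs1 \<union> {x. \<exists>j<l. B j = [x]} \<and> length Zs' \<le> length Zs1 + l)"
        by (rule runs_mark[OF Zs1(1)]) (use in1 in \<open>auto simp: input_def nwrites_mark\<close>)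
    next
      fix s2 assume "\<exists>Zs'. marked Zs' s2 \<and>
        set Zs' = set Zs1 \<union> {x. \<exists>j<l. B j = [x]} \<and> length Zs' \<le> length Zs1 + l"
      then obtain Zs where Zs: "marked Zs s2" "set Zs = Z" "length Zs \<le> ?K"
        using Zs1(2,3) Z_eq by fastforce
      assume fr2: "frame ?mB s1 s2"
      have in2: "input s2"
        by (rule input_frame[OF in1 fr2]) (simp_all add: nwrites_mark rwrites_mark)
      have zero2: "nmem s2 ''ok'' = nmem s ''ok''" "nmem s2 ''X_size'' = nmem s ''X_size''"
        "rmem s2 ''f'' = rmem s ''f''"
        by (simp_all add: frame_nmem[OF fr2] frame_nmem[OF fr1] frame_rmem[OF fr2] frame_rmem[OF fr1]
            nwrites_mark rwrites_mark)
      have pr2: "processed 0 s2"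
        by (rule processed_0[OF Zs(1,2)]) (simp_all add: zero2 zero)
      have sing2: "nmem s2 ''sing'' x 0 = (if x \<in> set Zs then 1 else 0)" for x
        using Zs(1) unfolding marked_def by blast
      show "runs (Seq ?sA ?sB) s2 ((h * (2 * ?K + 5) + 2) + (l * (2 * ?K + 5) + 2)) ?Q"
      proof (rule runs_Seq)
        have "runs ?sA s2 (h * (2 * length Zs + 5) + 2)
          (\<lambda>s'. \<forall>i<h. first_outside (set Zs) (A i) (nmem s' ''A_ptr'' i 0))"
          by (rule runs_scan[OF sing2])
            (use in2 distinct_A in \<open>auto simp: input_def nwrites_scan\<close>)
        then show "runs ?sA s2 (h * (2 * ?K + 5) + 2)
          (\<lambda>s'. \<forall>i<h. first_outside (set Zs) (A i) (nmem s' ''A_ptr'' i 0))"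
          by (rule runs_le) (use Zs(3) in simp)
      next
        fix s3 assume A3: "\<forall>i<h. first_outside (set Zs) (A i) (nmem s3 ''A_ptr'' i 0)"
          and fr3: "frame ?sA s2 s3"
        have in3: "input s3"
          by (rule input_frame[OF in2 fr3]) (simp_all add: nwrites_scan rwrites_scan)
        have sing3: "nmem s3 ''sing'' x 0 = (if x \<in> set Zs then 1 else 0)" for x
          using sing2 by (simp add: frame_nmem[OF fr3] nwrites_scan)
        have "runs ?sB s3 (l * (2 * length Zs + 5) + 2)
          (\<lambda>s'. \<forall>j<l. first_outside (set Zs) (B j) (nmem s' ''B_ptr'' j 0))"
          by (rule runs_scan[OF sing3])
            (use in3 distinct_B in \<open>auto simp: input_def nwrites_scan\<close>)
        then show "runs ?sB s3 (l * (2 * ?K + 5) + 2) ?Q"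
        proof (rule runs_mono)
          fix s4 assume B4: "\<forall>j<l. first_outside (set Zs) (B j) (nmem s4 ''B_ptr'' j 0)"
            and fr4: "frame ?sB s3 s4"
          have "input s4"
            by (rule input_frame[OF in3 fr4]) (simp_all add: nwrites_scan rwrites_scan)
          moreover have names: "nmem s4 n = nmem s2 n"
            if "n \<in> {''Z_size'', ''Z_elem'', ''X_size'', ''lab'', ''sol'', ''ok''}" for n
            using that by (auto simp: frame_nmem[OF fr4] frame_nmem[OF fr3] nwrites_scan)
          moreover have "rmem s4 = rmem s2"
            by (simp add: fun_eq_iff frame_rmem[OF fr4] frame_rmem[OF fr3] rwrites_scan)
          moreover have "nmem s4 ''A_ptr'' = nmem s3 ''A_ptr''"
            by (simp add: frame_nmem[OF fr4] nwrites_scan)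
          then have "pointers s4"
            using A3 B4 Zs(2) by (simp add: pointers_def)
          moreover have "processed 0 s4 = processed 0 s2"
            using block_tables_cong[of s4 s2] names \<open>rmem s4 = rmem s2\<close>
            by (simp add: processed_def dp_inv_def)
          ultimately show "?Q s4"
            using Zs pr2 zero2 zero by (intro exI[of _ Zs]) (simp add: marked_def list_at_def)
        qed (use Zs(3) in simp)
      qed
    qed
  qed
  then show ?thesis
    by (rule runs_le) (simp add: algebra_simps)
qed

section \<open>The final merger and the whole program\<close>

lemma runs_merge_all:
  assumes P: "processed k s" and Zs: "list_at s ''Z_size'' ''Z_elem'' 0 Zs" "distinct Zs" "set Zs = Z"
  shows "runs merge_all s (length Zs * (length Zs * 8 + 37) + 5) (\<lambda>s'. Z \<noteq> {} \<longrightarrow>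
    block_table (value_of (covered_A k) (covered_B k)) Z (selected s')
      (nmem s' ''ok'' (nmem s' ''c'' 0 0) 0) (rmem s' ''p'' (nmem s' ''c'' 0 0) 0)
      (rmem s' ''f'' (nmem s' ''c'' 0 0) 0))" (is "runs _ _ _ ?Q")
proof -
  let ?s1 = "effect (Set ''i'' N0) s"
  let ?v = "value_of (covered_A k) (covered_B k)"
  let ?F = "(\<lambda>i. set (A i)) ` covered_A k \<union> (\<lambda>j. set (B j)) ` covered_B k"
  have "runs (If (NLess N0 (Var ''Z_size'')) (merge ''Z_size'' ''Z_elem'') Skip) ?s1
    (Suc (length Zs * (length Zs * 8 + 37) + 3)) ?Q"
  proof (rule runs_If)
    assume "\<not> bval (NLess N0 (Var ''Z_size'')) ?s1"
    then have "Z = {}"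
      using Zs by (auto simp: list_at_def)
    then show "runs Skip ?s1 (length Zs * (length Zs * 8 + 37) + 3) ?Q"
      by (intro runs_loop_free) simp_all
  next
    assume "bval (NLess N0 (Var ''Z_size'')) ?s1"
    then have "Zs \<noteq> []"
      using Zs by (auto simp: list_at_def)
    have inv: "dp_inv ?v ?F (larger k) Z ?s1"
      using P dp_inv_upd[of ?v ?F "larger k" Z s "''i''"] by (simp add: processed_def)
    have "runs (merge ''Z_size'' ''Z_elem'') ?s1 (length Zs * (length Zs * 8 + 37) + 3) (\<lambda>s'.
      block_tables ?v (set Zs) s' \<and> nmem s' ''c'' 0 0 = label ?s1 (Zs ! 0) \<and>
      (\<forall>z\<in>set Zs. label s' z = (if z \<in> set Zs then label ?s1 (Zs ! 0) else label ?s1 z)))"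
    proof (rule runs_merge[where F = ?F])
      show "separable ?v ?F"
        by (rule separable_value) (auto simp: covered_A_def covered_B_def)
      show "block_tables ?v (set Zs) ?s1" "\<And>S. S \<in> ?F \<Longrightarrow> S \<subseteq> set Zs \<and> uniform (label ?s1) S"
        using inv unfolding dp_inv_def Zs(3) by blast+
      show "saturated (set Zs) (label ?s1) (set Zs)"
        unfolding saturated_def by blast
    qed (use Zs \<open>Zs \<noteq> []\<close> in \<open>simp_all add: list_at_def nwrites_merge\<close>)
    then show "runs (merge ''Z_size'' ''Z_elem'') ?s1 (length Zs * (length Zs * 8 + 37) + 3) ?Q"
    proof (rule runs_mono)
      fix s' assume s': "block_tables ?v (set Zs) s' \<and> nmem s' ''c'' 0 0 = label ?s1 (Zs ! 0) \<and>
        (\<forall>z\<in>set Zs. label s' z = (if z \<in> set Zs then label ?s1 (Zs ! 0) else label ?s1 z))"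
      let ?c = "nmem s' ''c'' 0 0"
      have lab: "label s' z = ?c" if "z \<in> Z" for z
        using s' that Zs(3) by simp
      then have "block Z (label s') ?c = Z"
        by (auto simp: block_def)
      moreover have "?c \<in> label s' ` Z" if "Z \<noteq> {}"
        using lab that by (metis all_not_in_conv image_eqI)
      ultimately show "?Q s'"
        using s' unfolding block_tables_def Zs(3) by metis
    qed simp
  qed
  then have "runs merge_all s (Suc (Suc (length Zs * (length Zs * 8 + 37) + 3))) ?Q"
    unfolding merge_all_def by (rule runs_Seq_NAssign)
  then show ?thesis
    by (rule runs_le) simp
qed

text \<open>The interface between program and optimality proof. The covered sets are served as well
  as possible, and the uncovered ones attain the obvious bound of all rewards and no
  penalties.\<close>

definition good_selection :: "nat set \<Rightarrow> bool" where
  "good_selection X \<longleftrightarrow> X \<subseteq> \<Union>family \<and>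
     (\<forall>Y\<subseteq>Z. value_of (covered_A (h + l)) (covered_B (h + l)) Y \<le>
       value_of (covered_A (h + l)) (covered_B (h + l)) (X \<inter> Z)) \<and>
     (\<forall>S\<in>family. \<not> S \<subseteq> Z \<longrightarrow> \<not> S \<subseteq> X) \<and> (\<forall>i<h. \<not> set (A i) \<subseteq> Z \<longrightarrow> set (A i) \<inter> X \<noteq> {})"

lemma runs_finish:
  assumes s: "input s" "pointers s" "processed (h + l) s" "nmem s ''X_size'' 0 0 = 0"
    and Zs: "list_at s ''Z_size'' ''Z_elem'' 0 Zs" "distinct Zs" "set Zs = Z"
  shows "runs finish s (length Zs * (length Zs * 8 + 44) + h * (4 * (length Zs + h) + 10) + 16)
    (\<lambda>s'. \<exists>Xs. list_at s' ''X_size'' ''X_elem'' 0 Xs \<and> good_selection (set Xs))" (is "runs _ _ _ ?Q")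
proof -
  let ?v = "value_of (covered_A (h + l)) (covered_B (h + l))"
  let ?z = "length Zs"
  have "runs finish s ((?z * (?z * 8 + 37) + 5) + (7 + ((?z * 7 + 2) + (h * (4 * (?z + h) + 10) + 2)))) ?Q"
    unfolding finish_def
  proof (rule runs_Seq[OF runs_merge_all[OF s(3) Zs]])
    fix s1
    assume T1: "Z \<noteq> {} \<longrightarrow> block_table ?v Z (selected s1) (nmem s1 ''ok'' (nmem s1 ''c'' 0 0) 0)
      (rmem s1 ''p'' (nmem s1 ''c'' 0 0) 0) (rmem s1 ''f'' (nmem s1 ''c'' 0 0) 0)"
      and fr1: "frame merge_all s s1"
    have in1: "input s1"
      by (rule input_frame[OF s(1) fr1]) (simp_all add: nwrites_merge_all rwrites_merge_all)
    have "separable ?v ((\<lambda>i. set (A i)) ` covered_A (h + l) \<union> (\<lambda>j. set (B j)) ` covered_B (h + l))"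
      by (rule separable_value) (auto simp: covered_A_def covered_B_def)
    then have v0: "?v {} = 0"
      by (simp add: separable_def)
    show "runs (Seq best_choice (Seq select hit_all)) s1
      (7 + ((?z * 7 + 2) + (h * (4 * (?z + h) + 10) + 2))) ?Q"
    proof (rule runs_Seq)
      show "runs best_choice s1 7 (\<lambda>s'. nmem s' ''s'' 0 0 \<le> 2 \<and>
        (\<forall>X\<subseteq>Z. ?v X \<le> ?v (choice (nmem s' ''s'' 0 0) Z (selected s1))))"
        by (rule runs_best_choice) (use T1 v0 in blast)+
    next
      fix s2 assume s2: "nmem s2 ''s'' 0 0 \<le> 2 \<and>
        (\<forall>X\<subseteq>Z. ?v X \<le> ?v (choice (nmem s2 ''s'' 0 0) Z (selected s1)))"
        and fr2: "frame best_choice s1 s2"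
      have in2: "input s2"
        by (rule input_frame[OF in1 fr2]) (simp_all add: nwrites_best_choice rwrites_best_choice)
      have sol: "nmem s2 ''sol'' = nmem s1 ''sol''"
        by (simp add: frame_nmem[OF fr2] nwrites_best_choice)
      have names2: "nmem s2 n = nmem s n"
        if "n \<in> {''Z_size'', ''Z_elem'', ''X_size'', ''A_ptr''}" for n
        using that by (auto simp: frame_nmem[OF fr2] frame_nmem[OF fr1] nwrites_best_choice nwrites_merge_all)
      let ?X = "choice (nmem s2 ''s'' 0 0) (set Zs) (selected s2)"
      show "runs (Seq select hit_all) s2 ((?z * 7 + 2) + (h * (4 * (?z + h) + 10) + 2)) ?Q"
      proof (rule runs_Seq)
        show "runs select s2 (?z * 7 + 2) (\<lambda>s'. \<exists>Xs. list_at s' ''X_size'' ''X_elem'' 0 Xs \<and>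
          set Xs = ?X \<and> length Xs \<le> ?z)"
          by (rule runs_select) (use Zs(1) s(4) s2 in \<open>simp_all add: list_at_def names2\<close>)
      next
        fix s3 assume "\<exists>Xs. list_at s3 ''X_size'' ''X_elem'' 0 Xs \<and> set Xs = ?X \<and> length Xs \<le> ?z"
        then obtain Xs0 where Xs0: "list_at s3 ''X_size'' ''X_elem'' 0 Xs0" "set Xs0 = ?X" "length Xs0 \<le> ?z"
          by blast
        assume fr3: "frame select s2 s3"
        have in3: "input s3"
          by (rule input_frame[OF in2 fr3]) (simp_all add: nwrites_select rwrites_select)
        have ptr3: "nmem s3 ''A_ptr'' = nmem s ''A_ptr''"
          by (simp add: frame_nmem[OF fr3] nwrites_select names2)
        have sub: "set Xs0 \<subseteq> Z"
          using Xs0(2) Zs(3) by (auto simp: choice_def split: if_splits)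
        have best: "?v Y \<le> ?v (set Xs0)" if "Y \<subseteq> Z" for Y
          using s2 that Zs(3) by (simp add: Xs0(2) sol)
        have "runs hit_all s3 (h * (4 * (length Xs0 + h) + 10) + 2) (\<lambda>s'. \<exists>Xs.
          list_at s' ''X_size'' ''X_elem'' 0 Xs \<and> set Xs \<inter> Z = set Xs0 \<and>
          set Xs \<subseteq> Z \<union> (\<Union>i<h. set (A i)) \<and> (\<forall>S\<in>family. \<not> S \<subseteq> Z \<longrightarrow> \<not> S \<subseteq> set Xs) \<and>
          (\<forall>i<h. \<not> set (A i) \<subseteq> Z \<longrightarrow> set (A i) \<inter> set Xs \<noteq> {}))"
        proof (rule runs_hit_all[OF Xs0(1) sub])
          show "laminar family"
            using laminar by (simp add: family_def)
          show "first_outside Z (A i) (nmem s3 ''A_ptr'' i 0)" if "i < h" for i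
            using s(2) that by (simp add: pointers_def ptr3)
        qed (use in3 in \<open>simp_all add: input_def family_def Z_def\<close>)
        then show "runs hit_all s3 (h * (4 * (?z + h) + 10) + 2) ?Q"
        proof (rule runs_mono)
          fix s4 assume "\<exists>Xs. list_at s4 ''X_size'' ''X_elem'' 0 Xs \<and> set Xs \<inter> Z = set Xs0 \<and>
            set Xs \<subseteq> Z \<union> (\<Union>i<h. set (A i)) \<and> (\<forall>S\<in>family. \<not> S \<subseteq> Z \<longrightarrow> \<not> S \<subseteq> set Xs) \<and>
            (\<forall>i<h. \<not> set (A i) \<subseteq> Z \<longrightarrow> set (A i) \<inter> set Xs \<noteq> {})"
          then obtain Xs where Xs: "list_at s4 ''X_size'' ''X_elem'' 0 Xs" "set Xs \<inter> Z = set Xs0"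
            "set Xs \<subseteq> Z \<union> (\<Union>i<h. set (A i))" "\<forall>S\<in>family. \<not> S \<subseteq> Z \<longrightarrow> \<not> S \<subseteq> set Xs"
            "\<forall>i<h. \<not> set (A i) \<subseteq> Z \<longrightarrow> set (A i) \<inter> set Xs \<noteq> {}"
            by blast
          have "(\<Union>i<h. set (A i)) \<subseteq> \<Union>family"
            by (auto simp: family_def)
          then have "set Xs \<subseteq> \<Union>family"
            using Xs(3) Z_subset by (meson Un_least order_trans)
          then have "good_selection (set Xs)"
            using Xs(4,5) best unfolding good_selection_def Xs(2) by simp
          then show "?Q s4"
            using Xs(1) by blast
        qed (use Xs0(3) in simp)
      qed
    qed
  qed
  then show ?thesis
    by (rule runs_le) (simp add: algebra_simps)
qed

text \<open>The constants add up the phases: 22 = 2 + 4 + 8 + 8, 72 = 12 + 6 + 44 + 10 and 26 = 8 +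
  2 + 16.\<close>

lemma runs_solve:
  assumes s: "input s" and zero: "nmem s ''Z_size'' 0 0 = 0" "\<And>x. nmem s ''sing'' x 0 = 0"
    "\<And>x. nmem s ''ok'' x 0 = 0" "\<And>x. rmem s ''f'' x 0 = 0" "nmem s ''X_size'' 0 0 = 0"
  shows "runs solve s ((h + l) * (22 * (h + l) + 72) + covered_size * (8 * (h + l) + 41) + 26)
    (\<lambda>s'. \<exists>Xs. list_at s' ''X_size'' ''X_elem'' 0 Xs \<and> good_selection (set Xs))" (is "runs _ _ _ ?Q")
proof -
  let ?K = "h + l"
  have "runs solve s ((?K * (2 * ?K + 12) + 8) + ((?K * (4 * ?K + 6) + covered_size * (?K * 8 + 41) + 2) +
    (?K * (?K * 8 + 44) + ?K * (8 * ?K + 10) + 16))) ?Q"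
    unfolding solve_def
  proof (rule runs_Seq[OF runs_prepare[OF assms]])
    fix s1 assume "\<exists>Zs. list_at s1 ''Z_size'' ''Z_elem'' 0 Zs \<and> distinct Zs \<and> set Zs = Z \<and>
      length Zs \<le> ?K \<and> input s1 \<and> pointers s1 \<and> processed 0 s1 \<and> nmem s1 ''X_size'' 0 0 = 0"
    then obtain Zs where Zs: "list_at s1 ''Z_size'' ''Z_elem'' 0 Zs" "distinct Zs" "set Zs = Z"
      "length Zs \<le> ?K" and s1: "input s1" "pointers s1" "processed 0 s1" "nmem s1 ''X_size'' 0 0 = 0"
      by blast
    show "runs (Seq process_all finish) s1 ((?K * (4 * ?K + 6) + covered_size * (?K * 8 + 41) + 2) +
      (?K * (?K * 8 + 44) + ?K * (8 * ?K + 10) + 16)) ?Q"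
    proof (rule runs_Seq)
      show "runs process_all s1 (?K * (4 * ?K + 6) + covered_size * (?K * 8 + 41) + 2) (processed ?K)"
        by (rule runs_le[OF runs_process_all[OF s1(1-3) Zs(1-3)]]) (use Zs(4) in simp)
    next
      fix s2 assume s2: "processed ?K s2" and fr: "frame process_all s1 s2"
      have in2: "input s2"
        by (rule input_frame[OF s1(1) fr]) (simp_all add: nwrites_process_all rwrites_process_all)
      have names: "nmem s2 n = nmem s1 n"
        if "n \<in> {''Z_size'', ''Z_elem'', ''X_size'', ''A_ptr'', ''B_ptr''}" for n
        using that by (auto simp: frame_nmem[OF fr] nwrites_process_all)
      have "runs finish s2 (length Zs * (length Zs * 8 + 44) + h * (4 * (length Zs + h) + 10) + 16) ?Q"
        by (rule runs_finish)
          (use s1 s2 in2 Zs in \<open>simp_all add: pointers_def list_at_def names\<close>)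
      then show "runs finish s2 (?K * (?K * 8 + 44) + ?K * (8 * ?K + 10) + 16) ?Q"
      proof (rule runs_le)
        have "length Zs * (length Zs * 8 + 44) \<le> ?K * (?K * 8 + 44)"
          using Zs(4) by (intro mult_le_mono) simp_all
        moreover have "h * (4 * (length Zs + h) + 10) \<le> ?K * (8 * ?K + 10)"
          using Zs(4) by (intro mult_le_mono) simp_all
        ultimately show "length Zs * (length Zs * 8 + 44) + h * (4 * (length Zs + h) + 10) + 16 \<le>
          ?K * (?K * 8 + 44) + ?K * (8 * ?K + 10) + 16"
          by linarith
      qed
    qed
  qed
  then show ?thesis
    by (rule runs_le) (simp add: algebra_simps)
qed

end

section \<open>Optimality and running time\<close>

lemma gain_split:
  assumes "finite R'" "finite Q'" "R \<subseteq> R'" "Q \<subseteq> Q'"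
  shows "gain A a B b R' Q' X = gain A a B b R Q X + gain A a B b (R' - R) (Q' - Q) X"
  using assms unfolding gain_def by (simp add: sum.subset_diff)

context laminar_lists
begin

lemma card_Z: "finite Z" "card Z \<le> h + l"
proof -
  \<comment> \<open>The head of a one-element list is its only element. An empty list contributes
    some unspecified value, which does no harm to the count.\<close>
  let ?H = "(\<lambda>i. hd (A i)) ` {..<h} \<union> (\<lambda>j. hd (B j)) ` {..<l}"
  have sub: "Z \<subseteq> ?H"
    unfolding Z_eq by force
  then show "finite Z"
    by (rule finite_subset) simp
  have "card Z \<le> card ?H"
    using sub by (intro card_mono) simp_all
  also have "\<dots> \<le> card {..<h} + card {..<l}"
    by (meson add_mono card_Un_le card_image_le finite_lessThan order_trans)
  finally show "card Z \<le> h + l"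
    by simp
qed

lemma covered_all:
  "covered_A (h + l) = {i. i < h \<and> A i \<noteq> [] \<and> set (A i) \<subseteq> Z}"
  "covered_B (h + l) = {j. j < l \<and> B j \<noteq> [] \<and> set (B j) \<subseteq> Z}"
proof -
  have "length xs \<le> h + l" if "distinct xs" "set xs \<subseteq> Z" for xs
    using card_mono[OF card_Z(1) that(2)] card_Z(2) distinct_card[OF that(1)] by simp
  then show "covered_A (h + l) = {i. i < h \<and> A i \<noteq> [] \<and> set (A i) \<subseteq> Z}"
    "covered_B (h + l) = {j. j < l \<and> B j \<noteq> [] \<and> set (B j) \<subseteq> Z}"
    using distinct_A distinct_B by (auto simp: covered_A_def covered_B_def)
qed

text \<open>The value splits into a part that depends only on the trace on \<open>Z\<close> and the
  part of the remaining sets. In the latter \<open>X\<close> is best term by term; the empty sets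
  belong there too, with terms that are the same for all selections.\<close>

lemma good_selection_optimal:
  assumes "good_selection X" and a: "\<And>i. i < h \<Longrightarrow> 0 \<le> a i" and b: "\<And>j. j < l \<Longrightarrow> 0 \<le> b j"
  shows "value_of {..<h} {..<l} Y \<le> value_of {..<h} {..<l} X"
proof -
  let ?R = "covered_A (h + l)" and ?Q = "covered_B (h + l)"
  have split: "value_of {..<h} {..<l} W =
      value_of ?R ?Q (W \<inter> Z) + value_of ({..<h} - ?R) ({..<l} - ?Q) W" for W
  proof -
    have "(set (A i) \<inter> W \<noteq> {}) = (set (A i) \<inter> (W \<inter> Z) \<noteq> {})" if "i \<in> ?R" for i
      using that unfolding covered_all by blast
    moreover have "(set (B j) \<subseteq> W) = (set (B j) \<subseteq> W \<inter> Z)" if "j \<in> ?Q" for j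
      using that unfolding covered_all by blast
    ultimately have "value_of ?R ?Q W = value_of ?R ?Q (W \<inter> Z)"
      unfolding gain_def by (simp cong: sum.cong)
    moreover have "value_of {..<h} {..<l} W = value_of ?R ?Q W + value_of ({..<h} - ?R) ({..<l} - ?Q) W"
      by (rule gain_split) (auto simp: covered_all)
    ultimately show ?thesis
      by simp
  qed
  have "value_of ?R ?Q (Y \<inter> Z) \<le> value_of ?R ?Q (X \<inter> Z)"
    using assms(1) unfolding good_selection_def by simp
  moreover have "value_of ({..<h} - ?R) ({..<l} - ?Q) Y \<le> value_of ({..<h} - ?R) ({..<l} - ?Q) X"
    unfolding gain_def
  proof (intro diff_mono sum_mono)
    fix i assume "i \<in> {..<h} - ?R"
    then have i: "i < h" "A i = [] \<or> \<not> set (A i) \<subseteq> Z"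
      by (auto simp: covered_all)
    then have "A i = [] \<or> set (A i) \<inter> X \<noteq> {}"
      using assms(1) unfolding good_selection_def by blast
    then show "(if set (A i) \<inter> Y \<noteq> {} then a i else 0) \<le> (if set (A i) \<inter> X \<noteq> {} then a i else 0)"
      using a[OF i(1)] by auto
  next
    fix j assume "j \<in> {..<l} - ?Q"
    then have j: "j < l" "B j = [] \<or> \<not> set (B j) \<subseteq> Z"
      by (auto simp: covered_all)
    moreover have "set (B j) \<in> family"
      using j(1) by (simp add: family_def)
    ultimately have "B j = [] \<or> \<not> set (B j) \<subseteq> X"
      using assms(1) unfolding good_selection_def by blast
    then show "(if set (B j) \<subseteq> X then b j else 0) \<le> (if set (B j) \<subseteq> Y then b j else 0)"
      using b[OF j(1)] by auto
  qed
  ultimately show ?thesis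
    unfolding split by linarith
qed

text \<open>An element x of the i-th covered set is charged to the arc from that set to {x}, which
  is a node because x lies in \<open>Z\<close>. As the sets are pairwise distinct, no arc is charged
  twice.\<close>

lemma sum_covered_le:
  fixes L :: "nat \<Rightarrow> nat list"
  assumes inj: "inj_on (\<lambda>i. set (L i)) {..<n}" and fam: "(\<lambda>i. set (L i)) ` {..<n} \<subseteq> family"
    and dist: "\<And>i. i < n \<Longrightarrow> distinct (L i)"
  shows "(\<Sum>i<n. if set (L i) \<subseteq> Z then length (L i) else 0) \<le> card (arcs (containment_digraph family))"
proof -
  let ?I = "{i. i < n \<and> set (L i) \<subseteq> Z}"
  let ?g = "\<lambda>(i, x). (set (L i), {x})"
  have fin: "finite family"
    by (simp add: family_def)
  have arcs: "arcs (containment_digraph family) = {(S, T). S \<in> family \<and> T \<in> family \<and> T \<subseteq> S}"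
    by (simp add: containment_digraph_def)
  have "(\<Sum>i<n. if set (L i) \<subseteq> Z then length (L i) else 0) = (\<Sum>i\<in>?I. length (L i))"
    by (rule sum.mono_neutral_cong_right) auto
  also have "\<dots> = (\<Sum>i\<in>?I. card (set (L i)))"
    using dist by (intro sum.cong) (simp_all add: distinct_card)
  also have "\<dots> = card (SIGMA i:?I. set (L i))"
    by (simp add: card_SigmaI)
  also have "\<dots> = card (?g ` (SIGMA i:?I. set (L i)))"
    using inj by (intro card_image[symmetric]) (auto simp: inj_on_def)
  also have "\<dots> \<le> card (arcs (containment_digraph family))"
  proof (rule card_mono)
    show "finite (arcs (containment_digraph family))"
      unfolding arcs by (rule finite_subset[OF _ finite_SigmaI[OF fin fin]]) auto
    show "?g ` (SIGMA i:?I. set (L i)) \<subseteq> arcs (containment_digraph family)"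
      unfolding arcs using fam by (auto simp: Z_def)
  qed
  finally show ?thesis .
qed

text \<open>The factors 2 are due to sets that serve as reward and as penalty. There are at least as
  many arcs as nodes because containment is reflexive and gives every node a loop.\<close>

lemma size_bounds:
  assumes "inj_on (\<lambda>i. set (A i)) {..<h}" "inj_on (\<lambda>j. set (B j)) {..<l}"
  shows "h + l \<le> 2 * card family" "card family \<le> card (arcs (containment_digraph family))"
    "covered_size \<le> 2 * card (arcs (containment_digraph family))"
proof -
  have fin: "finite family"
    by (simp add: family_def)
  have "h \<le> card family" "l \<le> card family"
    using card_mono[OF fin, of "(\<lambda>i. set (A i)) ` {..<h}"] card_mono[OF fin, of "(\<lambda>j. set (B j)) ` {..<l}"]
      card_image[OF assms(1)] card_image[OF assms(2)] by (auto simp: family_def)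
  then show "h + l \<le> 2 * card family"
    by simp
  have "card ((\<lambda>S. (S, S)) ` family) \<le> card (arcs (containment_digraph family))"
  proof (rule card_mono)
    show "finite (arcs (containment_digraph family))"
      unfolding containment_digraph_def by (simp, rule finite_subset[OF _ finite_SigmaI[OF fin fin]]) auto
  qed (auto simp: containment_digraph_def)
  then show "card family \<le> card (arcs (containment_digraph family))"
    by (simp add: card_image inj_on_def)
  show "covered_size \<le> 2 * card (arcs (containment_digraph family))"
    using sum_covered_le[OF assms(1)] sum_covered_le[OF assms(2)] distinct_A distinct_B
    by (simp add: covered_size_def family_def)
qed

end

text \<open>With c = 0 the empty network satisfies the size conditions for all n and m. The flow
  program must halt on it, and no run takes zero steps.\<close>

lemma max_profit_circulation_time_pos:
  assumes "max_profit_circulation_time T"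
  shows "0 < T n m"
proof -
  obtain Q where Q: "\<forall>c. \<exists>d. \<forall>n m D. flow_network D \<and>
      card (verts (graph D)) \<le> c * n \<and> card (arcs (graph D)) \<le> c * m \<longrightarrow>
      (\<exists>t s'. exec Q (network_input D) t s' \<and> t \<le> d * T n m \<and>
         max_profit_circulation D (\<lambda>e. rmem s' ''flow'' e 0))"
    using assms unfolding max_profit_circulation_time_def by blast
  obtain d where d: "\<And>n m D. flow_network D \<Longrightarrow> card (verts (graph D)) \<le> 0 * n \<Longrightarrow>
      card (arcs (graph D)) \<le> 0 * m \<Longrightarrow> \<exists>t s'. exec Q (network_input D) t s' \<and> t \<le> d * T n m"
    using Q[THEN spec[of _ 0]] by blast
  define D where "D = \<lparr>graph = \<lparr>verts = {}, arcs = {}, tail = \<lambda>_. 0, head = \<lambda>_. 0\<rparr>,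
    capacity = \<lambda>_. 0, profit = \<lambda>_. 0\<rparr>"
  have "flow_network D"
    unfolding flow_network_def by (auto simp: D_def intro!: fin_digraph.intro wf_digraph.intro
        fin_digraph_axioms.intro)
  then obtain t s' where "exec Q (network_input D) t s'" "t \<le> d * T n m"
    using d[of D n m] by (auto simp: D_def)
  then show ?thesis
    using exec_time_pos by (metis gr0I leD mult_0_right)
qed

lemma rpsp_output_list_at: "list_at s ''X_size'' ''X_elem'' 0 Xs \<Longrightarrow> rpsp_output s = set Xs"
  by (auto simp: rpsp_output_def list_at_def in_set_conv_nth image_iff)

lemma rpsp_value_eq_gain:
  assumes "\<And>i. i < num_rewards I \<Longrightarrow> A i = reward_set I i" "\<And>j. j < num_penalties I \<Longrightarrow> B j = penalty_set I j"
  shows "rpsp_value I X = gain A (reward I) B (penalty I) {..<num_rewards I} {..<num_penalties I} X"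
proof -
  have "(\<Sum>i | i < num_rewards I \<and> reward_set I i \<inter> X \<noteq> {}. reward I i) =
      (\<Sum>i<num_rewards I. if A i \<inter> X \<noteq> {} then reward I i else 0)"
    using assms(1) by (intro sum.mono_neutral_cong_left) auto
  moreover have "(\<Sum>j | j < num_penalties I \<and> penalty_set I j \<subseteq> X. penalty I j) =
      (\<Sum>j<num_penalties I. if B j \<subseteq> X then penalty I j else 0)"
    using assms(2) by (intro sum.mono_neutral_cong_left) auto
  ultimately show ?thesis
    by (simp add: rpsp_value_def gain_def)
qed

lemma solve_correct:
  assumes I: "rpsp_instance I" "laminar (rpsp_family I)" "inj_on (reward_set I) {..<num_rewards I}"
      "inj_on (penalty_set I) {..<num_penalties I}" "rpsp_input I s"
    and n: "n = card (verts (containment_digraph (rpsp_family I)))"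
    and m: "m = card (arcs (containment_digraph (rpsp_family I)))"
  shows "runs solve s (400 * (m * (n + m)) + 26) (\<lambda>s'. rpsp_optimal I (rpsp_output s'))"
proof -
  let ?h = "num_rewards I" and ?l = "num_penalties I"
  obtain N A B where lists: "enumerates N (ground I)"
      "\<And>i. i < ?h \<Longrightarrow> enumerates (A i) (reward_set I i)"
      "\<And>j. j < ?l \<Longrightarrow> enumerates (B j) (penalty_set I j)"
    and s: "s = \<lparr>nmem = (\<lambda>_ _ _. 0)
              (''h'' := scalar ?h,
               ''l'' := scalar ?l,
               ''N_size'' := sizes 1 (\<lambda>_. N),
               ''N_elem'' := elements 1 (\<lambda>_. N),
               ''N_mem'' := members 1 (\<lambda>_. N),
               ''A_size'' := sizes ?h A,
               ''A_elem'' := elements ?h A,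
               ''A_mem'' := members ?h A,
               ''B_size'' := sizes ?l B,
               ''B_elem'' := elements ?l B,
               ''B_mem'' := members ?l B),
            rmem = (\<lambda>_ _ _. 0)
              (''a'' := vector ?h (reward I),
               ''b'' := vector ?l (penalty I))\<rparr>"
    using I(5) unfolding rpsp_input_def Let_def by blast
  have A: "distinct (A i)" "set (A i) = reward_set I i" if "i < ?h" for i
    using lists(2)[OF that] by (simp_all add: enumerates_def)
  have B: "distinct (B j)" "set (B j) = penalty_set I j" if "j < ?l" for j
    using lists(3)[OF that] by (simp_all add: enumerates_def)
  have fam: "(\<lambda>i. set (A i)) ` {..<?h} \<union> (\<lambda>j. set (B j)) ` {..<?l} = rpsp_family I"
    using A(2) B(2) by (simp add: rpsp_family_def cong: image_cong_simp)
  interpret laminar_lists ?h ?l A B "reward I" "penalty I"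
    by unfold_locales (use A(1) B(1) I(2) fam in auto)
  have family: "family = rpsp_family I"
    using fam by (simp add: family_def)
  have "inj_on (\<lambda>i. set (A i)) {..<?h}" "inj_on (\<lambda>j. set (B j)) {..<?l}"
    using I(3,4) A(2) B(2) by (simp_all add: inj_on_def)
  note bounds = size_bounds[OF this, unfolded family]
  have le: "?h + ?l \<le> 2 * n" "n \<le> m" "covered_size \<le> 2 * m"
    using bounds n m by (simp_all add: containment_digraph_def)
  have "input s"
    using s by (simp add: input_def list_at_def scalar_def sizes_def elements_def members_def vector_def)
  then have "runs solve s ((?h + ?l) * (22 * (?h + ?l) + 72) + covered_size * (8 * (?h + ?l) + 41) + 26)
    (\<lambda>s'. \<exists>Xs. list_at s' ''X_size'' ''X_elem'' 0 Xs \<and> good_selection (set Xs))"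
    by (rule runs_solve) (simp_all add: s)
  then show ?thesis
  proof (rule runs_mono)
    have "(?h + ?l) * (22 * (?h + ?l) + 72) \<le> (2 * n) * (22 * (2 * n) + 72)"
      using le(1) by (intro mult_le_mono) simp_all
    also have "\<dots> \<le> (2 * m) * (22 * (2 * n) + 72)"
      using le(2) by (intro mult_le_mono) simp_all
    also have "\<dots> = 88 * (m * n) + 144 * m"
      by (simp add: algebra_simps)
    finally have 1: "(?h + ?l) * (22 * (?h + ?l) + 72) \<le> 88 * (m * n) + 144 * m" .
    have "covered_size * (8 * (?h + ?l) + 41) \<le> (2 * m) * (16 * n + 41)"
      using le by (intro mult_le_mono) simp_all
    also have "\<dots> = 32 * (m * n) + 82 * m"
      by (simp add: algebra_simps)
    finally have 2: "covered_size * (8 * (?h + ?l) + 41) \<le> 32 * (m * n) + 82 * m" .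
    have 3: "400 * (m * (n + m)) = 400 * (m * n) + 400 * (m * m)"
      by (simp add: algebra_simps)
    \<comment> \<open>This charges the linear terms, 226 m in all, to the term 400 (m * m).\<close>
    have "m \<le> m * m"
      by (cases m) simp_all
    then show "(?h + ?l) * (22 * (?h + ?l) + 72) + covered_size * (8 * (?h + ?l) + 41) + 26 \<le>
        400 * (m * (n + m)) + 26"
      using 1 2 3 by linarith
  next
    fix s' assume "\<exists>Xs. list_at s' ''X_size'' ''X_elem'' 0 Xs \<and> good_selection (set Xs)"
    then obtain X where X: "rpsp_output s' = X" "good_selection X"
      using rpsp_output_list_at by blast
    have "rpsp_value I Y \<le> rpsp_value I X" for Y
      using good_selection_optimal[OF X(2), of Y] I(1)
        rpsp_value_eq_gain[of I "\<lambda>i. set (A i)" "\<lambda>j. set (B j)"] A(2) B(2)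
      by (simp add: rpsp_instance_def)
    moreover have "X \<subseteq> ground I"
    proof -
      have "\<Union>family \<subseteq> ground I"
        using I(1) unfolding family rpsp_family_def rpsp_instance_def by blast
      moreover have "X \<subseteq> \<Union>family"
        using X(2) by (simp add: good_selection_def)
      ultimately show ?thesis
        by (rule order_trans[rotated])
    qed
    ultimately show "rpsp_optimal I (rpsp_output s')"
      using X(1) by (simp add: rpsp_optimal_def)
  qed
qed

theorem mainTheorem3:
  fixes T_MF :: "nat \<Rightarrow> nat \<Rightarrow> nat"
  assumes "max_profit_circulation_time T_MF"
  shows "\<exists>P C. \<forall>I s n m.
    rpsp_instance I \<and> laminar (rpsp_family I) \<and>
    inj_on (reward_set I) {..<num_rewards I} \<and>
    inj_on (penalty_set I) {..<num_penalties I} \<and>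
    n = card (verts (containment_digraph (rpsp_family I))) \<and>
    m = card (arcs (containment_digraph (rpsp_family I))) \<and>
    rpsp_input I s \<longrightarrow>
    (\<exists>t s'. exec P s t s' \<and> t \<le> C * (m * (n + m) + T_MF n m) \<and> rpsp_optimal I (rpsp_output s'))"
proof (rule exI[of _ solve], rule exI[of _ 400], intro allI impI)
  fix I s n m
  assume asm: "rpsp_instance I \<and> laminar (rpsp_family I) \<and>
    inj_on (reward_set I) {..<num_rewards I} \<and>
    inj_on (penalty_set I) {..<num_penalties I} \<and>
    n = card (verts (containment_digraph (rpsp_family I))) \<and>
    m = card (arcs (containment_digraph (rpsp_family I))) \<and>
    rpsp_input I s"
  then have "runs solve s (400 * (m * (n + m)) + 26) (\<lambda>s'. rpsp_optimal I (rpsp_output s'))"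
    by (intro solve_correct) simp_all
  \<comment> \<open>For an empty family the product is 0, and the constant 26 has to be paid by
    \<open>T_MF n m\<close>, which is at least 1.\<close>
  moreover have "400 * (m * (n + m)) + 26 \<le> 400 * (m * (n + m) + T_MF n m)"
    using max_profit_circulation_time_pos[OF assms, of n m] by simp
  ultimately show "\<exists>t s'. exec solve s t s' \<and> t \<le> 400 * (m * (n + m) + T_MF n m) \<and>
      rpsp_optimal I (rpsp_output s')"
    unfolding runs_def by (meson order_trans)
qed

end
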